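(* Let $(X,\oplus,\odot,d)$ be any one of the spaces listed in the context and let $\mathbf L(X)$ be either $\mathcal L(X)$ or $\mathcal L^+(X)$. If $(A_j)_{j\in J}\subset\mathbf L(X)$ is pointwise bounded, i.e. for every $x\in X$ there is $M_x$ with $\|A_j(x)\|_{\mathcal F}=d(A_j(x),\tilde0)\le M_x$ for all $j\in J$, then there exists $M>0$ with $|||A_j|||_{\mathcal F}\le M$ for all $j\in J$.
   Context: Fuzzy numbers $\mathbb{R}_{\mathcal F}$: functions $u:\mathbb{R}\to[0,1]$ that are normal, fuzzy convex, upper semicontinuous, with compact support closure; level sets $[u]^r=[u_-(r),u_+(r)]$; $[u\oplus v]^r=[u]^r+[v]^r$, $[\lambda\odot u]^r=\lambda[u]^r$, $\tilde0=\chi_{\{0\}}$; $D(u,v)=\sup_{r\in[0,1]}\max\{|u_-(r)-v_-(r)|,|u_+(r)-v_+(r)|\}$. The admissible spaces $(X,\oplus,\odot,d)$ (operations pointwise/componentwise): $(\mathbb{R}_{\mathcal F},D)$; $C([a,b];\mathbb{R}_{\mathcal F})$ with sup-metric $D^*$; $L^p([a,b];\mathbb{R}_{\mathcal F})$ ($1\le p<\infty$) with $D_p(f,g)=(\int_a^bD(f,g)^p)^{1/p}$; $C^p([a,b];\mathbb{R}_{\mathcal F})$ with $D_p^*(f,g)=\sum_{i=0}^pD^*(f^{(i)},g^{(i)})$; $l^p_{\mathbb{R}_{\mathcal F}}$ with $\rho_p$; $m_{\mathbb{R}_{\mathcal F}}$, $c_{\mathbb{R}_{\mathcal F}}$, $c^{\tilde0}_{\mathbb{R}_{\mathcal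 F}}$ with $\mu(x,y)=\sup_nD(x_n,y_n)$; finite Cartesian products with max metric. $\|x\|_{\mathcal F}=d(\tilde0,x)$. $\mathcal L^+(X)$: maps $A:X\to X$ additive ($A(x\oplus y)=A(x)\oplus A(y)$), positive homogeneous ($A(\lambda\odot x)=\lambda\odot A(x)$, $\lambda\ge0$) and continuous at every point; $\mathcal L(X)$: maps that are additive, satisfy $A(\lambda\odot x)=\lambda\odot A(x)$ for all $\lambda\in\mathbb{R}$, and are continuous at every point. $|||A|||_{\mathcal F}=\inf\{M>0:\|A(x)\|_{\mathcal F}\le M\|x\|_{\mathcal F}\ \forall x\}$. *)

theory Defs
  imports "HOL-Analysis.Analysis"
begin

text \<open>A fuzzy number is represented by its membership function u : real -> real
  (values in [0,1]).\<close>

type_synonym fz = "real \<Rightarrow> real"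

definition fuzzy_number :: "fz \<Rightarrow> bool" where
  "fuzzy_number u \<longleftrightarrow>
     (\<forall>x. 0 \<le> u x \<and> u x \<le> 1) \<and>
     (\<exists>x. u x = 1) \<and>
     (\<forall>x y t. 0 \<le> t \<and> t \<le> 1 \<longrightarrow> min (u x) (u y) \<le> u ((1 - t) * x + t * y)) \<and>
     (\<forall>x. \<forall>e>0. \<exists>d>0. \<forall>y. \<bar>y - x\<bar> < d \<longrightarrow> u y < u x + e) \<and>
     compact (closure {x. 0 < u x})"

definition lev :: "fz \<Rightarrow> real \<Rightarrow> real set" where
  "lev u r = (if r = 0 then closure {x. 0 < u x} else {x. r \<le> u x})"

definition lower :: "fz \<Rightarrow> real \<Rightarrow> real" where
  "lower u r = Inf (lev u r)"

definition upper :: "fz \<Rightarrow> real \<Rightarrow> real" where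
  "upper u r = Sup (lev u r)"

definition fz_zero :: fz where
  "fz_zero = (\<lambda>x. if x = 0 then 1 else 0)"

text \<open>Addition and scalar multiplication (Zadeh extension principle; on fuzzy
  numbers these satisfy [u+v]^r = [u]^r + [v]^r and [c u]^r = c [u]^r).\<close>
definition fz_add :: "fz \<Rightarrow> fz \<Rightarrow> fz" where
  "fz_add u v = (\<lambda>x. Sup (range (\<lambda>y. min (u y) (v (x - y)))))"

definition fz_smul :: "real \<Rightarrow> fz \<Rightarrow> fz" where
  "fz_smul c u = (if c = 0 then fz_zero else (\<lambda>x. u (x / c)))"

definition fz_dist :: "fz \<Rightarrow> fz \<Rightarrow> real" where
  "fz_dist u v = Sup ((\<lambda>r. max \<bar>lower u r - lower v r\<bar> \<bar>upper u r - upper v r\<bar>) ` {0..1})"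

text \<open>A universal carrier type for all admissible spaces.\<close>
datatype felem = FNum (fnum: fz) | FFun (ffun: "real \<Rightarrow> fz")
  | FSeq (fseq: "nat \<Rightarrow> fz") | FTup (ftup: "felem list")

record fspace =
  carrier :: "felem set"
  fadd :: "felem \<Rightarrow> felem \<Rightarrow> felem"
  fsmul :: "real \<Rightarrow> felem \<Rightarrow> felem"
  fdist :: "felem \<Rightarrow> felem \<Rightarrow> real"
  fzero :: felem

definition RF_space :: fspace where
  "RF_space = \<lparr>carrier = FNum ` {u. fuzzy_number u},
     fadd = (\<lambda>x y. FNum (fz_add (fnum x) (fnum y))),
     fsmul = (\<lambda>c x. FNum (fz_smul c (fnum x))),
     fdist = (\<lambda>x y. fz_dist (fnum x) (fnum y)),
     fzero = FNum fz_zero\<rparr>"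

definition fun_space :: "(real \<Rightarrow> fz) set \<Rightarrow> ((real \<Rightarrow> fz) \<Rightarrow> (real \<Rightarrow> fz) \<Rightarrow> real) \<Rightarrow> fspace" where
  "fun_space K dst = \<lparr>carrier = FFun ` K,
     fadd = (\<lambda>x y. FFun (\<lambda>t. fz_add (ffun x t) (ffun y t))),
     fsmul = (\<lambda>c x. FFun (\<lambda>t. fz_smul c (ffun x t))),
     fdist = (\<lambda>x y. dst (ffun x) (ffun y)),
     fzero = FFun (\<lambda>t. fz_zero)\<rparr>"

definition seq_space :: "(nat \<Rightarrow> fz) set \<Rightarrow> ((nat \<Rightarrow> fz) \<Rightarrow> (nat \<Rightarrow> fz) \<Rightarrow> real) \<Rightarrow> fspace" where
  "seq_space K dst = \<lparr>carrier = FSeq ` K,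
     fadd = (\<lambda>x y. FSeq (\<lambda>n. fz_add (fseq x n) (fseq y n))),
     fsmul = (\<lambda>c x. FSeq (\<lambda>n. fz_smul c (fseq x n))),
     fdist = (\<lambda>x y. dst (fseq x) (fseq y)),
     fzero = FSeq (\<lambda>n. fz_zero)\<rparr>"

definition fuzzy_fun_on :: "real \<Rightarrow> real \<Rightarrow> (real \<Rightarrow> fz) \<Rightarrow> bool" where
  "fuzzy_fun_on a b f \<longleftrightarrow> (\<forall>t\<in>{a..b}. fuzzy_number (f t)) \<and> (\<forall>t. t \<notin> {a..b} \<longrightarrow> f t = fz_zero)"

definition C_car :: "real \<Rightarrow> real \<Rightarrow> (real \<Rightarrow> fz) set" where
  "C_car a b = {f. fuzzy_fun_on a b f \<and>
     (\<forall>t\<in>{a..b}. \<forall>e>0. \<exists>d>0. \<forall>s\<in>{a..b}. \<bar>s - t\<bar> < d \<longrightarrow> fz_dist (f s) (f t) < e)}"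

definition Dstar :: "real \<Rightarrow> real \<Rightarrow> (real \<Rightarrow> fz) \<Rightarrow> (real \<Rightarrow> fz) \<Rightarrow> real" where
  "Dstar a b f g = Sup ((\<lambda>t. fz_dist (f t) (g t)) ` {a..b})"

definition C_space :: "real \<Rightarrow> real \<Rightarrow> fspace" where
  "C_space a b = fun_space (C_car a b) (Dstar a b)"

text \<open>f is Hukuhara differentiable at t (relative to [a,b], one-sided at the
  endpoints) with derivative w.\<close>
definition has_hderiv :: "real \<Rightarrow> real \<Rightarrow> (real \<Rightarrow> fz) \<Rightarrow> fz \<Rightarrow> real \<Rightarrow> bool" where
  "has_hderiv a b f w t \<longleftrightarrow> fuzzy_number w \<and>
     (\<forall>e>0. \<exists>d>0. \<forall>h. 0 < h \<and> h < d \<longrightarrow>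
        (t + h \<in> {a..b} \<longrightarrow> (\<exists>z. fuzzy_number z \<and> f (t + h) = fz_add (f t) z
                                   \<and> fz_dist (fz_smul (1 / h) z) w < e)) \<and>
        (t - h \<in> {a..b} \<longrightarrow> (\<exists>z. fuzzy_number z \<and> f t = fz_add (f (t - h)) z
                                   \<and> fz_dist (fz_smul (1 / h) z) w < e)))"

definition hderiv :: "real \<Rightarrow> real \<Rightarrow> (real \<Rightarrow> fz) \<Rightarrow> (real \<Rightarrow> fz)" where
  "hderiv a b f = (\<lambda>t. if t \<in> {a..b} then (SOME w. has_hderiv a b f w t) else fz_zero)"

definition Cp_car :: "real \<Rightarrow> real \<Rightarrow> nat \<Rightarrow> (real \<Rightarrow> fz) set" where
  "Cp_car a b p = {f. (\<forall>i<p. \<forall>t\<in>{a..b}. \<exists>w. has_hderiv a b ((hderiv a b ^^ i) f) w t) \<and>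
                      (\<forall>i\<le>p. (hderiv a b ^^ i) f \<in> C_car a b)}"

definition Dpstar :: "real \<Rightarrow> real \<Rightarrow> nat \<Rightarrow> (real \<Rightarrow> fz) \<Rightarrow> (real \<Rightarrow> fz) \<Rightarrow> real" where
  "Dpstar a b p f g = (\<Sum>i\<le>p. Dstar a b ((hderiv a b ^^ i) f) ((hderiv a b ^^ i) g))"

definition Cp_space :: "real \<Rightarrow> real \<Rightarrow> nat \<Rightarrow> fspace" where
  "Cp_space a b p = fun_space (Cp_car a b p) (Dpstar a b p)"

text \<open>Elements are represented by (level-wise Lebesgue measurable) functions; D_p is then
  a pseudometric, functions at D_p-distance 0 representing the same element.\<close>
definition Lp_car :: "real \<Rightarrow> real \<Rightarrow> real \<Rightarrow> (real \<Rightarrow> fz) set" where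
  "Lp_car a b p = {f. fuzzy_fun_on a b f \<and>
     (\<forall>r\<in>{0..1}. (\<lambda>t. lower (f t) r) \<in> borel_measurable (restrict_space lebesgue {a..b}) \<and>
                 (\<lambda>t. upper (f t) r) \<in> borel_measurable (restrict_space lebesgue {a..b})) \<and>
     (\<integral>\<^sup>+ t \<in> {a..b}. ennreal (fz_dist (f t) fz_zero powr p) \<partial>lebesgue) < \<infinity>}"

definition Dp :: "real \<Rightarrow> real \<Rightarrow> real \<Rightarrow> (real \<Rightarrow> fz) \<Rightarrow> (real \<Rightarrow> fz) \<Rightarrow> real" where
  "Dp a b p f g = (enn2real (\<integral>\<^sup>+ t \<in> {a..b}. ennreal (fz_dist (f t) (g t) powr p) \<partial>lebesgue)) powr (1 / p)"

definition Lp_space :: "real \<Rightarrow> real \<Rightarrow> real \<Rightarrow> fspace" where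
  "Lp_space a b p = fun_space (Lp_car a b p) (Dp a b p)"

definition lp_space :: "real \<Rightarrow> fspace" where
  "lp_space p = seq_space
     {x. (\<forall>n. fuzzy_number (x n)) \<and> summable (\<lambda>n. fz_dist (x n) fz_zero powr p)}
     (\<lambda>x y. (\<Sum>n. fz_dist (x n) (y n) powr p) powr (1 / p))"

definition mu :: "(nat \<Rightarrow> fz) \<Rightarrow> (nat \<Rightarrow> fz) \<Rightarrow> real" where
  "mu x y = Sup (range (\<lambda>n. fz_dist (x n) (y n)))"

definition m_space :: fspace where
  "m_space = seq_space
     {x. (\<forall>n. fuzzy_number (x n)) \<and> (\<exists>B. \<forall>n. fz_dist (x n) fz_zero \<le> B)} mu"

definition c_space :: fspace where
  "c_space = seq_space
     {x. (\<forall>n. fuzzy_number (x n)) \<and>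
         (\<exists>u. fuzzy_number u \<and> (\<forall>e>0. \<exists>N. \<forall>n\<ge>N. fz_dist (x n) u < e))} mu"

definition c0_space :: fspace where
  "c0_space = seq_space
     {x. (\<forall>n. fuzzy_number (x n)) \<and> (\<forall>e>0. \<exists>N. \<forall>n\<ge>N. fz_dist (x n) fz_zero < e)} mu"

definition prod_space :: "fspace list \<Rightarrow> fspace" where
  "prod_space Ss = \<lparr>carrier = {FTup xs | xs. length xs = length Ss \<and>
                                 (\<forall>i<length Ss. xs ! i \<in> carrier (Ss ! i))},
     fadd = (\<lambda>x y. FTup (map (\<lambda>i. fadd (Ss ! i) (ftup x ! i) (ftup y ! i)) [0..<length Ss])),
     fsmul = (\<lambda>c x. FTup (map (\<lambda>i. fsmul (Ss ! i) c (ftup x ! i)) [0..<length Ss])),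
     fdist = (\<lambda>x y. Max ((\<lambda>i. fdist (Ss ! i) (ftup x ! i) (ftup y ! i)) ` {..<length Ss})),
     fzero = FTup (map fzero Ss)\<rparr>"

inductive base_space :: "fspace \<Rightarrow> bool" where
  "base_space RF_space"
| "a < b \<Longrightarrow> base_space (C_space a b)"
| "a < b \<Longrightarrow> 1 \<le> p \<Longrightarrow> base_space (Lp_space a b p)"
| "a < b \<Longrightarrow> 1 \<le> p \<Longrightarrow> base_space (Cp_space a b p)"
| "1 \<le> p \<Longrightarrow> base_space (lp_space p)"
| "base_space m_space"
| "base_space c_space"
| "base_space c0_space"

definition admissible_space :: "fspace \<Rightarrow> bool" where
  "admissible_space S \<longleftrightarrow> base_space S \<or>
     (\<exists>Ss. Ss \<noteq> [] \<and> (\<forall>T\<in>set Ss. base_space T) \<and> S = prod_space Ss)"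

definition fnorm :: "fspace \<Rightarrow> felem \<Rightarrow> real" where
  "fnorm S x = fdist S (fzero S) x"

definition cont_at :: "fspace \<Rightarrow> (felem \<Rightarrow> felem) \<Rightarrow> felem \<Rightarrow> bool" where
  "cont_at S A x \<longleftrightarrow> (\<forall>e>0. \<exists>d>0. \<forall>y\<in>carrier S. fdist S y x < d \<longrightarrow> fdist S (A y) (A x) < e)"

text \<open>Equalities are taken modulo the (pseudo)metric, i.e. d(.,.) = 0; for all spaces but
  L^p this is literal equality of elements.\<close>
definition Lplus_op :: "fspace \<Rightarrow> (felem \<Rightarrow> felem) \<Rightarrow> bool" where
  "Lplus_op S A \<longleftrightarrow> A ` carrier S \<subseteq> carrier S \<and>
     (\<forall>x\<in>carrier S. \<forall>y\<in>carrier S. fdist S (A (fadd S x y)) (fadd S (A x) (A y)) = 0) \<and>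
     (\<forall>c\<ge>0. \<forall>x\<in>carrier S. fdist S (A (fsmul S c x)) (fsmul S c (A x)) = 0) \<and>
     (\<forall>x\<in>carrier S. cont_at S A x)"

definition L_op :: "fspace \<Rightarrow> (felem \<Rightarrow> felem) \<Rightarrow> bool" where
  "L_op S A \<longleftrightarrow> A ` carrier S \<subseteq> carrier S \<and>
     (\<forall>x\<in>carrier S. \<forall>y\<in>carrier S. fdist S (A (fadd S x y)) (fadd S (A x) (A y)) = 0) \<and>
     (\<forall>c. \<forall>x\<in>carrier S. fdist S (A (fsmul S c x)) (fsmul S c (A x)) = 0) \<and>
     (\<forall>x\<in>carrier S. cont_at S A x)"

definition opnorm :: "fspace \<Rightarrow> (felem \<Rightarrow> felem) \<Rightarrow> real" where
  "opnorm S A = Inf {M. M > 0 \<and> (\<forall>x\<in>carrier S. fnorm S (A x) \<le> M * fnorm S x)}"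

end

theory Submission
  imports Defs
begin

text \<open>The proof is a gliding hump argument adapted to cones without subtraction.  If the operator
  bounds were unbounded, one picks operators \<open>A (j n)\<close> with huge bound and elements \<open>x n\<close> of norm at
  most \<open>(1/512)^n\<close> such that \<open>A (j n)\<close> is large at the partial sum through \<open>x n\<close>; since the tail of the series is
  much smaller than its leading term, \<open>A (j n)\<close> is also large at the full sum, contradicting pointwise
  boundedness there.  All that is needed of a space is that rapidly decreasing series converge.
  A fuzzy number is determined by the two level functions \<open>lower u\<close> and \<open>upper u\<close>, whose
  characteristic semicontinuity survives uniform limits, so an absolutely convergent series of
  fuzzy numbers can be summed levelwise, and every space in question is summed pointwise.\<close>

subsection \<open>Level functions of fuzzy numbers\<close>

text \<open>The obstacle is the missing subtraction. A Baire category argument would compare values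
  of an operator at differences, and completeness alone would yield a limit with no way to write it
  as a partial sum plus a remainder on which additivity of the operator could act. The condition
  imposed on a space is therefore that remainders exist inside the cone. What replaces subtraction
  is translation invariance of the distance, \<open>d (add w x) (add w y) = d x y\<close>: it turns
  the norm of a summand into the distance between two sums. Remainders are available because sums of
  fuzzy numbers are formed level by level, where the head of a series can be split off exactly.
  Identities between elements are used only up to distance zero, because elements of L^p are
  functions rather than classes; continuity makes operators respect distance zero.\<close>

text \<open>Monotone on [0,1], left continuous on (0,1] and right continuous at 0: the classical
  characterisation of endpoint functions of a fuzzy number, applied to \<open>lower u\<close> and to
  the negative of \<open>upper u\<close>. One inequality per one-sided limit is enough, since
  monotonicity gives the other.\<close>

definition level_fun :: "(real \<Rightarrow> real) \<Rightarrow> bool" where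
  "level_fun l \<longleftrightarrow> mono_on {0..1} l \<and>
     (\<forall>r e. 0 < r \<and> r \<le> 1 \<and> 0 < e \<longrightarrow> (\<exists>s. 0 < s \<and> s < r \<and> l r - e < l s)) \<and>
     (\<forall>e>0. \<exists>s. 0 < s \<and> s \<le> 1 \<and> l s < l 0 + e)"

lemma level_fun_mono: "level_fun l \<Longrightarrow> 0 \<le> r \<Longrightarrow> r \<le> s \<Longrightarrow> s \<le> 1 \<Longrightarrow> l r \<le> l s"
  unfolding level_fun_def mono_on_def by auto

lemma level_fun_left: 
  assumes "level_fun l" "0 < r" "r \<le> 1" "0 < e"
  obtains s where "0 < s" "s < r" "\<And>s'. s \<le> s' \<Longrightarrow> s' \<le> 1 \<Longrightarrow> l r - e < l s'"
proof -
  obtain s where s: "0 < s" "s < r" "l r - e < l s"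
    using assms unfolding level_fun_def by blast
  show ?thesis
    by (rule that[of s]) (use s level_fun_mono[OF assms(1), of s] in \<open>auto intro: less_le_trans\<close>)
qed

lemma level_fun_right0: 
  assumes "level_fun l" "0 < e"
  obtains s where "0 < s" "s \<le> 1" "\<And>s'. 0 \<le> s' \<Longrightarrow> s' \<le> s \<Longrightarrow> l s' < l 0 + e"
proof -
  obtain s where s: "0 < s" "s \<le> 1" "l s < l 0 + e"
    using assms unfolding level_fun_def by blast
  show ?thesis
    by (rule that[of s]) (use s level_fun_mono[OF assms(1), of _ s] in \<open>auto intro: le_less_trans\<close>)
qed

lemma level_fun_const: "level_fun (\<lambda>r. c)"
  unfolding level_fun_def
proof (intro conjI allI impI)
  show "mono_on {0..1} (\<lambda>r. c)" by (simp add: mono_on_def)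
  show "\<exists>s>0. s < r \<and> c - e < c" if "0 < r \<and> r \<le> 1 \<and> 0 < e" for r e :: real
    using that by (intro exI[of _ "r / 2"]) simp
  show "\<exists>s>0::real. s \<le> 1 \<and> c < c + e" if "0 < e" for e :: real
    using that by (intro exI[of _ 1]) simp
qed

lemma level_fun_add:
  assumes "level_fun l" "level_fun m"
  shows "level_fun (\<lambda>r. l r + m r)"
  unfolding level_fun_def
proof (intro conjI allI impI)
  show "mono_on {0..1} (\<lambda>r. l r + m r)"
    using assms level_fun_mono[of l] level_fun_mono[of m] by (auto simp: mono_on_def intro!: add_mono)
next
  fix r e :: real assume "0 < r \<and> r \<le> 1 \<and> 0 < e"
  then have h: "0 < r" "r \<le> 1" "0 < e / 2" by auto
  obtain s1 where 1: "0 < s1" "s1 < r" "\<And>s'. s1 \<le> s' \<Longrightarrow> s' \<le> 1 \<Longrightarrow> l r - e/2 < l s'"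
    using level_fun_left[OF assms(1) h] by blast
  obtain s2 where 2: "0 < s2" "s2 < r" "\<And>s'. s2 \<le> s' \<Longrightarrow> s' \<le> 1 \<Longrightarrow> m r - e/2 < m s'"
    using level_fun_left[OF assms(2) h] by blast
  show "\<exists>s. 0 < s \<and> s < r \<and> l r + m r - e < l s + m s"
    using 1(1,2) 2(1,2) 1(3)[of "max s1 s2"] 2(3)[of "max s1 s2"] h
    by (intro exI[of _ "max s1 s2"]) (auto simp: field_simps)
next
  fix e :: real assume "0 < e"
  then have h: "0 < e / 2" by auto
  obtain s1 where 1: "0 < s1" "s1 \<le> 1" "\<And>s'. 0 \<le> s' \<Longrightarrow> s' \<le> s1 \<Longrightarrow> l s' < l 0 + e/2"
    using level_fun_right0[OF assms(1) h] by blast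
  obtain s2 where 2: "0 < s2" "s2 \<le> 1" "\<And>s'. 0 \<le> s' \<Longrightarrow> s' \<le> s2 \<Longrightarrow> m s' < m 0 + e/2"
    using level_fun_right0[OF assms(2) h] by blast
  show "\<exists>s. 0 < s \<and> s \<le> 1 \<and> l s + m s < l 0 + m 0 + e"
    using 1(1,2) 2(1,2) 1(3)[of "min s1 s2"] 2(3)[of "min s1 s2"]
    by (intro exI[of _ "min s1 s2"]) (auto simp: field_simps)
qed

lemma level_fun_cmult:
  assumes "level_fun l" "0 \<le> c"
  shows "level_fun (\<lambda>r. c * l r)"
proof (cases "c = 0")
  case True then show ?thesis using level_fun_const[of 0] by simp
next
  case False
  then have c: "0 < c" using assms by simp
  show ?thesis
    unfolding level_fun_def
  proof (intro conjI allI impI)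
    show "mono_on {0..1} (\<lambda>r. c * l r)"
      using assms level_fun_mono[of l] by (auto simp: mono_on_def intro!: mult_left_mono)
  next
    fix r e :: real assume h: "0 < r \<and> r \<le> 1 \<and> 0 < e"
    then obtain s where "0 < s" "s < r" "l r - e / c < l s"
      using level_fun_left[OF assms(1), of r "e / c"] c by (metis divide_pos_pos less_eq_real_def less_le_trans)
    then show "\<exists>s. 0 < s \<and> s < r \<and> c * l r - e < c * l s"
      using c by (intro exI[of _ s]) (auto simp: field_simps)
  next
    fix e :: real assume h: "0 < e"
    then obtain s where "0 < s" "s \<le> 1" "l s < l 0 + e / c"
      using level_fun_right0[OF assms(1), of "e / c"] c by (metis divide_pos_pos less_eq_real_def)
    then show "\<exists>s. 0 < s \<and> s \<le> 1 \<and> c * l s < c * l 0 + e"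
      using c by (intro exI[of _ s]) (auto simp: field_simps)
  qed
qed

text \<open>All three conditions are inequalities up to an arbitrary \<open>e\<close>, and one
  approximant within a fraction of \<open>e\<close> transfers each of them. This is where
  completeness of the fuzzy numbers comes from.\<close>

lemma level_fun_uniform_limit:
  assumes "\<And>e. 0 < e \<Longrightarrow> \<exists>m. level_fun m \<and> (\<forall>r\<in>{0..1}. \<bar>l r - m r\<bar> < e)"
  shows "level_fun l"
  unfolding level_fun_def
proof (intro conjI allI impI)
  show "mono_on {0..1} l"
    unfolding mono_on_def
  proof (intro allI impI)
    fix r s :: real assume h: "r \<in> {0..1} \<and> s \<in> {0..1} \<and> r \<le> s"
    show "l r \<le> l s"
    proof (rule field_le_epsilon)
      fix e :: real assume "0 < e"
      then obtain m where m: "level_fun m" "\<forall>r\<in>{0..1}. \<bar>l r - m r\<bar> < e / 2"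
        using assms[of "e/2"] by auto
      have "\<bar>l r - m r\<bar> < e / 2" "\<bar>l s - m s\<bar> < e / 2" "m r \<le> m s"
        using m h level_fun_mono by auto
      then show "l r \<le> l s + e" by linarith
    qed
  qed
next
  fix r e :: real assume h: "0 < r \<and> r \<le> 1 \<and> 0 < e"
  then obtain m where m: "level_fun m" "\<And>r. 0 \<le> r \<Longrightarrow> r \<le> 1 \<Longrightarrow> \<bar>l r - m r\<bar> < e / 3"
    using assms[of "e/3"] by auto
  obtain s where "0 < s" "s < r" "m r - e / 3 < m s"
    using level_fun_left[OF m(1), of r "e / 3"] h by (metis divide_pos_pos less_eq_real_def less_le_trans zero_less_numeral)
  moreover have "\<bar>l r - m r\<bar> < e / 3" "\<bar>l s - m s\<bar> < e / 3"
    using m(2) h calculation by auto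
  ultimately show "\<exists>s. 0 < s \<and> s < r \<and> l r - e < l s"
    by (intro exI[of _ s] conjI) linarith+
next
  fix e :: real assume h: "0 < e"
  then obtain m where m: "level_fun m" "\<And>r. 0 \<le> r \<Longrightarrow> r \<le> 1 \<Longrightarrow> \<bar>l r - m r\<bar> < e / 3"
    using assms[of "e/3"] by auto
  obtain s where "0 < s" "s \<le> 1" "m s < m 0 + e / 3"
    using level_fun_right0[OF m(1), of "e / 3"] h by (metis divide_pos_pos less_eq_real_def zero_less_numeral)
  moreover have "\<bar>l 0 - m 0\<bar> < e / 3" "\<bar>l s - m s\<bar> < e / 3"
    using m(2) h calculation by auto
  ultimately show "\<exists>s. 0 < s \<and> s \<le> 1 \<and> l s < l 0 + e"
    by (intro exI[of _ s] conjI) linarith+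
qed

text \<open>The degenerate uniform limit, with the same approximant \<open>l\<close> for every
  \<open>e\<close>; values outside [0,1] do not enter \<open>level_fun\<close>.\<close>

lemma level_fun_cong:
  assumes "level_fun l" "\<And>r. 0 \<le> r \<Longrightarrow> r \<le> 1 \<Longrightarrow> l r = m r"
  shows "level_fun m"
  by (rule level_fun_uniform_limit) (use assms in \<open>intro exI[of _ l], auto\<close>)

section \<open>Fuzzy numbers and their level intervals\<close>

text \<open>A common interface for zero, multiples, sums and the reconstruction from levels: once
  the positive level sets of \<open>v\<close> are known to be intervals with good endpoints, the
  rest follows. Level 0 is kept out of \<open>level_iff\<close> because it is defined by a
  closure.\<close>

locale level_representation =
  fixes l m :: "real \<Rightarrow> real" and v :: fz
  assumes level_lower: "level_fun l" and level_upper: "level_fun (\<lambda>r. - m r)"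
    and core: "l 1 \<le> m 1"
    and range01: "\<And>x. 0 \<le> v x" "\<And>x. v x \<le> 1"
    and level_iff: "\<And>r x. 0 < r \<Longrightarrow> r \<le> 1 \<Longrightarrow> r \<le> v x \<longleftrightarrow> l r \<le> x \<and> x \<le> m r"
begin

lemma lower_mono: "0 \<le> r \<Longrightarrow> r \<le> s \<Longrightarrow> s \<le> 1 \<Longrightarrow> l r \<le> l s"
  using level_fun_mono[OF level_lower] .

lemma upper_antimono: "0 \<le> r \<Longrightarrow> r \<le> s \<Longrightarrow> s \<le> 1 \<Longrightarrow> m s \<le> m r"
  using level_fun_mono[OF level_upper, of r s] by simp

lemma lower_le_upper: "0 \<le> r \<Longrightarrow> r \<le> 1 \<Longrightarrow> l r \<le> m r"
  using lower_mono[of r 1] upper_antimono[of r 1] core by linarith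

lemma support_closure: "closure {x. 0 < v x} = {l 0..m 0}"
proof (rule antisym)
  have "x \<in> {l 0..m 0}" if "0 < v x" for x
    using level_iff[OF that, of x] range01(2)[of x] lower_mono[of 0 "v x"] upper_antimono[of 0 "v x"] that by auto
  then show "closure {x. 0 < v x} \<subseteq> {l 0..m 0}"
    by (intro closure_minimal) auto
  show "{l 0..m 0} \<subseteq> closure {x. 0 < v x}"
  proof
    fix x assume x: "x \<in> {l 0..m 0}"
    show "x \<in> closure {x. 0 < v x}"
      unfolding closure_approachable
    proof (intro allI impI)
      fix e :: real assume e: "0 < e"
      obtain s1 where 1: "0 < s1" "s1 \<le> 1" "\<And>s'. 0 \<le> s' \<Longrightarrow> s' \<le> s1 \<Longrightarrow> l s' < l 0 + e"
        using level_fun_right0[OF level_lower e] by blast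
      obtain s2 where 2: "0 < s2" "s2 \<le> 1" "\<And>s'. 0 \<le> s' \<Longrightarrow> s' \<le> s2 \<Longrightarrow> - m s' < - m 0 + e"
        using level_fun_right0[OF level_upper e] by blast
      define s where "s = min s1 s2"
      have s: "0 < s" "s \<le> 1" "l s < l 0 + e" "m 0 - e < m s"
        using 1(1,2) 2(1,2) 1(3)[of s] 2(3)[of s] by (auto simp: s_def)
      \<comment> \<open>\<open>y\<close> is \<open>x\<close> clamped to the level interval at
        \<open>s\<close>; the endpoints of that interval are within \<open>e\<close> of
        \<open>l 0\<close> and \<open>m 0\<close>, so the point moves by less than
        \<open>e\<close>.\<close>
      define y where "y = max (l s) (min x (m s))"
      have "s \<le> v y"
        using level_iff[of s y] s lower_le_upper[of s] by (auto simp: y_def)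
      moreover have "dist y x < e"
        using s x e by (auto simp: y_def dist_real_def)
      ultimately show "\<exists>y\<in>{x. 0 < v x}. dist y x < e"
        using s(1) by (intro bexI[of _ y]) auto
    qed
  qed
qed

lemma lev_eq: "0 \<le> r \<Longrightarrow> r \<le> 1 \<Longrightarrow> lev v r = {l r..m r}"
  using support_closure level_iff by (auto simp: lev_def)

lemma lower_eq: "0 \<le> r \<Longrightarrow> r \<le> 1 \<Longrightarrow> lower v r = l r"
  and upper_eq: "0 \<le> r \<Longrightarrow> r \<le> 1 \<Longrightarrow> upper v r = m r"
  using lower_le_upper lev_eq by (auto simp: lower_def upper_def)

text \<open>Normality comes from \<open>core\<close>, fuzzy convexity from convexity of the interval
  at the smaller membership value, and semicontinuity from closedness of the interval at height
  \<open>v x + e\<close>, which misses \<open>x\<close>.\<close>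

lemma fuzzy_number: "fuzzy_number v"
  unfolding fuzzy_number_def
proof (intro conjI allI impI)
  show "0 \<le> v x" "v x \<le> 1" for x using range01 by auto
  have "1 \<le> v (l 1)" using level_iff[of 1 "l 1"] core by auto
  then show "\<exists>x. v x = 1" using range01(2)[of "l 1"] by (intro exI[of _ "l 1"]) auto
  show "compact (closure {x. 0 < v x})" unfolding support_closure by simp
next
  fix x y t :: real assume t: "0 \<le> t \<and> t \<le> 1"
  define r where "r = min (v x) (v y)"
  show "r \<le> v ((1 - t) * x + t * y)"
  proof (cases "0 < r")
    case True
    have r: "r \<le> 1" "r \<le> v x" "r \<le> v y" using range01(2)[of x] by (auto simp: r_def)
    then have "x \<in> {l r..m r}" "y \<in> {l r..m r}" using level_iff True by auto
    then have "(1 - t) * x + t * y \<in> {l r..m r}"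
      using convexD[OF convex_real_interval(5)[of "l r" "m r"], of x y "1 - t" t] t by auto
    then show ?thesis using level_iff[OF True r(1)] by auto
  qed (use range01(1)[of "(1 - t) * x + t * y"] in linarith)
next
  fix x e :: real assume e: "0 < e"
  show "\<exists>d>0. \<forall>y. \<bar>y - x\<bar> < d \<longrightarrow> v y < v x + e"
  proof (cases "v x + e \<le> 1")
    case True
    define r where "r = v x + e"
    have r: "0 < r" "r \<le> 1" using True e range01(1)[of x] by (auto simp: r_def)
    have "x \<notin> {l r..m r}" using level_iff[OF r, of x] e by (auto simp: r_def)
    then have "open (- {l r..m r})" "x \<in> - {l r..m r}" by auto
    then obtain d where d: "d > 0" "\<And>y. dist y x < d \<Longrightarrow> y \<in> - {l r..m r}"
      unfolding open_dist by blast
    show ?thesis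
    proof (intro exI[of _ d] conjI allI impI)
      fix y assume "\<bar>y - x\<bar> < d"
      then have "y \<notin> {l r..m r}" using d(2)[of y] by (auto simp: dist_real_def)
      then show "v y < v x + e" using level_iff[OF r, of y] by (auto simp: r_def not_le)
    qed fact
  next
    case False
    then have "\<forall>y. v y < v x + e" using range01(2) by (meson le_less_trans not_le)
    then show ?thesis by (intro exI[of _ 1]) auto
  qed
qed

end

text \<open>A level set is closed by upper semicontinuity, bounded by the compact support, convex by
  fuzzy convexity and nonempty by normality, hence a compact interval with its infimum and supremum
  as endpoints.\<close>

lemma fuzzy_number_lev:
  assumes u: "fuzzy_number u" and r: "0 \<le> r" "r \<le> 1"
  shows "lev u r = {lower u r..upper u r}" "lower u r \<le> upper u r"
proof -
  have bd: "0 \<le> u x" "u x \<le> 1" for x using u by (auto simp: fuzzy_number_def)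
  have cv: "min (u x) (u y) \<le> u ((1 - t) * x + t * y)" if "0 \<le> t" "t \<le> 1" for x y t
    using u that by (auto simp: fuzzy_number_def)
  have cmp: "compact (closure {x. 0 < u x})" using u by (auto simp: fuzzy_number_def)
  obtain x1 where x1: "u x1 = 1" using u by (auto simp: fuzzy_number_def)
  have conv: "convex {x. s \<le> u x}" "convex {x. s < u x}" for s
    unfolding convex_alt using cv by (auto, (smt (verit) min_def)+)
  have cl: "closed {x. s \<le> u x}" for s
    unfolding closed_def open_dist
  proof
    fix x assume "x \<in> - {x. s \<le> u x}"
    then have "s - u x > 0" by auto
    then obtain d where "d>0" "\<forall>y. \<bar>y - x\<bar> < d \<longrightarrow> u y < u x + (s - u x)"
      using u unfolding fuzzy_number_def by blast
    then show "\<exists>e>0. \<forall>y. dist y x < e \<longrightarrow> y \<in> - {x. s \<le> u x}"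
      by (intro exI[of _ d]) (auto simp: dist_real_def not_le)
  qed
  have "x1 \<in> lev u r" using x1 r closure_subset[of "{x. 0 < u x}"]
    by (auto simp: lev_def)
  then have ne: "lev u r \<noteq> {}" by blast
  have c: "compact (lev u r)"
  proof (cases "r = 0")
    case False
    then have "{x. r \<le> u x} \<subseteq> closure {x. 0 < u x}"
      using r closure_subset[of "{x. 0 < u x}"] by auto
    then have "compact (closure {x. 0 < u x} \<inter> {x. r \<le> u x})" using cmp cl by blast
    with \<open>_ \<subseteq> _\<close> show ?thesis using False by (simp add: lev_def Int_absorb1)
  next
    case True
    then show ?thesis using cmp by (simp only: lev_def if_True simp_thms)
  qed
  have "convex (lev u r)" using conv convex_closure by (auto simp: lev_def)
  then have "connected (lev u r)" by (rule convex_connected)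
  then obtain p q where pq: "lev u r = {p..q}"
    using connected_compact_interval_1[of "lev u r"] c by (auto simp: cbox_interval)
  then have "p \<le> q" using ne by auto
  then show "lev u r = {lower u r..upper u r}" "lower u r \<le> upper u r"
    unfolding lower_def upper_def using pq by auto
qed

lemma fuzzy_number_level_iff:
  assumes "fuzzy_number u" "0 < r" "r \<le> 1"
  shows "r \<le> u x \<longleftrightarrow> lower u r \<le> x \<and> x \<le> upper u r"
  using fuzzy_number_lev(1)[OF assms(1), of r] assms(2,3) by (auto simp: lev_def)

lemma fuzzy_number_range: "fuzzy_number u \<Longrightarrow> 0 \<le> u x \<and> u x \<le> 1"
  by (auto simp: fuzzy_number_def)

lemma fuzzy_number_lower_upper_mono:
  assumes u: "fuzzy_number u" and "0 \<le> r" "r \<le> s" "s \<le> 1"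
  shows "lower u r \<le> lower u s" "upper u s \<le> upper u r"
proof -
  have "lev u s \<subseteq> lev u r"
    using assms closure_subset[of "{x. 0 < u x}"] by (auto simp: lev_def)
  then show "lower u r \<le> lower u s" "upper u s \<le> upper u r"
    using assms fuzzy_number_lev[OF u, of r] fuzzy_number_lev[OF u, of s] by auto
qed

text \<open>A jump of \<open>lower u\<close> at \<open>r\<close> would put the point
  \<open>lower u r - e\<close> into every positive level below \<open>r\<close>, hence into level
  \<open>r\<close> itself, which starts to the right of it. At level 0 the closure supplies points
  of positive membership near the endpoint, and their membership value is the required
  \<open>s\<close>. The upper endpoint is symmetric.\<close>

lemma fuzzy_number_level_fun:
  assumes u: "fuzzy_number u"
  shows "level_fun (lower u)" "level_fun (\<lambda>r. - upper u r)"
proof -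
  note mono = fuzzy_number_lower_upper_mono[OF u]
  note le = fuzzy_number_lev(2)[OF u]
  have left: "r \<le> u y" if r: "0 < r" "\<And>s. 0 < s \<Longrightarrow> s < r \<Longrightarrow> s \<le> u y" for r y
    using r dense_le_bounded[of 0 r "u y"] by blast
  have ex0: "\<exists>y. 0 < u y \<and> \<bar>y - x\<bar> < e" if "x \<in> {lower u 0..upper u 0}" "0 < e" for x e
  proof -
    have "x \<in> closure {x. 0 < u x}" using that fuzzy_number_lev(1)[OF u, of 0] by (simp add: lev_def)
    then show ?thesis using that(2) by (auto simp: closure_approachable dist_real_def)
  qed
  show "level_fun (lower u)"
    unfolding level_fun_def
  proof (intro conjI allI impI)
    show "mono_on {0..1} (lower u)" using mono(1) by (auto simp: mono_on_def)
  next
    fix r e :: real assume h: "0 < r \<and> r \<le> 1 \<and> 0 < e"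
    show "\<exists>s. 0 < s \<and> s < r \<and> lower u r - e < lower u s"
    proof (rule ccontr)
      assume "\<not> ?thesis"
      then have "\<And>s. 0 < s \<Longrightarrow> s < r \<Longrightarrow> lower u s \<le> lower u r - e" by force
      then have "s \<le> u (lower u r - e)" if "0 < s" "s < r" for s
        using that h mono[of s r] le[of r] fuzzy_number_level_iff[OF u, of s "lower u r - e"]
        by auto
      then have "r \<le> u (lower u r - e)" using left h by blast
      then show False using fuzzy_number_level_iff[OF u, of r] h by auto
    qed
  next
    fix e :: real assume "0 < e"
    then obtain y where y: "0 < u y" "\<bar>y - lower u 0\<bar> < e" using ex0[of "lower u 0" e] le[of 0] by auto
    then show "\<exists>s. 0 < s \<and> s \<le> 1 \<and> lower u s < lower u 0 + e"
      using fuzzy_number_range[OF u, of y] fuzzy_number_level_iff[OF u, of "u y" y]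
      by (intro exI[of _ "u y"]) auto
  qed
  show "level_fun (\<lambda>r. - upper u r)"
    unfolding level_fun_def
  proof (intro conjI allI impI)
    show "mono_on {0..1} (\<lambda>r. - upper u r)" using mono(2) by (auto simp: mono_on_def)
  next
    fix r e :: real assume h: "0 < r \<and> r \<le> 1 \<and> 0 < e"
    show "\<exists>s. 0 < s \<and> s < r \<and> - upper u r - e < - upper u s"
    proof (rule ccontr)
      assume "\<not> ?thesis"
      then have "\<And>s. 0 < s \<Longrightarrow> s < r \<Longrightarrow> upper u r + e \<le> upper u s" by force
      then have "s \<le> u (upper u r + e)" if "0 < s" "s < r" for s
        using that h mono[of s r] le[of r] fuzzy_number_level_iff[OF u, of s "upper u r + e"]
        by auto
      then have "r \<le> u (upper u r + e)" using left h by blast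
      then show False using fuzzy_number_level_iff[OF u, of r] h by auto
    qed
  next
    fix e :: real assume "0 < e"
    then obtain y where y: "0 < u y" "\<bar>y - upper u 0\<bar> < e" using ex0[of "upper u 0" e] le[of 0] by auto
    then show "\<exists>s. 0 < s \<and> s \<le> 1 \<and> - upper u s < - upper u 0 + e"
      using fuzzy_number_range[OF u, of y] fuzzy_number_level_iff[OF u, of "u y" y]
      by (intro exI[of _ "u y"]) auto
  qed
qed

text \<open>If \<open>u x\<close> and \<open>v x\<close> differ, the larger one is itself a level in
  (0,1], and membership of \<open>x\<close> at this level separates the two.\<close>

lemma fuzzy_number_ext:
  assumes "fuzzy_number u" "fuzzy_number v"
    and "\<And>r. 0 < r \<Longrightarrow> r \<le> 1 \<Longrightarrow> lower u r = lower v r"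
    and "\<And>r. 0 < r \<Longrightarrow> r \<le> 1 \<Longrightarrow> upper u r = upper v r"
  shows "u = v"
proof
  fix x
  have "r \<le> u x \<longleftrightarrow> r \<le> v x" if "0 < r" "r \<le> 1" for r
    using assms fuzzy_number_level_iff[of _ r x] that by auto
  then show "u x = v x"
    using fuzzy_number_range[OF assms(1), of x] fuzzy_number_range[OF assms(2), of x]
    by (smt (verit))
qed

text \<open>\<open>v x\<close> is the supremum of the levels whose interval contains
  \<open>x\<close>. Left continuity of the endpoints makes a positive supremum attained, so that the
  level sets of \<open>v\<close> are the prescribed intervals and not larger ones.\<close>

lemma fuzzy_number_of_levels:
  assumes l: "level_fun l" and m: "level_fun (\<lambda>r. - m r)" and lm: "l 1 \<le> m 1"
  obtains v where "fuzzy_number v"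
    "\<And>r. 0 \<le> r \<Longrightarrow> r \<le> 1 \<Longrightarrow> lower v r = l r" "\<And>r. 0 \<le> r \<Longrightarrow> r \<le> 1 \<Longrightarrow> upper v r = m r"
proof -
  \<comment> \<open>The inserted 0 keeps the set nonempty and gives membership 0 to points that lie
    in no interval.\<close>
  define R where "R x = insert 0 {r. 0 < r \<and> r \<le> 1 \<and> l r \<le> x \<and> x \<le> m r}" for x
  define v where "v x = Sup (R x)" for x
  have bd: "bdd_above (R x)" for x unfolding R_def bdd_above_def by (rule exI[of _ 1]) auto
  interpret level_representation l m v
  proof
    show "0 \<le> v x" for x unfolding v_def using bd by (intro cSup_upper) (auto simp: R_def)
    show "v x \<le> 1" for x unfolding v_def by (intro cSup_least) (auto simp: R_def)
  next
    fix r x :: real assume r: "0 < r" "r \<le> 1"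
    show "r \<le> v x \<longleftrightarrow> l r \<le> x \<and> x \<le> m r"
    proof
      assume "l r \<le> x \<and> x \<le> m r"
      then show "r \<le> v x" unfolding v_def using bd r by (intro cSup_upper) (auto simp: R_def)
    next
      assume v: "r \<le> v x"
      \<comment> \<open>Strictly below \<open>r\<close> monotonicity suffices; the passage to
        \<open>r\<close> itself is the left continuity that follows.\<close>
      have s: "l s \<le> x \<and> x \<le> m s" if "0 < s" "s < r" for s
      proof -
        have "s < Sup (R x)" using v that by (simp add: v_def)
        then obtain s' where "s' \<in> R x" "s < s'"
          using less_cSup_iff[OF _ bd] by (auto simp: R_def)
        then show ?thesis using level_fun_mono[OF l, of s s'] level_fun_mono[OF m, of s s'] that
          by (auto simp: R_def)
      qed
      have "l r \<le> x"
      proof (rule field_le_epsilon)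
        fix e :: real assume "0 < e"
        then obtain s where "0 < s" "s < r" "l r - e < l s"
          using l r unfolding level_fun_def by blast
        then show "l r \<le> x + e" using s[of s] by auto
      qed
      moreover have "x \<le> m r"
      proof (rule field_le_epsilon)
        fix e :: real assume "0 < e"
        then obtain s where "0 < s" "s < r" "- m r - e < - m s"
          using m r unfolding level_fun_def by blast
        then show "x \<le> m r + e" using s[of s] by auto
      qed
      ultimately show "l r \<le> x \<and> x \<le> m r" by simp
    qed
  qed (fact l m lm)+
  show ?thesis using that fuzzy_number lower_eq upper_eq by blast
qed

lemma fz_zero_levels: "level_representation (\<lambda>r. 0) (\<lambda>r. 0) fz_zero"
  by standard (use level_fun_const[of 0] in \<open>auto simp: fz_zero_def\<close>)

lemma fuzzy_number_zero [simp]: "fuzzy_number fz_zero"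
  and lower_zero [simp]: "0 \<le> r \<Longrightarrow> r \<le> 1 \<Longrightarrow> lower fz_zero r = 0"
  and upper_zero [simp]: "0 \<le> r \<Longrightarrow> r \<le> 1 \<Longrightarrow> upper fz_zero r = 0"
  by (fact level_representation.fuzzy_number[OF fz_zero_levels] level_representation.lower_eq[OF fz_zero_levels]
      level_representation.upper_eq[OF fz_zero_levels])+

lemma fz_smul_levels:
  assumes u: "fuzzy_number u" and c: "0 < c"
  shows "level_representation (\<lambda>r. c * lower u r) (\<lambda>r. c * upper u r) (fz_smul c u)"
proof
  show "level_fun (\<lambda>r. c * lower u r)"
    using fuzzy_number_level_fun(1)[OF u] c by (intro level_fun_cmult) auto
  show "level_fun (\<lambda>r. - (c * upper u r))"
    using level_fun_cmult[OF fuzzy_number_level_fun(2)[OF u], of c] c by auto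
  show "c * lower u 1 \<le> c * upper u 1"
    using fuzzy_number_lev(2)[OF u, of 1] c by auto
  show "0 \<le> fz_smul c u x" "fz_smul c u x \<le> 1" for x
    using fuzzy_number_range[OF u] c by (auto simp: fz_smul_def)
  show "r \<le> fz_smul c u x \<longleftrightarrow> c * lower u r \<le> x \<and> x \<le> c * upper u r" if "0 < r" "r \<le> 1" for r x
    using fuzzy_number_level_iff[OF u that] c by (auto simp: fz_smul_def field_simps)
qed

lemma fz_smul_0 [simp]: "fz_smul 0 u = fz_zero"
  by (simp add: fz_smul_def)

lemma fuzzy_number_smul [simp]: "fuzzy_number u \<Longrightarrow> 0 \<le> c \<Longrightarrow> fuzzy_number (fz_smul c u)"
  and lower_smul: "fuzzy_number u \<Longrightarrow> 0 \<le> c \<Longrightarrow> 0 \<le> r \<Longrightarrow> r \<le> 1 \<Longrightarrow> lower (fz_smul c u) r = c * lower u r"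
  and upper_smul: "fuzzy_number u \<Longrightarrow> 0 \<le> c \<Longrightarrow> 0 \<le> r \<Longrightarrow> r \<le> 1 \<Longrightarrow> upper (fz_smul c u) r = c * upper u r"
proof -
  have c: "0 \<le> c \<Longrightarrow> c = 0 \<or> 0 < c" by linarith
  show "fuzzy_number u \<Longrightarrow> 0 \<le> c \<Longrightarrow> fuzzy_number (fz_smul c u)"
    using c level_representation.fuzzy_number[OF fz_smul_levels] by fastforce
  show "fuzzy_number u \<Longrightarrow> 0 \<le> c \<Longrightarrow> 0 \<le> r \<Longrightarrow> r \<le> 1 \<Longrightarrow> lower (fz_smul c u) r = c * lower u r"
    using c level_representation.lower_eq[OF fz_smul_levels] by fastforce
  show "fuzzy_number u \<Longrightarrow> 0 \<le> c \<Longrightarrow> 0 \<le> r \<Longrightarrow> r \<le> 1 \<Longrightarrow> upper (fz_smul c u) r = c * upper u r"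
    using c level_representation.upper_eq[OF fz_smul_levels] by fastforce
qed

text \<open>Attainment of the supremum in \<open>fz_add\<close> is bypassed: at each level
  \<open>s < r\<close> some splitting of \<open>x\<close> beats \<open>s\<close>, and left
  continuity of the summed endpoints carries both inequalities to \<open>r\<close>.\<close>

lemma fz_add_levels:
  assumes u: "fuzzy_number u" and v: "fuzzy_number v"
  shows "level_representation (\<lambda>r. lower u r + lower v r) (\<lambda>r. upper u r + upper v r) (fz_add u v)"
proof
  let ?l = "\<lambda>r. lower u r + lower v r" and ?m = "\<lambda>r. upper u r + upper v r"
  note ru = fuzzy_number_range[OF u] and rv = fuzzy_number_range[OF v]
  show l: "level_fun ?l"
    using fuzzy_number_level_fun(1) u v by (intro level_fun_add) auto
  show m: "level_fun (\<lambda>r. - ?m r)"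
    using level_fun_add[OF fuzzy_number_level_fun(2)[OF u] fuzzy_number_level_fun(2)[OF v]] by simp
  show "?l 1 \<le> ?m 1"
    using fuzzy_number_lev(2)[OF u, of 1] fuzzy_number_lev(2)[OF v, of 1] by auto
  have bd: "bdd_above (range (\<lambda>y. min (u y) (v (x - y))))" for x
    unfolding bdd_above_def using ru by (intro exI[of _ 1]) (auto simp: min_le_iff_disj)
  show "fz_add u v x \<le> 1" for x
    unfolding fz_add_def using ru by (intro cSup_least) (auto simp: min_le_iff_disj)
  have up: "min (u y) (v (x - y)) \<le> fz_add u v x" for x y
    unfolding fz_add_def using bd by (intro cSup_upper) auto
  show "0 \<le> fz_add u v x" for x
    using up[of 0 x] ru[of 0] rv[of "x - 0"] by (auto simp: min_def split: if_splits)
  fix r x :: real assume r: "0 < r" "r \<le> 1"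
  show "r \<le> fz_add u v x \<longleftrightarrow> ?l r \<le> x \<and> x \<le> ?m r"
  proof
    assume x: "?l r \<le> x \<and> x \<le> ?m r"
    \<comment> \<open>The smallest \<open>y\<close> at or above \<open>lower u r\<close> for which
      \<open>x - y\<close> does not exceed \<open>upper v r\<close>.\<close>
    define y where "y = max (lower u r) (x - upper v r)"
    have "r \<le> u y" "r \<le> v (x - y)"
      using x fuzzy_number_lev(2)[OF u, of r] fuzzy_number_lev(2)[OF v, of r] r
        fuzzy_number_level_iff[OF u r, of y] fuzzy_number_level_iff[OF v r, of "x - y"]
      by (auto simp: y_def max_def)
    then show "r \<le> fz_add u v x" using up[of y x] by linarith
  next
    assume x: "r \<le> fz_add u v x"
    have s: "?l s \<le> x \<and> x \<le> ?m s" if "0 < s" "s < r" for s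
    proof -
      have "s < Sup (range (\<lambda>y. min (u y) (v (x - y))))" using x that by (simp add: fz_add_def)
      then obtain y where "s < u y" "s < v (x - y)"
        using less_cSup_iff[OF _ bd] by auto
      then show ?thesis
        using fuzzy_number_level_iff[OF u, of s y] fuzzy_number_level_iff[OF v, of s "x - y"] that r by auto
    qed
    have "?l r \<le> x"
    proof (rule field_le_epsilon)
      fix e :: real assume "0 < e"
      then obtain s where "0 < s" "s < r" "?l r - e < ?l s"
        using l r unfolding level_fun_def by blast
      then show "?l r \<le> x + e" using s[of s] by auto
    qed
    moreover have "x \<le> ?m r"
    proof (rule field_le_epsilon)
      fix e :: real assume "0 < e"
      then obtain s where "0 < s" "s < r" "- ?m r - e < - ?m s"
        using m r unfolding level_fun_def by blast
      then show "x \<le> ?m r + e" using s[of s] by auto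
    qed
    ultimately show "?l r \<le> x \<and> x \<le> ?m r" by simp
  qed
qed

lemma fuzzy_number_add [simp]: "fuzzy_number u \<Longrightarrow> fuzzy_number v \<Longrightarrow> fuzzy_number (fz_add u v)"
  and lower_add: "fuzzy_number u \<Longrightarrow> fuzzy_number v \<Longrightarrow> 0 \<le> r \<Longrightarrow> r \<le> 1 \<Longrightarrow> lower (fz_add u v) r = lower u r + lower v r"
  and upper_add: "fuzzy_number u \<Longrightarrow> fuzzy_number v \<Longrightarrow> 0 \<le> r \<Longrightarrow> r \<le> 1 \<Longrightarrow> upper (fz_add u v) r = upper u r + upper v r"
  by (fact level_representation.fuzzy_number[OF fz_add_levels] level_representation.lower_eq[OF fz_add_levels]
      level_representation.upper_eq[OF fz_add_levels])+

subsection \<open>The metric on fuzzy numbers and infinite sums\<close>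

lemma fuzzy_number_levels_bounded:
  assumes "fuzzy_number u" "0 \<le> r" "r \<le> 1"
  shows "\<bar>lower u r\<bar> \<le> \<bar>lower u 0\<bar> + \<bar>upper u 0\<bar>" "\<bar>upper u r\<bar> \<le> \<bar>lower u 0\<bar> + \<bar>upper u 0\<bar>"
  using fuzzy_number_lower_upper_mono[OF assms(1), of 0 r] fuzzy_number_lev(2)[OF assms] assms(2,3) by linarith+

lemma fz_dist_bdd_above:
  assumes u: "fuzzy_number u" and v: "fuzzy_number v"
  shows "bdd_above ((\<lambda>r. max \<bar>lower u r - lower v r\<bar> \<bar>upper u r - upper v r\<bar>) ` {0..1})"
  unfolding bdd_above_def
proof (intro exI ballI, elim imageE)
  let ?B = "\<bar>lower u 0\<bar> + \<bar>upper u 0\<bar> + (\<bar>lower v 0\<bar> + \<bar>upper v 0\<bar>)"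
  fix y r :: real assume y: "y = max \<bar>lower u r - lower v r\<bar> \<bar>upper u r - upper v r\<bar>" and "r \<in> {0..1}"
  then have r: "0 \<le> r" "r \<le> 1" by auto
  have "\<bar>lower u r - lower v r\<bar> \<le> ?B" "\<bar>upper u r - upper v r\<bar> \<le> ?B"
    using fuzzy_number_levels_bounded[OF u r] fuzzy_number_levels_bounded[OF v r]
      abs_triangle_ineq4[of "lower u r" "lower v r"] abs_triangle_ineq4[of "upper u r" "upper v r"]
    by linarith+
  then show "y \<le> ?B" unfolding y by (rule max.boundedI)
qed

lemma fz_dist_leI:
  assumes "\<And>r. 0 \<le> r \<Longrightarrow> r \<le> 1 \<Longrightarrow> \<bar>lower u r - lower v r\<bar> \<le> B"
    and "\<And>r. 0 \<le> r \<Longrightarrow> r \<le> 1 \<Longrightarrow> \<bar>upper u r - upper v r\<bar> \<le> B"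
  shows "fz_dist u v \<le> B"
  unfolding fz_dist_def using assms by (intro cSup_least) auto

lemma fz_dist_lower: "fuzzy_number u \<Longrightarrow> fuzzy_number v \<Longrightarrow> 0 \<le> r \<Longrightarrow> r \<le> 1 \<Longrightarrow> \<bar>lower u r - lower v r\<bar> \<le> fz_dist u v"
  and fz_dist_upper: "fuzzy_number u \<Longrightarrow> fuzzy_number v \<Longrightarrow> 0 \<le> r \<Longrightarrow> r \<le> 1 \<Longrightarrow> \<bar>upper u r - upper v r\<bar> \<le> fz_dist u v"
proof -
  assume *: "fuzzy_number u" "fuzzy_number v" "0 \<le> r" "r \<le> 1"
  have "max \<bar>lower u r - lower v r\<bar> \<bar>upper u r - upper v r\<bar> \<le> fz_dist u v"
    unfolding fz_dist_def using * by (intro cSup_upper fz_dist_bdd_above) auto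
  then show "\<bar>lower u r - lower v r\<bar> \<le> fz_dist u v" "\<bar>upper u r - upper v r\<bar> \<le> fz_dist u v"
    by auto
qed

lemma fz_dist_self [simp]: "fz_dist u u = 0"
  unfolding fz_dist_def by simp

lemma fz_dist_commute: "fz_dist u v = fz_dist v u"
  unfolding fz_dist_def by (simp add: abs_minus_commute)

lemma fz_dist_nonneg [simp]: "fuzzy_number u \<Longrightarrow> fuzzy_number v \<Longrightarrow> 0 \<le> fz_dist u v"
  using fz_dist_lower[of u v 0] by linarith

lemma fz_dist_triangle:
  assumes "fuzzy_number u" "fuzzy_number v" "fuzzy_number w"
  shows "fz_dist u w \<le> fz_dist u v + fz_dist v w"
proof (rule fz_dist_leI)
  fix r :: real assume r: "0 \<le> r" "r \<le> 1"
  show "\<bar>lower u r - lower w r\<bar> \<le> fz_dist u v + fz_dist v w"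
    using fz_dist_lower[OF assms(1,2) r] fz_dist_lower[OF assms(2,3) r] by linarith
  show "\<bar>upper u r - upper w r\<bar> \<le> fz_dist u v + fz_dist v w"
    using fz_dist_upper[OF assms(1,2) r] fz_dist_upper[OF assms(2,3) r] by linarith
qed

lemma fz_dist_eq_0:
  assumes "fuzzy_number u" "fuzzy_number v"
  shows "fz_dist u v = 0 \<longleftrightarrow> u = v"
proof
  assume "fz_dist u v = 0"
  then show "u = v"
    using fz_dist_lower[OF assms] fz_dist_upper[OF assms] by (intro fuzzy_number_ext assms) force+
qed simp

lemma fz_dist_add:
  assumes "fuzzy_number u" "fuzzy_number v" "fuzzy_number u'" "fuzzy_number v'"
  shows "fz_dist (fz_add u v) (fz_add u' v') \<le> fz_dist u u' + fz_dist v v'"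
proof (rule fz_dist_leI)
  fix r :: real assume r: "0 \<le> r" "r \<le> 1"
  show "\<bar>lower (fz_add u v) r - lower (fz_add u' v') r\<bar> \<le> fz_dist u u' + fz_dist v v'"
    using fz_dist_lower[OF assms(1,3) r] fz_dist_lower[OF assms(2,4) r] assms r by (simp add: lower_add)
  show "\<bar>upper (fz_add u v) r - upper (fz_add u' v') r\<bar> \<le> fz_dist u u' + fz_dist v v'"
    using fz_dist_upper[OF assms(1,3) r] fz_dist_upper[OF assms(2,4) r] assms r by (simp add: upper_add)
qed

text \<open>Endpoints add, so the common summand cancels in every level difference. This gives the
  translation invariance of all the metrics, and the cancellation law behind uniqueness of Hukuhara
  differences.\<close>

lemma fz_dist_add_left [simp]:
  assumes "fuzzy_number w" "fuzzy_number u" "fuzzy_number v"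
  shows "fz_dist (fz_add w u) (fz_add w v) = fz_dist u v"
  unfolding fz_dist_def using assms by (intro arg_cong[of _ _ Sup] image_cong) (auto simp: lower_add upper_add)

lemma fz_add_assoc:
  assumes "fuzzy_number u" "fuzzy_number v" "fuzzy_number w"
  shows "fz_add (fz_add u v) w = fz_add u (fz_add v w)"
  using assms by (intro fuzzy_number_ext) (auto simp: lower_add upper_add)

lemma fz_add_zero [simp]:
  assumes "fuzzy_number u" shows "fz_add u fz_zero = u" "fz_add fz_zero u = u"
  using assms by (auto intro!: fuzzy_number_ext simp: lower_add upper_add)

lemma fz_add_left_cancel:
  assumes "fuzzy_number w" "fuzzy_number u" "fuzzy_number v" "fz_add w u = fz_add w v"
  shows "u = v"
  using fz_dist_add_left[OF assms(1-3)] assms fz_dist_eq_0 by simp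

lemma fz_smul_zero [simp]: "0 \<le> c \<Longrightarrow> fz_smul c fz_zero = fz_zero"
  by (intro fuzzy_number_ext) (auto simp: lower_smul upper_smul)

lemma fz_smul_add:
  assumes "fuzzy_number u" "fuzzy_number v" "0 \<le> c"
  shows "fz_smul c (fz_add u v) = fz_add (fz_smul c u) (fz_smul c v)"
  using assms by (intro fuzzy_number_ext) (auto simp: lower_smul upper_smul lower_add upper_add algebra_simps)

lemma fz_smul_smul:
  assumes "fuzzy_number u" "0 \<le> c" "0 \<le> d"
  shows "fz_smul c (fz_smul d u) = fz_smul (c * d) u"
  using assms by (intro fuzzy_number_ext) (auto simp: lower_smul upper_smul)

lemma fz_dist_smul:
  assumes u: "fuzzy_number u" and v: "fuzzy_number v" and c: "0 \<le> c"
  shows "fz_dist (fz_smul c u) (fz_smul c v) = c * fz_dist u v"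
proof (rule antisym)
  have *: "\<bar>c * a - c * b\<bar> = c * \<bar>a - b\<bar>" for a b :: real
    using c by (metis abs_mult abs_of_nonneg right_diff_distrib)
  show le: "fz_dist (fz_smul c u) (fz_smul c v) \<le> c * fz_dist u v"
    using fz_dist_lower[OF u v] fz_dist_upper[OF u v] c u v
    by (intro fz_dist_leI) (auto simp: lower_smul upper_smul * intro: mult_left_mono)
  show "c * fz_dist u v \<le> fz_dist (fz_smul c u) (fz_smul c v)"
  proof (cases "c = 0")
    case False
    have "fz_dist u v \<le> fz_dist (fz_smul c u) (fz_smul c v) / c"
    proof (rule fz_dist_leI)
      fix r :: real assume r: "0 \<le> r" "r \<le> 1"
      show "\<bar>lower u r - lower v r\<bar> \<le> fz_dist (fz_smul c u) (fz_smul c v) / c"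
        using fz_dist_lower[of "fz_smul c u" "fz_smul c v" r] u v c r False
        by (simp add: lower_smul * field_simps)
      show "\<bar>upper u r - upper v r\<bar> \<le> fz_dist (fz_smul c u) (fz_smul c v) / c"
        using fz_dist_upper[of "fz_smul c u" "fz_smul c v" r] u v c r False
        by (simp add: upper_smul * field_simps)
    qed
    then show ?thesis using c False by (simp add: field_simps)
  qed simp
qed

lemma fz_norm_smul: "fuzzy_number u \<Longrightarrow> 0 \<le> c \<Longrightarrow> fz_dist (fz_smul c u) fz_zero = c * fz_dist u fz_zero"
  using fz_dist_smul[of u fz_zero c] by simp

lemma fz_dist_le_norms:
  "fuzzy_number u \<Longrightarrow> fuzzy_number v \<Longrightarrow> fz_dist u v \<le> fz_dist u fz_zero + fz_dist v fz_zero"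
  using fz_dist_triangle[of u fz_zero v] by (simp add: fz_dist_commute)

lemma fz_norm_add:
  "fuzzy_number u \<Longrightarrow> fuzzy_number v \<Longrightarrow> fz_dist (fz_add u v) fz_zero \<le> fz_dist u fz_zero + fz_dist v fz_zero"
  using fz_dist_add[of u v fz_zero fz_zero] by simp

lemma fz_norm_lower: "fuzzy_number u \<Longrightarrow> 0 \<le> r \<Longrightarrow> r \<le> 1 \<Longrightarrow> \<bar>lower u r\<bar> \<le> fz_dist u fz_zero"
  and fz_norm_upper: "fuzzy_number u \<Longrightarrow> 0 \<le> r \<Longrightarrow> r \<le> 1 \<Longrightarrow> \<bar>upper u r\<bar> \<le> fz_dist u fz_zero"
  using fz_dist_lower[of u fz_zero r] fz_dist_upper[of u fz_zero r] by auto

section \<open>Levelwise infinite sums\<close>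

text \<open>Choice makes this a total function; its value is meaningful for
  \<open>fz_summable\<close> families, where a fuzzy number with these levels exists and is
  determined by them.\<close>

definition fz_sum :: "(nat \<Rightarrow> fz) \<Rightarrow> fz" where
  "fz_sum u = (SOME w. fuzzy_number w \<and>
     (\<forall>r\<in>{0..1}. lower w r = (\<Sum>k. lower (u k) r) \<and> upper w r = (\<Sum>k. upper (u k) r)))"

locale fz_summable =
  fixes u :: "nat \<Rightarrow> fz"
  assumes fuzzy: "\<And>k. fuzzy_number (u k)"
    and summable_norm: "summable (\<lambda>k. fz_dist (u k) fz_zero)"
begin

lemma summable_lower: "0 \<le> r \<Longrightarrow> r \<le> 1 \<Longrightarrow> summable (\<lambda>k. lower (u k) r)"
  and summable_upper: "0 \<le> r \<Longrightarrow> r \<le> 1 \<Longrightarrow> summable (\<lambda>k. upper (u k) r)"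
  by (rule summable_comparison_test'[OF summable_norm, of 0];
      simp add: fuzzy fz_norm_lower fz_norm_upper)+

text \<open>Weierstrass test: the norms of the terms dominate all levels at once, so the partial
  sums converge uniformly in \<open>r\<close>. A general family \<open>l\<close> serves
  \<open>lower\<close> and the negated \<open>upper\<close> alike.\<close>

lemma level_fun_suminf:
  assumes l: "\<And>k. level_fun (\<lambda>r. l k r)"
    and le: "\<And>k r. 0 \<le> r \<Longrightarrow> r \<le> 1 \<Longrightarrow> \<bar>l k r\<bar> \<le> fz_dist (u k) fz_zero"
  shows "level_fun (\<lambda>r. \<Sum>k. l k r)"
proof (rule level_fun_uniform_limit)
  fix e :: real assume e: "0 < e"
  obtain N where N: "\<bar>\<Sum>k. fz_dist (u (k + N)) fz_zero\<bar> < e"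
    using suminf_exist_split[OF e summable_norm] by (auto simp: real_norm_def)
  have "level_fun (\<lambda>r. \<Sum>k<n. l k r)" for n
    by (induction n) (auto intro: level_fun_add level_fun_const l)
  moreover have "\<bar>(\<Sum>k. l k r) - (\<Sum>k<N. l k r)\<bar> < e" if r: "r \<in> {0..1}" for r
  proof -
    have s: "summable (\<lambda>k. l k r)"
      using r le by (intro summable_comparison_test'[OF summable_norm, of 0]) auto
    have s': "summable (\<lambda>k. \<bar>l (k + N) r\<bar>)"
      using r le by (intro summable_comparison_test'[OF summable_ignore_initial_segment[OF summable_norm, of N], of 0]) auto
    have "(\<Sum>k. l k r) - (\<Sum>k<N. l k r) = (\<Sum>k. l (k + N) r)"
      using suminf_minus_initial_segment[OF s, of N] by simp
    also have "\<bar>\<dots>\<bar> \<le> (\<Sum>k. \<bar>l (k + N) r\<bar>)"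
      using s' by (rule summable_rabs)
    also have "\<dots> \<le> (\<Sum>k. fz_dist (u (k + N)) fz_zero)"
      using r le s' summable_ignore_initial_segment[OF summable_norm, of N] by (intro suminf_le) auto
    finally show ?thesis using N by linarith
  qed
  ultimately show "\<exists>m. level_fun m \<and> (\<forall>r\<in>{0..1}. \<bar>(\<Sum>k. l k r) - m r\<bar> < e)" by blast
qed

lemma sum_props:
  "fuzzy_number (fz_sum u) \<and>
   (\<forall>r\<in>{0..1}. lower (fz_sum u) r = (\<Sum>k. lower (u k) r) \<and> upper (fz_sum u) r = (\<Sum>k. upper (u k) r))"
proof -
  have a: "level_fun (\<lambda>r. \<Sum>k. lower (u k) r)"
    using fuzzy by (intro level_fun_suminf fuzzy_number_level_fun fz_norm_lower)
  have "level_fun (\<lambda>r. \<Sum>k. - upper (u k) r)"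
    using fuzzy fz_norm_upper by (intro level_fun_suminf fuzzy_number_level_fun) auto
  then have b: "level_fun (\<lambda>r. - (\<Sum>k. upper (u k) r))"
    by (rule level_fun_cong) (simp add: suminf_minus summable_upper)
  have c: "(\<Sum>k. lower (u k) 1) \<le> (\<Sum>k. upper (u k) 1)"
    using fuzzy_number_lev(2)[OF fuzzy, of 1] by (intro suminf_le summable_lower summable_upper) auto
  obtain w where "fuzzy_number w" "\<And>r. 0 \<le> r \<Longrightarrow> r \<le> 1 \<Longrightarrow> lower w r = (\<Sum>k. lower (u k) r)"
    "\<And>r. 0 \<le> r \<Longrightarrow> r \<le> 1 \<Longrightarrow> upper w r = (\<Sum>k. upper (u k) r)"
    using fuzzy_number_of_levels[OF a b c] by blast
  then show ?thesis
    unfolding fz_sum_def by (intro someI_ex[of "\<lambda>w. fuzzy_number w \<and> _ w"] exI[of _ w]) auto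
qed

lemma fuzzy_number_sum: "fuzzy_number (fz_sum u)"
  and lower_sum: "0 \<le> r \<Longrightarrow> r \<le> 1 \<Longrightarrow> lower (fz_sum u) r = (\<Sum>k. lower (u k) r)"
  and upper_sum: "0 \<le> r \<Longrightarrow> r \<le> 1 \<Longrightarrow> upper (fz_sum u) r = (\<Sum>k. upper (u k) r)"
  using sum_props by auto

end

lemma fz_summableI:
  assumes "\<And>k. fuzzy_number (u k)" "\<And>k. fz_dist (u k) fz_zero \<le> B k" "summable B"
  shows "fz_summable u"
proof
  show "summable (\<lambda>k. fz_dist (u k) fz_zero)"
    using assms by (intro summable_comparison_test'[OF assms(3), of 0]) auto
qed (fact assms)

lemma fz_summable_zero: "fz_summable (\<lambda>k. fz_zero)"
  by (rule fz_summableI[of _ "\<lambda>_. 0"]) auto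

lemma fz_sum_zero [simp]: "fz_sum (\<lambda>k. fz_zero) = fz_zero"
  by (rule fuzzy_number_ext)
    (auto simp: fz_summable.fuzzy_number_sum fz_summable.lower_sum fz_summable.upper_sum fz_summable_zero)

lemma fz_summable_add:
  assumes u: "fz_summable u" and v: "fz_summable v"
  shows "fz_summable (\<lambda>k. fz_add (u k) (v k))"
  using fz_summable.fuzzy[OF u] fz_summable.fuzzy[OF v]
    summable_add[OF fz_summable.summable_norm[OF u] fz_summable.summable_norm[OF v]]
  by (intro fz_summableI[of _ "\<lambda>k. fz_dist (u k) fz_zero + fz_dist (v k) fz_zero"]) (auto intro: fz_norm_add)

lemma fz_sum_add:
  assumes u: "fz_summable u" and v: "fz_summable v"
  shows "fz_sum (\<lambda>k. fz_add (u k) (v k)) = fz_add (fz_sum u) (fz_sum v)"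
proof -
  interpret u: fz_summable u by fact
  interpret v: fz_summable v by fact
  interpret uv: fz_summable "\<lambda>k. fz_add (u k) (v k)" using fz_summable_add[OF u v] .
  show ?thesis
    by (rule fuzzy_number_ext)
      (simp_all add: u.fuzzy_number_sum v.fuzzy_number_sum uv.fuzzy_number_sum lower_add upper_add
        u.lower_sum v.lower_sum uv.lower_sum u.upper_sum v.upper_sum uv.upper_sum u.fuzzy v.fuzzy
        suminf_add u.summable_lower v.summable_lower u.summable_upper v.summable_upper)
qed

lemma fz_summable_smul:
  assumes u: "fz_summable u" and c: "0 \<le> c"
  shows "fz_summable (\<lambda>k. fz_smul c (u k))"
  using fz_summable.fuzzy[OF u] c summable_mult[OF fz_summable.summable_norm[OF u], of c]
  by (intro fz_summableI[of _ "\<lambda>k. c * fz_dist (u k) fz_zero"]) (auto simp: fz_norm_smul)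

lemma fz_sum_smul:
  assumes u: "fz_summable u" and c: "0 \<le> c"
  shows "fz_sum (\<lambda>k. fz_smul c (u k)) = fz_smul c (fz_sum u)"
proof -
  interpret u: fz_summable u by fact
  interpret uv: fz_summable "\<lambda>k. fz_smul c (u k)" using fz_summable_smul[OF u c] .
  show ?thesis
    by (rule fuzzy_number_ext)
      (simp_all add: u.fuzzy_number_sum uv.fuzzy_number_sum lower_smul upper_smul c
        u.lower_sum uv.lower_sum u.upper_sum uv.upper_sum u.fuzzy suminf_mult u.summable_lower u.summable_upper)
qed

lemma fz_summable_shift: "fz_summable u \<Longrightarrow> fz_summable (\<lambda>k. u (k + n))"
  unfolding fz_summable_def using summable_ignore_initial_segment by blast

lemma fz_sum_head:
  assumes u: "fz_summable u"
  shows "fz_sum u = fz_add (u 0) (fz_sum (\<lambda>k. u (Suc k)))"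
proof -
  interpret u: fz_summable u by fact
  interpret s: fz_summable "\<lambda>k. u (Suc k)" using fz_summable_shift[OF u, of 1] by simp
  show ?thesis
  proof (rule fuzzy_number_ext)
    fix r :: real assume r: "0 < r" "r \<le> 1"
    show "lower (fz_sum u) r = lower (fz_add (u 0) (fz_sum (\<lambda>k. u (Suc k)))) r"
      using r suminf_split_head[OF u.summable_lower, of r]
      by (simp add: u.fuzzy s.fuzzy_number_sum lower_add u.lower_sum s.lower_sum)
    show "upper (fz_sum u) r = upper (fz_add (u 0) (fz_sum (\<lambda>k. u (Suc k)))) r"
      using r suminf_split_head[OF u.summable_upper, of r]
      by (simp add: u.fuzzy s.fuzzy_number_sum upper_add u.upper_sum s.upper_sum)
  qed (simp_all add: u.fuzzy u.fuzzy_number_sum s.fuzzy_number_sum)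
qed

lemma fz_dist_sum_le:
  assumes u: "fz_summable u" and v: "fz_summable v"
  shows "fz_dist (fz_sum u) (fz_sum v) \<le> (\<Sum>k. fz_dist (u k) (v k))"
    and "summable (\<lambda>k. fz_dist (u k) (v k))"
proof -
  interpret u: fz_summable u by fact
  interpret v: fz_summable v by fact
  show s: "summable (\<lambda>k. fz_dist (u k) (v k))"
    by (rule summable_comparison_test'[OF summable_add[OF u.summable_norm v.summable_norm], of 0])
      (simp add: u.fuzzy v.fuzzy fz_dist_le_norms)
  have *: "\<bar>(\<Sum>k. f k) - (\<Sum>k. g k)\<bar> \<le> (\<Sum>k. fz_dist (u k) (v k))"
    if f: "summable f" and g: "summable g" and le: "\<And>k. \<bar>f k - g k\<bar> \<le> fz_dist (u k) (v k)" for f g :: "nat \<Rightarrow> real"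
  proof -
    have s': "summable (\<lambda>k. \<bar>f k - g k\<bar>)"
      using le by (intro summable_comparison_test'[OF s, of 0]) auto
    have "\<bar>(\<Sum>k. f k) - (\<Sum>k. g k)\<bar> = \<bar>\<Sum>k. f k - g k\<bar>" using f g by (simp add: suminf_diff)
    also have "\<dots> \<le> (\<Sum>k. \<bar>f k - g k\<bar>)" using s' by (rule summable_rabs)
    also have "\<dots> \<le> (\<Sum>k. fz_dist (u k) (v k))" using le s' s by (intro suminf_le) auto
    finally show ?thesis .
  qed
  show "fz_dist (fz_sum u) (fz_sum v) \<le> (\<Sum>k. fz_dist (u k) (v k))"
  proof (rule fz_dist_leI)
    fix r :: real assume r: "0 \<le> r" "r \<le> 1"
    show "\<bar>lower (fz_sum u) r - lower (fz_sum v) r\<bar> \<le> (\<Sum>k. fz_dist (u k) (v k))"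
      using * r by (simp add: u.lower_sum v.lower_sum u.summable_lower v.summable_lower u.fuzzy v.fuzzy fz_dist_lower)
    show "\<bar>upper (fz_sum u) r - upper (fz_sum v) r\<bar> \<le> (\<Sum>k. fz_dist (u k) (v k))"
      using * r by (simp add: u.upper_sum v.upper_sum u.summable_upper v.summable_upper u.fuzzy v.fuzzy fz_dist_upper)
  qed
qed

lemma fz_norm_sum_le:
  assumes "fz_summable u" shows "fz_dist (fz_sum u) fz_zero \<le> (\<Sum>k. fz_dist (u k) fz_zero)"
  using fz_dist_sum_le(1)[OF assms fz_summable_zero] by simp

lemma fz_norm_sum_le_bound:
  assumes "\<And>k. fuzzy_number (u k)" "\<And>k. fz_dist (u k) fz_zero \<le> B k" "summable B"
  shows "fz_dist (fz_sum u) fz_zero \<le> (\<Sum>k. B k)"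
proof -
  have s: "fz_summable u" using assms by (rule fz_summableI)
  show ?thesis
    using fz_norm_sum_le[OF s] suminf_le[OF assms(2) fz_summable.summable_norm[OF s] assms(3)] by linarith
qed

text \<open>Tannery's theorem in \<open>\<epsilon>\<close>-form.\<close>

lemma fz_dist_sum_small:
  assumes B: "summable B" and e: "0 < e"
  obtains N d where "0 < d"
    "\<And>u v. (\<And>k. fuzzy_number (u k)) \<Longrightarrow> (\<And>k. fuzzy_number (v k)) \<Longrightarrow>
       (\<And>k. fz_dist (u k) fz_zero \<le> B k) \<Longrightarrow> (\<And>k. fz_dist (v k) fz_zero \<le> B k) \<Longrightarrow>
       (\<And>k. k < N \<Longrightarrow> fz_dist (u k) (v k) < d) \<Longrightarrow> fz_dist (fz_sum u) (fz_sum v) < e"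
proof -
  obtain N where N: "\<bar>\<Sum>k. B (k + N)\<bar> < e / 4"
    using suminf_exist_split[of "e/4", OF _ B] e by (auto simp: real_norm_def)
  \<comment> \<open>The head contributes at most \<open>N * d\<close>, hence at most e/4, and the
    tail less than twice e/4; \<open>N + 1\<close> keeps \<open>d\<close> positive when
    \<open>N = 0\<close>.\<close>
  define d where "d = e / (4 * (real N + 1))"
  have d: "0 < d" using e by (simp add: d_def)
  have Nd: "real N * d \<le> e / 4" using e by (simp add: d_def field_simps)
  have "fz_dist (fz_sum u) (fz_sum v) < e"
    if u: "\<And>k. fuzzy_number (u k)" and v: "\<And>k. fuzzy_number (v k)"
      and uB: "\<And>k. fz_dist (u k) fz_zero \<le> B k" and vB: "\<And>k. fz_dist (v k) fz_zero \<le> B k"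
      and small: "\<And>k. k < N \<Longrightarrow> fz_dist (u k) (v k) < d" for u v
  proof -
    have su: "fz_summable u" and sv: "fz_summable v" 
      by (rule fz_summableI[OF u uB B], rule fz_summableI[OF v vB B])
    note le = fz_dist_sum_le[OF su sv]
    have "(\<Sum>k. fz_dist (u k) (v k)) = (\<Sum>k. fz_dist (u (k + N)) (v (k + N))) + (\<Sum>k<N. fz_dist (u k) (v k))"
      using suminf_split_initial_segment[OF le(2)] .
    moreover have "(\<Sum>k. fz_dist (u (k + N)) (v (k + N))) \<le> (\<Sum>k. 2 * B (k + N))"
    proof (rule suminf_le)
      show "fz_dist (u (k + N)) (v (k + N)) \<le> 2 * B (k + N)" for k
        using fz_dist_le_norms[OF u v, of "k + N" "k + N"] uB[of "k + N"] vB[of "k + N"] by linarith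
    qed (use B le(2) in \<open>auto intro: summable_mult summable_ignore_initial_segment\<close>)
    moreover have "(\<Sum>k. 2 * B (k + N)) = 2 * (\<Sum>k. B (k + N))"
      using B by (intro suminf_mult summable_ignore_initial_segment)
    moreover have "(\<Sum>k<N. fz_dist (u k) (v k)) \<le> real N * d"
      using sum_bounded_above[of "{..<N}" "\<lambda>k. fz_dist (u k) (v k)" d] small by (simp add: less_imp_le)
    ultimately show ?thesis using le(1) N Nd e by linarith
  qed
  with d show ?thesis by (rule that)
qed

subsection \<open>Uniform boundedness on fuzzy cones\<close>

text \<open>The distance is only required to satisfy a triangle inequality with constant 2, so that the
  \<open>L\<^sup>p\<close> metrics qualify without Minkowski's inequality.  Completeness enters only through
  \<open>series\<close>: a rapidly decreasing series has tails \<open>t n\<close>.\<close>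

locale fuzzy_cone =
  fixes C :: "'a set" and add :: "'a \<Rightarrow> 'a \<Rightarrow> 'a" and smul :: "real \<Rightarrow> 'a \<Rightarrow> 'a"
    and d :: "'a \<Rightarrow> 'a \<Rightarrow> real" and z :: 'a
  assumes zero_mem: "z \<in> C"
    and add_mem: "x \<in> C \<Longrightarrow> y \<in> C \<Longrightarrow> add x y \<in> C"
    and smul_mem: "x \<in> C \<Longrightarrow> 0 \<le> c \<Longrightarrow> smul c x \<in> C"
    and assoc: "x \<in> C \<Longrightarrow> y \<in> C \<Longrightarrow> w \<in> C \<Longrightarrow> add (add x y) w = add x (add y w)"
    and add_zero: "x \<in> C \<Longrightarrow> add x z = x" "x \<in> C \<Longrightarrow> add z x = x"
    and smul_0: "x \<in> C \<Longrightarrow> smul 0 x = z"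
    and dist_nonneg: "x \<in> C \<Longrightarrow> y \<in> C \<Longrightarrow> 0 \<le> d x y"
    and dist_self: "x \<in> C \<Longrightarrow> d x x = 0"
    and dist_commute: "x \<in> C \<Longrightarrow> y \<in> C \<Longrightarrow> d x y = d y x"
    and dist_triangle: "x \<in> C \<Longrightarrow> y \<in> C \<Longrightarrow> w \<in> C \<Longrightarrow> d x w \<le> 2 * (d x y + d y w)"
    and dist_add: "w \<in> C \<Longrightarrow> x \<in> C \<Longrightarrow> y \<in> C \<Longrightarrow> d (add w x) (add w y) = d x y"
    and norm_smul: "x \<in> C \<Longrightarrow> 0 \<le> c \<Longrightarrow> d (smul c x) z = c * d x z"
    and series: "\<And>x. (\<And>k. x k \<in> C) \<Longrightarrow> (\<And>k. d (x k) z \<le> (1/512) ^ k) \<Longrightarrow>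
      \<exists>t. \<forall>n. t n \<in> C \<and> d (t n) (add (x n) (t (Suc n))) = 0 \<and> d (t n) z \<le> 4 * (1/512) ^ n"
begin

abbreviation nrm :: "'a \<Rightarrow> real" where "nrm x \<equiv> d x z"

lemma norm_nonneg: "x \<in> C \<Longrightarrow> 0 \<le> nrm x"
  using dist_nonneg zero_mem by blast

lemma eq_trans: "\<lbrakk>x \<in> C; y \<in> C; w \<in> C; d x y = 0; d y w = 0\<rbrakk> \<Longrightarrow> d x w = 0"
  using dist_triangle[of x y w] dist_nonneg[of x w] by simp

lemma norm_cong: "\<lbrakk>x \<in> C; y \<in> C; d x y = 0\<rbrakk> \<Longrightarrow> nrm x \<le> 2 * nrm y"
  using dist_triangle[of x y z] zero_mem by simp

definition operator :: "('a \<Rightarrow> 'a) \<Rightarrow> bool" where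
  "operator A \<longleftrightarrow> A ` C \<subseteq> C \<and> (\<forall>x\<in>C. \<forall>y\<in>C. d (A (add x y)) (add (A x) (A y)) = 0) \<and>
     (\<forall>c\<ge>0. \<forall>x\<in>C. d (A (smul c x)) (smul c (A x)) = 0) \<and>
     (\<forall>x\<in>C. \<forall>e>0. \<exists>r>0. \<forall>y\<in>C. d y x < r \<longrightarrow> d (A y) (A x) < e)"

definition op_bound :: "('a \<Rightarrow> 'a) \<Rightarrow> real" where
  "op_bound A = Inf {M. M > 0 \<and> (\<forall>x\<in>C. nrm (A x) \<le> M * nrm x)}"

context
  fixes A assumes A: "operator A"
begin

lemma op_mem: "x \<in> C \<Longrightarrow> A x \<in> C"
  and op_add: "x \<in> C \<Longrightarrow> y \<in> C \<Longrightarrow> d (A (add x y)) (add (A x) (A y)) = 0"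
  and op_smul: "x \<in> C \<Longrightarrow> 0 \<le> c \<Longrightarrow> d (A (smul c x)) (smul c (A x)) = 0"
  and op_cont: "x \<in> C \<Longrightarrow> 0 < e \<Longrightarrow> \<exists>r>0. \<forall>y\<in>C. d y x < r \<longrightarrow> d (A y) (A x) < e"
  using A unfolding operator_def by blast+

text \<open>Distinct elements may have distance zero, so this needs an argument: a point at distance
  zero lies in every neighbourhood, and continuity forces the images together.\<close>

lemma op_cong:
  assumes "x \<in> C" "y \<in> C" "d x y = 0"
  shows "d (A x) (A y) = 0"
proof (rule ccontr)
  assume "d (A x) (A y) \<noteq> 0"
  then have "0 < d (A x) (A y)" using dist_nonneg[of "A x" "A y"] op_mem assms by simp
  then show False using op_cont[OF assms(2), of "d (A x) (A y)"] assms by force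
qed

lemma op_zero: "nrm (A z) = 0"
proof -
  have "d (A (smul 0 z)) (smul 0 (A z)) = 0" using op_smul zero_mem by simp
  then show ?thesis using smul_0 zero_mem op_mem by simp
qed

lemma norm_op_smul: "x \<in> C \<Longrightarrow> 0 \<le> c \<Longrightarrow> c * nrm (A x) \<le> 2 * nrm (A (smul c x))"
  using norm_cong[of "smul c (A x)" "A (smul c x)"] op_smul[of x c] op_mem smul_mem dist_commute norm_smul
  by simp

lemma op_bounded: "\<exists>M>0. \<forall>x\<in>C. nrm (A x) \<le> M * nrm x"
proof -
  obtain r where r: "0 < r" "\<And>y. y \<in> C \<Longrightarrow> nrm y < r \<Longrightarrow> d (A y) (A z) < 1"
    using op_cont[OF zero_mem, of 1] by auto
  have small: "nrm (A y) < 2" if "y \<in> C" "nrm y < r" for y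
    using dist_triangle[of "A y" "A z" z] op_zero r(2)[OF that] op_mem that zero_mem by simp
  \<comment> \<open>Scaling \<open>x\<close> to norm r/2, that is by
    \<open>c = r / (2 * nrm x)\<close>, gives \<open>c * nrm (A x) \<le> 4\<close>, hence the
    constant 8/r.\<close>
  have "nrm (A x) \<le> 8 / r * nrm x" if x: "x \<in> C" for x
  proof (cases "nrm x = 0")
    case True
    \<comment> \<open>All multiples of \<open>x\<close> have norm zero and stay in the ball, so
      every multiple of \<open>nrm (A x)\<close> is at most 4; the factor
      \<open>5 / nrm (A x)\<close> would produce 5.\<close>
    have "c * nrm (A x) \<le> 4" if "0 \<le> c" for c
      using norm_op_smul[OF x that] small[of "smul c x"] smul_mem[OF x that] norm_smul[OF x that] True r(1) by simp
    from this[of "5 / nrm (A x)"] have "nrm (A x) = 0"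
      using norm_nonneg[of "A x"] op_mem[OF x] by (cases "nrm (A x) = 0") simp_all
    then show ?thesis using True by simp
  next
    case False
    then have p: "0 < nrm x" using norm_nonneg[OF x] by simp
    define c where "c = r / (2 * nrm x)"
    have c: "0 < c" using p r(1) by (simp add: c_def)
    have "nrm (smul c x) < r" using norm_smul[OF x, of c] c p r(1) by (simp add: c_def)
    then have "c * nrm (A x) \<le> 4"
      using norm_op_smul[OF x, of c] small[of "smul c x"] smul_mem[OF x, of c] c by simp
    then show ?thesis using p r(1) by (simp add: c_def field_simps)
  qed
  then show ?thesis using r(1) by (intro exI[of _ "8 / r"]) auto
qed

lemma bounds_bdd_below: "bdd_below {M. M > 0 \<and> (\<forall>x\<in>C. nrm (A x) \<le> M * nrm x)}"
  unfolding bdd_below_def by (rule exI[of _ 0]) auto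

lemma norm_le_op_bound:
  assumes x: "x \<in> C" shows "nrm (A x) \<le> op_bound A * nrm x"
proof (cases "nrm x = 0")
  case True
  then show ?thesis using op_bounded x by force
next
  case False
  then have p: "0 < nrm x" using norm_nonneg[OF x] by simp
  have "nrm (A x) / nrm x \<le> op_bound A"
    unfolding op_bound_def using op_bounded x p by (intro cInf_greatest) (auto simp: field_simps)
  then show ?thesis using p by (simp add: field_simps)
qed

lemma op_bound_witness:
  assumes "0 < c" "c < op_bound A"
  obtains x where "x \<in> C" "c * nrm x < nrm (A x)" "0 < nrm x"
proof -
  have "\<exists>x\<in>C. c * nrm x < nrm (A x)"
  proof (rule ccontr)
    assume "\<not> ?thesis"
    then have "op_bound A \<le> c"
      unfolding op_bound_def using bounds_bdd_below assms by (intro cInf_lower) auto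
    then show False using assms by simp
  qed
  then obtain x where x: "x \<in> C" "c * nrm x < nrm (A x)" by blast
  moreover have "0 < nrm x"
    using x norm_le_op_bound[OF x(1)] norm_nonneg[OF x(1)] by (cases "nrm x = 0") simp_all
  ultimately show ?thesis by (rule that)
qed

text \<open>Without subtraction, a perturbation cannot be replaced by its negative; instead, if
  \<open>A (s + x)\<close> is small then \<open>A s\<close> itself is already large.\<close>

lemma hump_step:
  assumes s: "s \<in> C" and q: "0 < q" and L: "0 < op_bound A"
  obtains x where "x \<in> C" "nrm x \<le> q" "op_bound A * q / 32 \<le> nrm (A (add s x))"
proof -
  obtain y where y: "y \<in> C" "op_bound A / 2 * nrm y < nrm (A y)" "0 < nrm y"
    using op_bound_witness[of "op_bound A / 2"] L by auto
  \<comment> \<open>Scaling makes the norm exactly \<open>q\<close>. The near-optimal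
    \<open>y\<close> costs a factor 2 and homogeneity up to distance zero another 2, whence
    \<open>op_bound A * q / 4\<close> below.\<close>
  define c where "c = q / nrm y"
  have c: "0 < c" using q y by (simp add: c_def)
  define x where "x = smul c y"
  have x: "x \<in> C" "nrm x = q" using smul_mem norm_smul y c by (auto simp: x_def c_def)
  have "op_bound A * q / 2 \<le> c * nrm (A y)" using y(2,3) q by (simp add: c_def field_simps)
  also have "\<dots> \<le> 2 * nrm (A x)" using norm_op_smul[OF y(1), of c] c by (simp add: x_def)
  finally have Ax: "op_bound A * q / 4 \<le> nrm (A x)" by simp
  note mem = op_mem[OF s] op_mem[OF x(1)] add_mem[OF s x(1)] op_mem[OF add_mem[OF s x(1)]] zero_mem
    add_mem[OF op_mem[OF s] op_mem[OF x(1)]]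
  \<comment> \<open>Translation by \<open>A s\<close> replaces the norm of \<open>A x\<close> by a
    distance between two sums, and two relaxed triangle inequalities bound it by 4 times the sum of
    the norms at \<open>add s x\<close> and at \<open>s\<close>. Together with the earlier factor 4
    and a factor 2 for the larger of two norms, 1/32 remains.\<close>
  have "nrm (A x) = d (add (A s) (A x)) (add (A s) z)" using dist_add mem by simp
  also have "\<dots> \<le> 2 * (d (add (A s) (A x)) (A (add s x)) + d (A (add s x)) (A s))"
    using dist_triangle mem add_zero by simp
  also have "\<dots> = 2 * d (A (add s x)) (A s)"
    using op_add[OF s x(1)] dist_commute mem by simp
  also have "\<dots> \<le> 4 * (nrm (A (add s x)) + nrm (A s))"
    using dist_triangle[of "A (add s x)" z "A s"] dist_commute[of z "A s"] mem by simp
  finally have "nrm (A x) \<le> 4 * (nrm (A (add s x)) + nrm (A s))" .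
  moreover have "K / 32 \<le> a \<or> K / 32 \<le> b" if "y \<le> 4 * (a + b)" "K / 4 \<le> y" for K a b y :: real
    using that by (auto simp: field_simps)
  ultimately have "op_bound A * q / 32 \<le> nrm (A (add s x)) \<or> op_bound A * q / 32 \<le> nrm (A s)"
    using Ax by blast
  then show ?thesis
  proof
    \<comment> \<open>The increment \<open>z\<close> leaves the partial sum where it is.\<close>
    assume "op_bound A * q / 32 \<le> nrm (A s)"
    then show ?thesis
      by (intro that[of z]) (use q zero_mem dist_self add_zero s in auto)
  qed (use that x in auto)
qed

end

section \<open>The gliding hump\<close>

theorem uniform_boundedness:
  fixes A :: "'j \<Rightarrow> 'a \<Rightarrow> 'a"
  assumes A: "\<And>j. j \<in> J \<Longrightarrow> operator (A j)"
    and pw: "\<And>x. x \<in> C \<Longrightarrow> \<exists>M. \<forall>j\<in>J. nrm (A j x) \<le> M"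
  shows "\<exists>M>0. \<forall>j\<in>J. op_bound (A j) \<le> M"
proof (rule ccontr)
  assume neg: "\<not> ?thesis"
  \<comment> \<open>With L the bound of the \<open>n\<close>-th operator, the remainder after the
    hump has norm at most \<open>4 * q ^ Suc n\<close>, so its image has norm at most
    \<open>L * q ^ n / 128\<close>. The relaxed triangle inequality doubles this to
    \<open>L * q ^ n / 64\<close>, half of the hump \<open>L * q ^ n / 32\<close>; this is what 512
    is chosen for.\<close>
  define q :: real where "q = 1/512"
  have q: "0 < q" by (simp add: q_def)
  \<comment> \<open>The threshold makes \<open>op_bound (A (j n)) * q ^ n\<close> exceed
    \<open>n + 1\<close>, so the humps grow without bound although the increments shrink.\<close>
  have "\<exists>j. \<forall>n. j n \<in> J \<and> real (Suc n) / q ^ n < op_bound (A (j n))"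
  proof (intro choice allI)
    fix n
    have "0 < real (Suc n) / q ^ n" using q by simp
    with neg show "\<exists>j. j \<in> J \<and> real (Suc n) / q ^ n < op_bound (A j)" by (meson not_le)
  qed
  then obtain j where j: "\<And>n. j n \<in> J" "\<And>n. real (Suc n) / q ^ n < op_bound (A (j n))" by blast
  have L: "0 < op_bound (A (j n))" for n
    using j(2)[of n] q by (smt (verit) divide_pos_pos of_nat_0_less_iff zero_less_Suc zero_less_power)
  \<comment> \<open>The increment depends on the partial sum reached so far, so the choice is a
    function of both and is fed into a recursion.\<close>
  define pick where "pick n s = (SOME x. x \<in> C \<and> nrm x \<le> q ^ n \<and>
    op_bound (A (j n)) * q ^ n / 32 \<le> nrm (A (j n) (add s x)))" for n s
  have pick: "pick n s \<in> C \<and> nrm (pick n s) \<le> q ^ n \<and>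
    op_bound (A (j n)) * q ^ n / 32 \<le> nrm (A (j n) (add s (pick n s)))" if s: "s \<in> C" for n s
  proof -
    obtain x where "x \<in> C" "nrm x \<le> q ^ n" "op_bound (A (j n)) * q ^ n / 32 \<le> nrm (A (j n) (add s x))"
      using hump_step[OF A[OF j(1)] s zero_less_power[OF q] L] by metis
    then have "\<exists>x. x \<in> C \<and> nrm x \<le> q ^ n \<and> op_bound (A (j n)) * q ^ n / 32 \<le> nrm (A (j n) (add s x))"
      by blast
    from someI_ex[OF this] show ?thesis unfolding pick_def .
  qed
  define s where "s = rec_nat z (\<lambda>n s. add s (pick n s))"
  have s_rec: "s 0 = z" "s (Suc n) = add (s n) (pick n (s n))" for n by (auto simp: s_def)
  have s: "s n \<in> C" for n
    by (induction n) (auto simp: s_rec zero_mem pick add_mem)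
  define x where "x n = pick n (s n)" for n
  have x: "x n \<in> C" "nrm (x n) \<le> q ^ n" "op_bound (A (j n)) * q ^ n / 32 \<le> nrm (A (j n) (s (Suc n)))" for n
    using pick[OF s] by (auto simp: x_def s_rec)
  obtain t where t: "\<And>n. t n \<in> C" "\<And>n. d (t n) (add (x n) (t (Suc n))) = 0" "\<And>n. nrm (t n) \<le> 4 * q ^ n"
    using series[of x] x(1,2) unfolding q_def by blast
  \<comment> \<open>Peeling off one term at a time shows the same element \<open>t 0\<close> behind
    every stage, so that a single pointwise bound \<open>M\<close> serves all
    \<open>n\<close>.\<close>
  have st: "d (t 0) (add (s n) (t n)) = 0" for n
  proof (induction n)
    case 0
    then show ?case using t(1) add_zero dist_self by (simp add: s_rec)
  next
    case (Suc n)
    have "d (add (s n) (t n)) (add (s n) (add (x n) (t (Suc n)))) = 0"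
      using dist_add s t x add_mem by simp
    moreover have "add (s n) (add (x n) (t (Suc n))) = add (s (Suc n)) (t (Suc n))"
      using assoc s t x by (simp add: s_rec x_def)
    ultimately show ?case using eq_trans[OF _ _ _ Suc] s t(1) add_mem by simp
  qed
  obtain M where M: "\<And>i. i \<in> J \<Longrightarrow> nrm (A i (t 0)) \<le> M" using pw[OF t(1)] by blast
  have "real (Suc n) \<le> 512 * M" for n
  proof -
    let ?A = "A (j n)" and ?L = "op_bound (A (j n))" and ?s = "s (Suc n)" and ?t = "t (Suc n)"
    note op = A[OF j(1)[of n]]
    note mem = op_mem[OF op s[of "Suc n"]] op_mem[OF op t(1)[of "Suc n"]] op_mem[OF op t(1)[of 0]]
      add_mem[OF s[of "Suc n"] t(1)[of "Suc n"]] zero_mem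
    note mem' = add_mem[OF mem(1,2)] op_mem[OF op mem(4)]
    have "d (?A (t 0)) (?A (add ?s ?t)) = 0" using op_cong[OF op t(1) mem(4) st] .
    then have "d (?A (t 0)) (add (?A ?s) (?A ?t)) = 0"
      using eq_trans[OF mem(3) mem'(2,1)] op_add[OF op s t(1)] by blast
    then have a: "nrm (add (?A ?s) (?A ?t)) \<le> 2 * nrm (?A (t 0))"
      using norm_cong[OF mem'(1) mem(3)] dist_commute[OF mem(3) mem'(1)] by simp
    \<comment> \<open>Adding the image of the remainder moves the image of the partial sum by
      exactly the norm of the former; this recovers a bound on a summand from a bound on the
      sum.\<close>
    have "nrm (?A ?s) \<le> 2 * (d (?A ?s) (add (?A ?s) (?A ?t)) + nrm (add (?A ?s) (?A ?t)))"
      using dist_triangle mem mem' by blast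
    also have "d (?A ?s) (add (?A ?s) (?A ?t)) = d (add (?A ?s) z) (add (?A ?s) (?A ?t))"
      using add_zero mem by simp
    also have "\<dots> = nrm (?A ?t)" using dist_add[OF mem(1) zero_mem mem(2)] dist_commute mem by simp
    finally have b: "nrm (?A ?s) \<le> 2 * nrm (?A ?t) + 4 * nrm (?A (t 0))" using a by simp
    have "nrm (?A ?t) \<le> ?L * nrm ?t" using norm_le_op_bound[OF op t(1)] .
    also have "\<dots> \<le> ?L * (4 * q ^ Suc n)" using t(3)[of "Suc n"] L[of n] by (intro mult_left_mono) auto
    finally have "nrm (?A ?t) \<le> ?L * q ^ n / 128" by (simp add: q_def)
    then have "?L * q ^ n / 64 \<le> 4 * M" using x(3)[of n] b M[OF j(1)[of n]] by linarith
    moreover have "real (Suc n) \<le> ?L * q ^ n" using j(2)[of n] q by (simp add: field_simps)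
    ultimately show ?thesis by simp
  qed
  moreover obtain n where "512 * M < real n" using reals_Archimedean2 by blast
  ultimately show False by (smt (verit) of_nat_Suc)
qed

end

subsection \<open>Supremum metrics\<close>

text \<open>The spaces live inside the datatype \<open>felem\<close>; a constructor \<open>f\<close>
  with selector \<open>g\<close> carries the cone axioms over, so that the proofs can deal with
  plain functions and sequences.\<close>

lemma fuzzy_cone_transfer:
  assumes "fuzzy_cone K add smul d z" and gf: "\<And>x. g (f x) = x"
  shows "fuzzy_cone (f ` K) (\<lambda>x y. f (add (g x) (g y))) (\<lambda>c x. f (smul c (g x))) (\<lambda>x y. d (g x) (g y)) (f z)"
proof -
  interpret fuzzy_cone K add smul d z by fact
  show ?thesis
  proof
    show "d (g x) (g w) \<le> 2 * (d (g x) (g y) + d (g y) (g w))"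
      if "x \<in> f ` K" "y \<in> f ` K" "w \<in> f ` K" for x y w
      using that dist_triangle gf by force
  next
    fix x :: "nat \<Rightarrow> 'b"
    assume x: "\<And>k. x k \<in> f ` K" "\<And>k. d (g (x k)) (g (f z)) \<le> (1/512) ^ k"
    have "g (x k) \<in> K" for k using x(1)[of k] gf by auto
    then obtain t where t: "\<forall>n. t n \<in> K \<and> d (t n) (add (g (x n)) (t (Suc n))) = 0 \<and> d (t n) z \<le> 4 * (1/512) ^ n"
      using series[of "\<lambda>k. g (x k)"] x(2) gf by auto
    then show "\<exists>t. \<forall>n. t n \<in> f ` K \<and> d (g (t n)) (g (f (add (g (x n)) (g (t (Suc n)))))) = 0 \<and>
        d (g (t n)) (g (f z)) \<le> 4 * (1/512) ^ n"
      by (intro exI[of _ "\<lambda>n. f (t n)"]) (auto simp: gf)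
  qed (auto simp: gf zero_mem add_mem smul_mem assoc add_zero smul_0 dist_nonneg dist_self
      dist_add norm_smul intro: dist_commute)
qed

definition fspace_cone :: "fspace \<Rightarrow> bool" where
  "fspace_cone S \<longleftrightarrow> fuzzy_cone (carrier S) (fadd S) (fsmul S) (fdist S) (fzero S)"

definition padd :: "('i \<Rightarrow> fz) \<Rightarrow> ('i \<Rightarrow> fz) \<Rightarrow> 'i \<Rightarrow> fz" where
  "padd f g = (\<lambda>t. fz_add (f t) (g t))"

definition psmul :: "real \<Rightarrow> ('i \<Rightarrow> fz) \<Rightarrow> 'i \<Rightarrow> fz" where
  "psmul c f = (\<lambda>t. fz_smul c (f t))"

abbreviation pzero :: "'i \<Rightarrow> fz" where "pzero \<equiv> \<lambda>t. fz_zero"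

lemma fspace_cone_fun_space: "fuzzy_cone K padd psmul dst pzero \<Longrightarrow> fspace_cone (fun_space K dst)"
  using fuzzy_cone_transfer[of K padd psmul dst pzero ffun FFun]
  by (simp add: fspace_cone_def fun_space_def padd_def psmul_def)

lemma fspace_cone_seq_space: "fuzzy_cone K padd psmul dst pzero \<Longrightarrow> fspace_cone (seq_space K dst)"
  using fuzzy_cone_transfer[of K padd psmul dst pzero fseq FSeq]
  by (simp add: fspace_cone_def seq_space_def padd_def psmul_def)

text \<open>One supremum metric covers \<open>Dstar\<close>, \<open>mu\<close> and, over a one-point
  index type, \<open>fz_dist\<close> itself.\<close>

definition sup_dist :: "'i set \<Rightarrow> ('i \<Rightarrow> fz) \<Rightarrow> ('i \<Rightarrow> fz) \<Rightarrow> real" where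
  "sup_dist T f g = Sup ((\<lambda>t. fz_dist (f t) (g t)) ` T)"

lemma summable_scale: "summable (\<lambda>k. (1/512::real) ^ (k + n))"
  by (intro summable_ignore_initial_segment summable_geometric) simp

lemma suminf_scale: "(\<Sum>k. (1/512::real) ^ (k + n)) \<le> 2 * (1/512) ^ n"
proof -
  have "(\<Sum>k. (1/512::real) ^ (k + n)) = (\<Sum>k. (1/512) ^ n * (1/512::real) ^ k)"
    by (simp add: power_add mult.commute)
  also have "\<dots> = (1/512) ^ n * (512/511)"
    using suminf_geometric[of "1/512::real"] by (subst suminf_mult) (simp_all add: summable_geometric)
  also have "\<dots> \<le> 2 * (1/512) ^ n" by simp
  finally show ?thesis .
qed

text \<open>The assumption \<open>sum\<close> is the one place where completeness of a particular
  function class enters: closure under dominated pointwise series. \<open>outside\<close> turns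
  bounds on \<open>T\<close> into bounds at every index, the form in which \<open>sum\<close> asks
  for them.\<close>

locale sup_cone =
  fixes T :: "'i set" and K :: "('i \<Rightarrow> fz) set"
  assumes nonempty: "T \<noteq> {}"
    and fuzzy: "f \<in> K \<Longrightarrow> fuzzy_number (f t)"
    and outside: "f \<in> K \<Longrightarrow> t \<notin> T \<Longrightarrow> f t = fz_zero"
    and bounded: "f \<in> K \<Longrightarrow> \<exists>B. \<forall>t\<in>T. fz_dist (f t) fz_zero \<le> B"
    and zero: "pzero \<in> K"
    and add: "f \<in> K \<Longrightarrow> g \<in> K \<Longrightarrow> padd f g \<in> K"
    and smul: "f \<in> K \<Longrightarrow> 0 \<le> c \<Longrightarrow> psmul c f \<in> K"
    and sum: "(\<And>k. x k \<in> K) \<Longrightarrow> (\<And>k t. fz_dist (x k t) fz_zero \<le> B k) \<Longrightarrow> summable B \<Longrightarrow>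
      (\<lambda>t. fz_sum (\<lambda>k. x k t)) \<in> K"
begin

lemma sup_dist_leI: "(\<And>t. t \<in> T \<Longrightarrow> fz_dist (f t) (g t) \<le> B) \<Longrightarrow> sup_dist T f g \<le> B"
  unfolding sup_dist_def using nonempty by (intro cSup_least) auto

lemma dist_le_sup_dist:
  assumes f: "f \<in> K" and g: "g \<in> K" and t: "t \<in> T"
  shows "fz_dist (f t) (g t) \<le> sup_dist T f g"
proof -
  obtain B1 B2 where B: "\<And>t. t \<in> T \<Longrightarrow> fz_dist (f t) fz_zero \<le> B1" "\<And>t. t \<in> T \<Longrightarrow> fz_dist (g t) fz_zero \<le> B2"
    using bounded f g by metis
  have "fz_dist (f t) (g t) \<le> B1 + B2" if "t \<in> T" for t
    using fz_dist_le_norms[OF fuzzy fuzzy, OF f g, of t t] B[OF that] by linarith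
  then have "bdd_above ((\<lambda>t. fz_dist (f t) (g t)) ` T)" unfolding bdd_above_def by blast
  then show ?thesis unfolding sup_dist_def using t by (intro cSup_upper) auto
qed

lemma norm_le_sup_dist: "f \<in> K \<Longrightarrow> fz_dist (f t) fz_zero \<le> sup_dist T f pzero"
proof -
  assume f: "f \<in> K"
  obtain t0 where t0: "t0 \<in> T" using nonempty by blast
  show ?thesis
  proof (cases "t \<in> T")
    case True then show ?thesis using dist_le_sup_dist[OF f zero] by simp
  next
    case False
    then show ?thesis
      using dist_le_sup_dist[OF f zero t0] fz_dist_nonneg[OF fuzzy[OF f, of t0] fuzzy_number_zero] outside[OF f]
      by simp
  qed
qed

lemma fz_summable_pointwise:
  assumes "\<And>k. x k \<in> K" "\<And>k. sup_dist T (x k) pzero \<le> B k" "summable B"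
  shows "fz_summable (\<lambda>k. x k t)" "(\<lambda>t. fz_sum (\<lambda>k. x k t)) \<in> K"
    "sup_dist T (\<lambda>t. fz_sum (\<lambda>k. x k t)) pzero \<le> (\<Sum>k. B k)"
proof -
  have le: "fz_dist (x k t) fz_zero \<le> B k" for k t
    using norm_le_sup_dist[OF assms(1)] assms(2) by (rule order_trans)
  show "fz_summable (\<lambda>k. x k t)" by (rule fz_summableI[OF fuzzy[OF assms(1)] le assms(3)])
  show "(\<lambda>t. fz_sum (\<lambda>k. x k t)) \<in> K" by (rule sum[OF assms(1) le assms(3)])
  show "sup_dist T (\<lambda>t. fz_sum (\<lambda>k. x k t)) pzero \<le> (\<Sum>k. B k)"
    by (rule sup_dist_leI) (rule fz_norm_sum_le_bound[OF fuzzy[OF assms(1)] le assms(3)])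
qed

lemma sup_dist_nonneg: "f \<in> K \<Longrightarrow> g \<in> K \<Longrightarrow> 0 \<le> sup_dist T f g"
  using nonempty dist_le_sup_dist fz_dist_nonneg fuzzy by (meson ex_in_conv order_trans)

lemma sup_dist_triangle:
  assumes "f \<in> K" "g \<in> K" "h \<in> K"
  shows "sup_dist T f h \<le> sup_dist T f g + sup_dist T g h"
proof (rule sup_dist_leI)
  fix t assume t: "t \<in> T"
  show "fz_dist (f t) (h t) \<le> sup_dist T f g + sup_dist T g h"
    using fz_dist_triangle[OF fuzzy fuzzy fuzzy, OF assms, of t t t] dist_le_sup_dist[OF assms(1,2) t]
      dist_le_sup_dist[OF assms(2,3) t] by linarith
qed

lemma sup_dist_norm_smul:
  assumes f: "f \<in> K" and c: "0 \<le> c"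
  shows "sup_dist T (psmul c f) pzero = c * sup_dist T f pzero"
proof (rule antisym)
  show "sup_dist T (psmul c f) pzero \<le> c * sup_dist T f pzero"
    using c norm_le_sup_dist[OF f] fuzzy[OF f]
    by (intro sup_dist_leI) (auto simp: psmul_def fz_norm_smul intro: mult_left_mono)
  show "c * sup_dist T f pzero \<le> sup_dist T (psmul c f) pzero"
  proof (cases "c = 0")
    case True
    then show ?thesis using sup_dist_nonneg[OF smul[OF f c] zero] by simp
  next
    case False
    have "sup_dist T f pzero \<le> sup_dist T (psmul c f) pzero / c"
    proof (rule sup_dist_leI)
      fix t
      show "fz_dist (f t) fz_zero \<le> sup_dist T (psmul c f) pzero / c"
        using norm_le_sup_dist[OF smul[OF f c], of t] False c fuzzy[OF f, of t]
        by (simp add: psmul_def fz_norm_smul field_simps)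
    qed
    then show ?thesis using False c by (simp add: field_simps)
  qed
qed

lemma sup_dist_add: "f \<in> K \<Longrightarrow> g \<in> K \<Longrightarrow> h \<in> K \<Longrightarrow> sup_dist T (padd h f) (padd h g) = sup_dist T f g"
  unfolding sup_dist_def by (simp add: padd_def fuzzy)

lemma sup_dist_self: "sup_dist T f f = 0"
  unfolding sup_dist_def using nonempty by simp

lemma fuzzy_cone: "fuzzy_cone K padd psmul (sup_dist T) pzero"
proof
  show "sup_dist T f g = sup_dist T g f" for f g unfolding sup_dist_def by (simp add: fz_dist_commute)
  show "sup_dist T f h \<le> 2 * (sup_dist T f g + sup_dist T g h)" if "f \<in> K" "g \<in> K" "h \<in> K" for f g h
    using sup_dist_triangle[OF that] sup_dist_nonneg that by (smt (verit))
  fix x :: "nat \<Rightarrow> 'i \<Rightarrow> fz"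
  assume x: "\<And>k. x k \<in> K" "\<And>k. sup_dist T (x k) pzero \<le> (1/512) ^ k"
  \<comment> \<open>The remainders are the sums of the shifted series; splitting off the head gives
    literal equality, hence distance zero.\<close>
  define t where "t n = (\<lambda>i. fz_sum (\<lambda>k. x (k + n) i))" for n
  note p = fz_summable_pointwise[of "\<lambda>k. x (k + _)", OF x(1,2) summable_scale]
  have "t n = padd (x n) (t (Suc n))" for n
    using fz_sum_head[OF p(1)] by (simp add: t_def padd_def)
  then have "sup_dist T (t n) (padd (x n) (t (Suc n))) = 0" for n
    using sup_dist_self by metis
  moreover have "t n \<in> K" for n unfolding t_def by (rule p(2))
  moreover have "sup_dist T (t n) pzero \<le> 4 * (1/512) ^ n" for n
  proof -
    have "sup_dist T (t n) pzero \<le> 2 * (1/512) ^ n"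
      unfolding t_def using p(3) suminf_scale by (rule order_trans)
    also have "\<dots> \<le> 4 * (1/512) ^ n" by simp
    finally show ?thesis .
  qed
  ultimately show "\<exists>t. \<forall>n. t n \<in> K \<and> sup_dist T (t n) (padd (x n) (t (Suc n))) = 0 \<and>
      sup_dist T (t n) pzero \<le> 4 * (1/512) ^ n" by blast
qed (auto simp: zero add smul sup_dist_self sup_dist_nonneg sup_dist_add sup_dist_norm_smul,
     auto simp: padd_def psmul_def fuzzy fz_add_assoc)

end

lemma fspace_cone_RF: "fspace_cone RF_space"
proof -
  \<comment> \<open>A single fuzzy number is a function on the one-point type.\<close>
  interpret sup_cone "UNIV :: unit set" "{f. \<forall>t. fuzzy_number (f t)}"
  proof
    fix x :: "nat \<Rightarrow> unit \<Rightarrow> fz" and B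
    assume x: "\<And>k. x k \<in> {f. \<forall>t. fuzzy_number (f t)}" and B: "\<And>k t. fz_dist (x k t) fz_zero \<le> B k" "summable B"
    then show "(\<lambda>t. fz_sum (\<lambda>k. x k t)) \<in> {f. \<forall>t. fuzzy_number (f t)}"
      by (auto intro!: fz_summable.fuzzy_number_sum fz_summableI[OF _ B])
  qed (auto simp: padd_def psmul_def)
  have "FNum ` {u. fuzzy_number u} = (\<lambda>h. FNum (h ())) ` {f. \<forall>t. fuzzy_number (f t)}"
  proof (intro equalityI subsetI)
    fix y assume "y \<in> FNum ` {u. fuzzy_number u}"
    then obtain u where "y = FNum u" "fuzzy_number u" by blast
    then show "y \<in> (\<lambda>h. FNum (h ())) ` {f. \<forall>t. fuzzy_number (f t)}"
      by (intro image_eqI[of _ _ "\<lambda>_. u"]) auto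
  qed auto
  then show ?thesis
    using fuzzy_cone_transfer[OF fuzzy_cone, of "\<lambda>x t. fnum x" "\<lambda>h. FNum (h ())"]
    by (simp add: fspace_cone_def RF_space_def sup_dist_def padd_def psmul_def UNIV_unit)
qed

lemma mu_eq: "mu = sup_dist UNIV"
  by (intro ext) (simp add: mu_def sup_dist_def)

lemma fspace_cone_m: "fspace_cone m_space"
proof -
  interpret sup_cone "UNIV :: nat set"
    "{x. (\<forall>n. fuzzy_number (x n)) \<and> (\<exists>B. \<forall>n. fz_dist (x n) fz_zero \<le> B)}"
  proof
    fix f g :: "nat \<Rightarrow> fz"
    assume "f \<in> {x. (\<forall>n. fuzzy_number (x n)) \<and> (\<exists>B. \<forall>n. fz_dist (x n) fz_zero \<le> B)}"
      "g \<in> {x. (\<forall>n. fuzzy_number (x n)) \<and> (\<exists>B. \<forall>n. fz_dist (x n) fz_zero \<le> B)}"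
    then obtain B B' where "\<forall>n. fuzzy_number (f n)" "\<forall>n. fuzzy_number (g n)"
      "\<forall>n. fz_dist (f n) fz_zero \<le> B" "\<forall>n. fz_dist (g n) fz_zero \<le> B'" by blast
    then show "padd f g \<in> {x. (\<forall>n. fuzzy_number (x n)) \<and> (\<exists>B. \<forall>n. fz_dist (x n) fz_zero \<le> B)}"
      unfolding padd_def by (auto intro!: exI[of _ "B + B'"] order_trans[OF fz_norm_add add_mono])
  next
    fix f :: "nat \<Rightarrow> fz" and c :: real
    assume "f \<in> {x. (\<forall>n. fuzzy_number (x n)) \<and> (\<exists>B. \<forall>n. fz_dist (x n) fz_zero \<le> B)}" and c: "0 \<le> c"
    then obtain B where "\<forall>n. fuzzy_number (f n)" "\<forall>n. fz_dist (f n) fz_zero \<le> B" by blast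
    then show "psmul c f \<in> {x. (\<forall>n. fuzzy_number (x n)) \<and> (\<exists>B. \<forall>n. fz_dist (x n) fz_zero \<le> B)}"
      unfolding psmul_def using c by (auto simp: fz_norm_smul intro!: exI[of _ "c * B"] mult_left_mono)
  next
    fix x :: "nat \<Rightarrow> nat \<Rightarrow> fz" and B
    assume x: "\<And>k. x k \<in> {x. (\<forall>n. fuzzy_number (x n)) \<and> (\<exists>B. \<forall>n. fz_dist (x n) fz_zero \<le> B)}"
      and B: "\<And>k t. fz_dist (x k t) fz_zero \<le> B k" "summable B"
    then show "(\<lambda>t. fz_sum (\<lambda>k. x k t)) \<in> {x. (\<forall>n. fuzzy_number (x n)) \<and> (\<exists>B. \<forall>n. fz_dist (x n) fz_zero \<le> B)}"
      by (auto intro!: fz_summable.fuzzy_number_sum fz_summableI[OF _ B] exI[of _ "\<Sum>k. B k"]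
          fz_norm_sum_le_bound)
  qed auto
  show ?thesis unfolding m_space_def mu_eq by (rule fspace_cone_seq_space) (rule fuzzy_cone)
qed

section \<open>Convergent and null sequences\<close>

definition fz_LIMSEQ :: "(nat \<Rightarrow> fz) \<Rightarrow> fz \<Rightarrow> bool" where
  "fz_LIMSEQ x u \<longleftrightarrow> (\<forall>e>0. \<exists>N. \<forall>n\<ge>N. fz_dist (x n) u < e)"

lemma fz_LIMSEQ_iff: "(\<And>n. fuzzy_number (x n)) \<Longrightarrow> fuzzy_number u \<Longrightarrow>
    fz_LIMSEQ x u \<longleftrightarrow> (\<lambda>n. fz_dist (x n) u) \<longlonglongrightarrow> 0"
  by (simp add: fz_LIMSEQ_def LIMSEQ_def)

lemma fz_LIMSEQ_add:
  assumes "\<And>n. fuzzy_number (x n)" "\<And>n. fuzzy_number (y n)" "fuzzy_number u" "fuzzy_number v"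
    and "fz_LIMSEQ x u" "fz_LIMSEQ y v"
  shows "fz_LIMSEQ (\<lambda>n. fz_add (x n) (y n)) (fz_add u v)"
proof -
  have lim: "(\<lambda>n. fz_dist (x n) u + fz_dist (y n) v) \<longlonglongrightarrow> 0"
    using tendsto_add[of "\<lambda>n. fz_dist (x n) u" 0] assms by (simp add: fz_LIMSEQ_iff)
  have "(\<lambda>n. fz_dist (fz_add (x n) (y n)) (fz_add u v)) \<longlonglongrightarrow> 0"
    by (rule tendsto_sandwich[OF _ _ tendsto_const lim]) (auto simp: assms fz_dist_add)
  then show ?thesis using assms by (simp add: fz_LIMSEQ_iff)
qed

lemma fz_LIMSEQ_smul:
  assumes "\<And>n. fuzzy_number (x n)" "fuzzy_number u" "fz_LIMSEQ x u" "0 \<le> c"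
  shows "fz_LIMSEQ (\<lambda>n. fz_smul c (x n)) (fz_smul c u)"
  using tendsto_mult_left[of "\<lambda>n. fz_dist (x n) u" 0 sequentially c] assms
  by (simp add: fz_LIMSEQ_iff fz_dist_smul)

lemma fz_LIMSEQ_norm_le:
  assumes x: "\<And>n. fuzzy_number (x n)" and u: "fuzzy_number u" and l: "fz_LIMSEQ x u"
    and B: "\<And>n. fz_dist (x n) fz_zero \<le> B"
  shows "fz_dist u fz_zero \<le> B"
proof (rule field_le_epsilon)
  fix e :: real assume "0 < e"
  then obtain n where "fz_dist (x n) u < e" using l unfolding fz_LIMSEQ_def by blast
  then show "fz_dist u fz_zero \<le> B + e"
    using fz_dist_triangle[OF u x[of n] fuzzy_number_zero] B[of n] by (simp add: fz_dist_commute)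
qed

lemma fz_LIMSEQ_bounded:
  assumes x: "\<And>n. fuzzy_number (x n)" and u: "fuzzy_number u" and l: "fz_LIMSEQ x u"
  shows "\<exists>B. \<forall>n. fz_dist (x n) fz_zero \<le> B"
proof -
  obtain B where "\<And>n. norm (fz_dist (x n) u) \<le> B"
    using convergent_imp_Bseq[of "\<lambda>n. fz_dist (x n) u"] l x u
    by (auto simp: fz_LIMSEQ_iff convergent_def Bseq_def)
  then have "fz_dist (x n) fz_zero \<le> B + fz_dist u fz_zero" for n
    using fz_dist_triangle[OF x[of n] u fuzzy_number_zero] by (smt (verit) real_norm_def)
  then show ?thesis by blast
qed

text \<open>The bounds \<open>B k\<close> pass to the limits \<open>u k\<close>, so both families
  are dominated and \<open>fz_dist_sum_small\<close> reduces the claim to closeness of finitely many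
  terms.\<close>

lemma fz_LIMSEQ_sum:
  assumes x: "\<And>k n. fuzzy_number (x k n)" and u: "\<And>k. fuzzy_number (u k)"
    and l: "\<And>k. fz_LIMSEQ (x k) (u k)" and B: "\<And>k n. fz_dist (x k n) fz_zero \<le> B k" "summable B"
  shows "fz_LIMSEQ (\<lambda>n. fz_sum (\<lambda>k. x k n)) (fz_sum u)"
  unfolding fz_LIMSEQ_def
proof (intro allI impI)
  fix e :: real assume "0 < e"
  then obtain M d where d: "0 < d" and
    small: "\<And>u v. (\<And>k. fuzzy_number (u k)) \<Longrightarrow> (\<And>k. fuzzy_number (v k)) \<Longrightarrow>
       (\<And>k. fz_dist (u k) fz_zero \<le> B k) \<Longrightarrow> (\<And>k. fz_dist (v k) fz_zero \<le> B k) \<Longrightarrow>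
       (\<And>k. k < M \<Longrightarrow> fz_dist (u k) (v k) < d) \<Longrightarrow> fz_dist (fz_sum u) (fz_sum v) < e"
    using fz_dist_sum_small[OF B(2)] by metis
  have "\<exists>N. \<forall>k. \<forall>n\<ge>N k. fz_dist (x k n) (u k) < d"
    using l d unfolding fz_LIMSEQ_def by (intro choice) blast
  then obtain N where N: "\<And>k n. N k \<le> n \<Longrightarrow> fz_dist (x k n) (u k) < d" by blast
  have uB: "fz_dist (u k) fz_zero \<le> B k" for k
    using fz_LIMSEQ_norm_le[OF x u l B(1)] .
  show "\<exists>N. \<forall>n\<ge>N. fz_dist (fz_sum (\<lambda>k. x k n)) (fz_sum u) < e"
  proof (intro exI allI impI)
    \<comment> \<open>The inserted 0 keeps the maximum defined when \<open>M = 0\<close>.\<close>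
    fix n assume n: "Max (insert 0 (N ` {..<M})) \<le> n"
    show "fz_dist (fz_sum (\<lambda>k. x k n)) (fz_sum u) < e"
      using n by (intro small x u B(1) uB N) auto
  qed
qed

lemma fspace_cone_c: "fspace_cone c_space"
proof -
  let ?K = "{x. (\<forall>n. fuzzy_number (x n)) \<and> (\<exists>u. fuzzy_number u \<and> fz_LIMSEQ x u)}"
  interpret sup_cone "UNIV :: nat set" ?K
  proof
    show "pzero \<in> ?K" by (auto simp: fz_LIMSEQ_def intro!: exI[of _ fz_zero])
    show "\<exists>B. \<forall>t\<in>UNIV. fz_dist (f t) fz_zero \<le> B" if "f \<in> ?K" for f
      using that fz_LIMSEQ_bounded by simp blast
    show "padd f g \<in> ?K" if "f \<in> ?K" "g \<in> ?K" for f g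
      using that fz_LIMSEQ_add[of f g] by (auto simp: padd_def) (metis fuzzy_number_add)
    show "psmul c f \<in> ?K" if "f \<in> ?K" "0 \<le> c" for c f
      using that fz_LIMSEQ_smul[of f _ c] by (auto simp: psmul_def) (metis fuzzy_number_smul)
    fix x B assume x: "\<And>k. x k \<in> ?K" and B: "\<And>k t. fz_dist (x k t) fz_zero \<le> B k" "summable B"
    have "\<exists>u. \<forall>k. fuzzy_number (u k) \<and> fz_LIMSEQ (x k) (u k)" using x by (intro choice) auto
    then obtain u where u: "\<And>k. fuzzy_number (u k)" "\<And>k. fz_LIMSEQ (x k) (u k)" by blast
    have f: "fuzzy_number (x k n)" for k n using x by simp
    have "fuzzy_number (fz_sum u)"
      by (rule fz_summable.fuzzy_number_sum)
        (rule fz_summableI[OF u(1) fz_LIMSEQ_norm_le[OF f u B(1)] B(2)])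
    moreover have "fuzzy_number (fz_sum (\<lambda>k. x k n))" for n
      by (rule fz_summable.fuzzy_number_sum) (rule fz_summableI[OF f B])
    ultimately show "(\<lambda>t. fz_sum (\<lambda>k. x k t)) \<in> ?K"
      using fz_LIMSEQ_sum[OF f u B] by auto
  qed auto
  show ?thesis unfolding c_space_def mu_eq fz_LIMSEQ_def[symmetric]
    by (rule fspace_cone_seq_space) (rule fuzzy_cone)
qed

lemma fspace_cone_c0: "fspace_cone c0_space"
proof -
  let ?K = "{x. (\<forall>n. fuzzy_number (x n)) \<and> fz_LIMSEQ x fz_zero}"
  interpret sup_cone "UNIV :: nat set" ?K
  proof
    show "pzero \<in> ?K" by (auto simp: fz_LIMSEQ_def)
    show "\<exists>B. \<forall>t\<in>UNIV. fz_dist (f t) fz_zero \<le> B" if "f \<in> ?K" for f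
      using that fz_LIMSEQ_bounded[of f fz_zero] by simp
    show "padd f g \<in> ?K" if "f \<in> ?K" "g \<in> ?K" for f g
      using that fz_LIMSEQ_add[of f g fz_zero fz_zero] by (simp add: padd_def)
    show "psmul c f \<in> ?K" if "f \<in> ?K" "0 \<le> c" for c f
      using that fz_LIMSEQ_smul[of f fz_zero c] by (simp add: psmul_def)
    fix x B assume x: "\<And>k. x k \<in> ?K" and B: "\<And>k t. fz_dist (x k t) fz_zero \<le> B k" "summable B"
    have f: "fuzzy_number (x k n)" for k n using x by simp
    have "fuzzy_number (fz_sum (\<lambda>k. x k n))" for n
      by (rule fz_summable.fuzzy_number_sum) (rule fz_summableI[OF f B])
    then show "(\<lambda>t. fz_sum (\<lambda>k. x k t)) \<in> ?K"
      using fz_LIMSEQ_sum[of x "\<lambda>_. fz_zero" B] f B x by simp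
  qed auto
  show ?thesis unfolding c0_space_def mu_eq fz_LIMSEQ_def[symmetric]
    by (rule fspace_cone_seq_space) (rule fuzzy_cone)
qed

subsection \<open>Continuous and Hukuhara differentiable functions\<close>

text \<open>The size function \<open>r\<close> is abstract because the lemma is applied both to the
  distance from a point, for continuity, and to the length of an interval given as a pair, for
  derivatives.\<close>

lemma finitely_many_small:
  fixes r :: "'s \<Rightarrow> real" and N :: nat
  assumes "\<And>k. k < N \<Longrightarrow> \<exists>d>0. \<forall>s. r s < d \<longrightarrow> P k s"
  shows "\<exists>d>0. \<forall>k<N. \<forall>s. r s < d \<longrightarrow> P k s"
  using assms
proof (induction N)
  case 0
  then show ?case by (intro exI[of _ 1]) simp
next
  case (Suc N)
  have "\<exists>d>0. \<forall>k<N. \<forall>s. r s < d \<longrightarrow> P k s" by (rule Suc.IH) (simp add: Suc.prems)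
  moreover have "\<exists>d>0. \<forall>s. r s < d \<longrightarrow> P N s" by (simp add: Suc.prems)
  ultimately obtain d1 d2 where "d1 > 0" "\<forall>k<N. \<forall>s. r s < d1 \<longrightarrow> P k s" "d2 > 0" "\<forall>s. r s < d2 \<longrightarrow> P N s"
    by blast
  then show ?case by (intro exI[of _ "min d1 d2"]) (auto simp: less_Suc_eq)
qed

lemma C_car_fuzzy: "f \<in> C_car a b \<Longrightarrow> fuzzy_number (f t)"
  and C_car_outside: "f \<in> C_car a b \<Longrightarrow> t \<notin> {a..b} \<Longrightarrow> f t = fz_zero"
proof -
  assume "f \<in> C_car a b"
  then have f: "\<And>t. t \<in> {a..b} \<Longrightarrow> fuzzy_number (f t)" "\<And>t. t \<notin> {a..b} \<Longrightarrow> f t = fz_zero"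
    unfolding C_car_def fuzzy_fun_on_def by blast+
  show "fuzzy_number (f t)" using f by (cases "t \<in> {a..b}") auto
  show "t \<notin> {a..b} \<Longrightarrow> f t = fz_zero" by (rule f)
qed

lemma C_car_cont: "f \<in> C_car a b \<Longrightarrow> t \<in> {a..b} \<Longrightarrow> 0 < e \<Longrightarrow>
    \<exists>d>0. \<forall>s\<in>{a..b}. \<bar>s - t\<bar> < d \<longrightarrow> fz_dist (f s) (f t) < e"
  unfolding C_car_def by blast

lemma C_carI:
  assumes "\<And>t. fuzzy_number (f t)" "\<And>t. t \<notin> {a..b} \<Longrightarrow> f t = fz_zero"
    and "\<And>t e. t \<in> {a..b} \<Longrightarrow> 0 < e \<Longrightarrow> \<exists>d>0. \<forall>s\<in>{a..b}. \<bar>s - t\<bar> < d \<longrightarrow> fz_dist (f s) (f t) < e"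
  shows "f \<in> C_car a b"
  using assms unfolding C_car_def fuzzy_fun_on_def by blast

text \<open>Boundedness is compactness of [a,b] applied to the continuous norm function. For series,
  \<open>fz_dist_sum_small\<close> leaves finitely many terms, whose continuity radii have a common
  positive lower bound.\<close>

lemma sup_cone_C:
  assumes "a < b" shows "sup_cone {a..b} (C_car a b)"
proof
  show "{a..b} \<noteq> {}" using assms by simp
  show "fuzzy_number (f t)" if "f \<in> C_car a b" for f t using C_car_fuzzy[OF that] .
  show "f t = fz_zero" if "f \<in> C_car a b" "t \<notin> {a..b}" for f t using C_car_outside[OF that] .
  show "pzero \<in> C_car a b" by (rule C_carI) (auto intro: exI[of _ 1])
next
  fix f assume f: "f \<in> C_car a b"
  have "continuous_on {a..b} (\<lambda>t. fz_dist (f t) fz_zero)"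
    unfolding continuous_on_iff
  proof (intro ballI allI impI)
    fix t e :: real assume "t \<in> {a..b}" "0 < e"
    then obtain d where d: "0 < d" "\<And>s. s \<in> {a..b} \<Longrightarrow> \<bar>s - t\<bar> < d \<Longrightarrow> fz_dist (f s) (f t) < e"
      using C_car_cont[OF f] by blast
    have le: "\<bar>fz_dist (f s) fz_zero - fz_dist (f t) fz_zero\<bar> \<le> fz_dist (f s) (f t)" for s
      using fz_dist_triangle[of "f s" "f t" fz_zero] fz_dist_triangle[of "f t" "f s" fz_zero]
        fz_dist_commute[of "f s" "f t"] C_car_fuzzy[OF f] by simp
    have "dist (fz_dist (f s) fz_zero) (fz_dist (f t) fz_zero) < e" if "s \<in> {a..b}" "\<bar>s - t\<bar> < d" for s
      using le[of s] d(2)[OF that] unfolding dist_real_def by linarith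
    then show "\<exists>d>0. \<forall>s\<in>{a..b}. dist s t < d \<longrightarrow> dist (fz_dist (f s) fz_zero) (fz_dist (f t) fz_zero) < e"
      using d(1) by (intro exI[of _ d]) (auto simp: dist_real_def)
  qed
  then have "bounded ((\<lambda>t. fz_dist (f t) fz_zero) ` {a..b})"
    by (intro compact_imp_bounded compact_continuous_image) auto
  then obtain B where "\<forall>y \<in> (\<lambda>t. fz_dist (f t) fz_zero) ` {a..b}. norm y \<le> B"
    unfolding bounded_iff by blast
  then show "\<exists>B. \<forall>t\<in>{a..b}. fz_dist (f t) fz_zero \<le> B" by (intro exI[of _ B]) auto
next
  fix f g assume f: "f \<in> C_car a b" and g: "g \<in> C_car a b"
  show "padd f g \<in> C_car a b"
  proof (rule C_carI)
    fix t e :: real assume t: "t \<in> {a..b}" and "0 < e"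
    then have e: "0 < e / 2" by simp
    obtain d1 where d1: "d1 > 0" "\<And>s. s \<in> {a..b} \<Longrightarrow> \<bar>s - t\<bar> < d1 \<Longrightarrow> fz_dist (f s) (f t) < e / 2"
      using C_car_cont[OF f t e] by blast
    obtain d2 where d2: "d2 > 0" "\<And>s. s \<in> {a..b} \<Longrightarrow> \<bar>s - t\<bar> < d2 \<Longrightarrow> fz_dist (g s) (g t) < e / 2"
      using C_car_cont[OF g t e] by blast
    show "\<exists>d>0. \<forall>s\<in>{a..b}. \<bar>s - t\<bar> < d \<longrightarrow> fz_dist (padd f g s) (padd f g t) < e"
    proof (intro exI[of _ "min d1 d2"] conjI ballI impI)
      fix s assume s: "s \<in> {a..b}" "\<bar>s - t\<bar> < min d1 d2"
      have "fz_dist (padd f g s) (padd f g t) \<le> fz_dist (f s) (f t) + fz_dist (g s) (g t)"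
        unfolding padd_def using C_car_fuzzy f g by (intro fz_dist_add) auto
      then show "fz_dist (padd f g s) (padd f g t) < e" using d1(2)[OF s(1)] d2(2)[OF s(1)] s by simp
    qed (use d1 d2 in simp)
  qed (use f g C_car_fuzzy C_car_outside in \<open>auto simp: padd_def\<close>)
next
  fix f and c :: real assume f: "f \<in> C_car a b" and c: "0 \<le> c"
  show "psmul c f \<in> C_car a b"
  proof (rule C_carI)
    fix t e :: real assume t: "t \<in> {a..b}" and e: "0 < e"
    \<comment> \<open>\<open>c + 1\<close> instead of \<open>c\<close> also covers
      \<open>c = 0\<close>.\<close>
    then have "0 < e / (c + 1)" using c by simp
    then obtain d where d: "d > 0" "\<And>s. s \<in> {a..b} \<Longrightarrow> \<bar>s - t\<bar> < d \<Longrightarrow> fz_dist (f s) (f t) < e / (c + 1)"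
      using C_car_cont[OF f t] by blast
    show "\<exists>d>0. \<forall>s\<in>{a..b}. \<bar>s - t\<bar> < d \<longrightarrow> fz_dist (psmul c f s) (psmul c f t) < e"
    proof (intro exI[of _ d] conjI ballI impI)
      fix s assume s: "s \<in> {a..b}" "\<bar>s - t\<bar> < d"
      have "fz_dist (psmul c f s) (psmul c f t) = c * fz_dist (f s) (f t)"
        unfolding psmul_def using C_car_fuzzy[OF f] c by (intro fz_dist_smul) auto
      also have "\<dots> \<le> c * (e / (c + 1))" using d(2)[OF s] c by (intro mult_left_mono) auto
      also have "\<dots> < e" using c e by (simp add: field_simps)
      finally show "fz_dist (psmul c f s) (psmul c f t) < e" .
    qed fact
  qed (use f c C_car_fuzzy C_car_outside in \<open>auto simp: psmul_def\<close>)
next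
  fix x :: "nat \<Rightarrow> real \<Rightarrow> fz" and B
  assume x: "\<And>k. x k \<in> C_car a b" and B: "\<And>k t. fz_dist (x k t) fz_zero \<le> B k" "summable B"
  note fz = C_car_fuzzy[OF x]
  show "(\<lambda>t. fz_sum (\<lambda>k. x k t)) \<in> C_car a b"
  proof (rule C_carI)
    show "fuzzy_number (fz_sum (\<lambda>k. x k t))" for t
      by (rule fz_summable.fuzzy_number_sum) (rule fz_summableI[OF fz B])
    show "fz_sum (\<lambda>k. x k t) = fz_zero" if "t \<notin> {a..b}" for t
      using C_car_outside[OF x that] by simp
    fix t e :: real assume t: "t \<in> {a..b}" and e: "0 < e"
    obtain N d where d: "0 < d" and
      small: "\<And>u v. (\<And>k. fuzzy_number (u k)) \<Longrightarrow> (\<And>k. fuzzy_number (v k)) \<Longrightarrow>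
         (\<And>k. fz_dist (u k) fz_zero \<le> B k) \<Longrightarrow> (\<And>k. fz_dist (v k) fz_zero \<le> B k) \<Longrightarrow>
         (\<And>k. k < N \<Longrightarrow> fz_dist (u k) (v k) < d) \<Longrightarrow> fz_dist (fz_sum u) (fz_sum v) < e"
      using fz_dist_sum_small[OF B(2) e] by metis
    have "\<exists>c>0. \<forall>k<N. \<forall>s. \<bar>s - t\<bar> < c \<longrightarrow> s \<in> {a..b} \<longrightarrow> fz_dist (x k s) (x k t) < d"
      by (rule finitely_many_small) (use C_car_cont[OF x t d] in blast)
    then obtain c where c: "0 < c"
      "\<And>k s. k < N \<Longrightarrow> \<bar>s - t\<bar> < c \<Longrightarrow> s \<in> {a..b} \<Longrightarrow> fz_dist (x k s) (x k t) < d" by blast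
    show "\<exists>d>0. \<forall>s\<in>{a..b}. \<bar>s - t\<bar> < d \<longrightarrow> fz_dist (fz_sum (\<lambda>k. x k s)) (fz_sum (\<lambda>k. x k t)) < e"
      by (intro exI[of _ c] conjI ballI impI small fz B(1) c)
  qed
qed

lemma Dstar_eq: "Dstar a b = sup_dist {a..b}"
  by (intro ext) (simp add: Dstar_def sup_dist_def)

lemma fspace_cone_C: "a < b \<Longrightarrow> fspace_cone (C_space a b)"
  unfolding C_space_def Dstar_eq by (intro fspace_cone_fun_space sup_cone.fuzzy_cone sup_cone_C)

text \<open>Treating \<open>t\<close> as an endpoint of a short interval merges the two one-sided conditions
  in the definition of the Hukuhara derivative.\<close>

lemma has_hderiv_iff:
  assumes t: "t \<in> {a..b}"
  shows "has_hderiv a b f w t \<longleftrightarrow> fuzzy_number w \<and>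
    (\<forall>e>0. \<exists>d>0. \<forall>u v. u \<in> {a..b} \<and> v \<in> {a..b} \<and> u < v \<and> v - u < d \<and> (u = t \<or> v = t) \<longrightarrow>
       (\<exists>z. fuzzy_number z \<and> f v = fz_add (f u) z \<and> fz_dist (fz_smul (1 / (v - u)) z) w < e))"
  (is "?L \<longleftrightarrow> _ \<and> ?R")
proof
  assume L: ?L
  have ?R
  proof (intro allI impI)
    fix e :: real assume "0 < e"
    then obtain d where "d > 0" and d: "\<And>h. 0 < h \<Longrightarrow> h < d \<Longrightarrow>
        (t + h \<in> {a..b} \<longrightarrow> (\<exists>z. fuzzy_number z \<and> f (t + h) = fz_add (f t) z \<and> fz_dist (fz_smul (1 / h) z) w < e)) \<and>
        (t - h \<in> {a..b} \<longrightarrow> (\<exists>z. fuzzy_number z \<and> f t = fz_add (f (t - h)) z \<and> fz_dist (fz_smul (1 / h) z) w < e))"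
      using L unfolding has_hderiv_def by blast
    show "\<exists>d>0. \<forall>u v. u \<in> {a..b} \<and> v \<in> {a..b} \<and> u < v \<and> v - u < d \<and> (u = t \<or> v = t) \<longrightarrow>
       (\<exists>z. fuzzy_number z \<and> f v = fz_add (f u) z \<and> fz_dist (fz_smul (1 / (v - u)) z) w < e)"
    proof (intro exI[of _ d] conjI allI impI)
      fix u v assume uv: "u \<in> {a..b} \<and> v \<in> {a..b} \<and> u < v \<and> v - u < d \<and> (u = t \<or> v = t)"
      then consider "u = t" | "v = t" by blast
      then show "\<exists>z. fuzzy_number z \<and> f v = fz_add (f u) z \<and> fz_dist (fz_smul (1 / (v - u)) z) w < e"
        using d[of "v - u"] uv by cases auto
    qed fact
  qed
  with L show "fuzzy_number w \<and> ?R" unfolding has_hderiv_def by blast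
next
  assume R: "fuzzy_number w \<and> ?R"
  show ?L unfolding has_hderiv_def
  proof (intro conjI allI impI)
    fix e :: real assume "0 < e"
    then obtain d where "d > 0" and d: "\<And>u v. u \<in> {a..b} \<Longrightarrow> v \<in> {a..b} \<Longrightarrow> u < v \<Longrightarrow> v - u < d \<Longrightarrow> u = t \<or> v = t \<Longrightarrow>
       (\<exists>z. fuzzy_number z \<and> f v = fz_add (f u) z \<and> fz_dist (fz_smul (1 / (v - u)) z) w < e)"
      using R by metis
    show "\<exists>d>0. \<forall>h. 0 < h \<and> h < d \<longrightarrow>
        (t + h \<in> {a..b} \<longrightarrow> (\<exists>z. fuzzy_number z \<and> f (t + h) = fz_add (f t) z \<and> fz_dist (fz_smul (1 / h) z) w < e)) \<and>
        (t - h \<in> {a..b} \<longrightarrow> (\<exists>z. fuzzy_number z \<and> f t = fz_add (f (t - h)) z \<and> fz_dist (fz_smul (1 / h) z) w < e))"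
      using d[OF t, of "t + _"] d[OF _ t, of "t - _"] \<open>d > 0\<close> by (intro exI[of _ d]) simp
  qed (use R in blast)
qed

section \<open>Calculus of the Hukuhara derivative\<close>

lemma has_hderivD:
  assumes "has_hderiv a b f w t" "t \<in> {a..b}" "0 < e"
  obtains d where "0 < d" "\<And>u v. u \<in> {a..b} \<Longrightarrow> v \<in> {a..b} \<Longrightarrow> u < v \<Longrightarrow> v - u < d \<Longrightarrow> u = t \<or> v = t \<Longrightarrow>
     \<exists>z. fuzzy_number z \<and> f v = fz_add (f u) z \<and> fz_dist (fz_smul (1 / (v - u)) z) w < e"
  using assms has_hderiv_iff[OF assms(2), of f w] by (auto; meson)

lemma has_hderivI:
  assumes "t \<in> {a..b}" "fuzzy_number w"
    and "\<And>e. 0 < e \<Longrightarrow> \<exists>d>0. \<forall>u v. u \<in> {a..b} \<longrightarrow> v \<in> {a..b} \<longrightarrow> u < v \<longrightarrow> v - u < d \<longrightarrow> u = t \<or> v = t \<longrightarrow>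
     (\<exists>z. fuzzy_number z \<and> f v = fz_add (f u) z \<and> fz_dist (fz_smul (1 / (v - u)) z) w < e)"
  shows "has_hderiv a b f w t"
  unfolding has_hderiv_iff[OF assms(1)]
proof (intro conjI allI impI)
  fix e :: real assume "0 < e"
  then obtain d where "d > 0" "\<forall>u v. u \<in> {a..b} \<longrightarrow> v \<in> {a..b} \<longrightarrow> u < v \<longrightarrow> v - u < d \<longrightarrow> u = t \<or> v = t \<longrightarrow>
     (\<exists>z. fuzzy_number z \<and> f v = fz_add (f u) z \<and> fz_dist (fz_smul (1 / (v - u)) z) w < e)"
    using assms(3) by blast
  then show "\<exists>d>0. \<forall>u v. u \<in> {a..b} \<and> v \<in> {a..b} \<and> u < v \<and> v - u < d \<and> (u = t \<or> v = t) \<longrightarrow>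
     (\<exists>z. fuzzy_number z \<and> f v = fz_add (f u) z \<and> fz_dist (fz_smul (1 / (v - u)) z) w < e)"
    by (intro exI[of _ d]) blast
qed fact

lemma has_hderiv_fuzzy: "has_hderiv a b f w t \<Longrightarrow> fuzzy_number w"
  by (simp add: has_hderiv_def)

text \<open>Guarantees that the derivative condition at \<open>t\<close> is not vacuous: the
  interval extends to the right of \<open>t\<close>, or to the left if \<open>t = b\<close>.\<close>

lemma short_interval:
  fixes a b :: real
  assumes "a < b" "t \<in> {a..b}" "0 < d"
  obtains u v where "u \<in> {a..b}" "v \<in> {a..b}" "u < v" "v - u < d" "u = t \<or> v = t"
proof (cases "t < b")
  case True
  define h where "h = min d (b - t) / 2"
  have "0 < h" "h < d" "h \<le> b - t" using True assms by (auto simp: h_def)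
  then show ?thesis using assms by (intro that[of t "t + h"]) auto
next
  case False
  define h where "h = min d (t - a) / 2"
  have "0 < h" "h < d" "h \<le> t - a" using False assms by (auto simp: h_def)
  then show ?thesis using assms by (intro that[of "t - h" t]) auto
qed

text \<open>By cancellation the Hukuhara difference over a short interval is unique, so one and the
  same quotient lies within e/2 of both candidates. Uniqueness is what makes the choice in
  \<open>hderiv\<close> computable.\<close>

lemma has_hderiv_unique:
  assumes ab: "a < b" and t: "t \<in> {a..b}" and f: "\<And>t. fuzzy_number (f t)"
    and w: "has_hderiv a b f w t" and w': "has_hderiv a b f w' t"
  shows "w = w'"
proof -
  note fw = has_hderiv_fuzzy[OF w] has_hderiv_fuzzy[OF w']
  have "fz_dist w w' \<le> 0 + e" if "0 < e" for e
  proof -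
    have e: "0 < e / 2" using that by simp
    obtain d1 where d1: "0 < d1" "\<And>u v. u \<in> {a..b} \<Longrightarrow> v \<in> {a..b} \<Longrightarrow> u < v \<Longrightarrow> v - u < d1 \<Longrightarrow> u = t \<or> v = t \<Longrightarrow>
      \<exists>z. fuzzy_number z \<and> f v = fz_add (f u) z \<and> fz_dist (fz_smul (1 / (v - u)) z) w < e / 2"
      using has_hderivD[OF w t e] by blast
    obtain d2 where d2: "0 < d2" "\<And>u v. u \<in> {a..b} \<Longrightarrow> v \<in> {a..b} \<Longrightarrow> u < v \<Longrightarrow> v - u < d2 \<Longrightarrow> u = t \<or> v = t \<Longrightarrow>
      \<exists>z. fuzzy_number z \<and> f v = fz_add (f u) z \<and> fz_dist (fz_smul (1 / (v - u)) z) w' < e / 2"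
      using has_hderivD[OF w' t e] by blast
    obtain u v where uv: "u \<in> {a..b}" "v \<in> {a..b}" "u < v" "v - u < min d1 d2" "u = t \<or> v = t"
      using short_interval[OF ab t, of "min d1 d2"] d1(1) d2(1) by auto
    obtain z where z: "fuzzy_number z" "f v = fz_add (f u) z" "fz_dist (fz_smul (1 / (v - u)) z) w < e / 2"
      using d1(2)[OF uv(1-3) _ uv(5)] uv(4) by auto
    obtain z' where z': "fuzzy_number z'" "f v = fz_add (f u) z'" "fz_dist (fz_smul (1 / (v - u)) z') w' < e / 2"
      using d2(2)[OF uv(1-3) _ uv(5)] uv(4) by auto
    have "z' = z" using fz_add_left_cancel[OF f z'(1) z(1)] z z' by metis
    then have "fz_dist w w' \<le> fz_dist (fz_smul (1 / (v - u)) z) w + fz_dist (fz_smul (1 / (v - u)) z') w'"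
      using fz_dist_triangle[OF fw(1) _ fw(2), of "fz_smul (1 / (v - u)) z"] z(1) uv(3)
      by (simp add: fz_dist_commute)
    then show ?thesis using z z' by simp
  qed
  then have "fz_dist w w' \<le> 0" by (rule field_le_epsilon)
  then show ?thesis using fz_dist_eq_0[OF fw] fz_dist_nonneg[OF fw] by simp
qed

lemma hderiv_eq:
  assumes "a < b" "t \<in> {a..b}" "\<And>t. fuzzy_number (f t)" "has_hderiv a b f w t"
  shows "hderiv a b f t = w"
proof -
  have "has_hderiv a b f (SOME w. has_hderiv a b f w t) t" using assms(4) by (rule someI[of "\<lambda>w. has_hderiv a b f w t"])
  then show ?thesis using has_hderiv_unique[OF assms(1-3) _ assms(4)] assms(2) by (simp add: hderiv_def)
qed

lemma fz_add_add_swap: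
  assumes "fuzzy_number u" "fuzzy_number v" "fuzzy_number u'" "fuzzy_number v'"
  shows "fz_add (fz_add u v) (fz_add u' v') = fz_add (fz_add u u') (fz_add v v')"
  using assms by (intro fuzzy_number_ext) (auto simp: lower_add upper_add)

lemma has_hderiv_zero: "t \<in> {a..b} \<Longrightarrow> has_hderiv a b pzero fz_zero t"
  by (rule has_hderivI) (auto intro!: exI[of _ 1] exI[of _ fz_zero])

lemma has_hderiv_add:
  assumes t: "t \<in> {a..b}" and f: "\<And>t. fuzzy_number (f t)" and g: "\<And>t. fuzzy_number (g t)"
    and w: "has_hderiv a b f w t" and w': "has_hderiv a b g w' t"
  shows "has_hderiv a b (padd f g) (fz_add w w') t"
proof (rule has_hderivI[OF t])
  note fw = has_hderiv_fuzzy[OF w] has_hderiv_fuzzy[OF w']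
  show "fuzzy_number (fz_add w w')" using fw by simp
  fix e :: real assume "0 < e"
  then have e: "0 < e / 2" by simp
  obtain d1 where d1: "0 < d1" "\<And>u v. u \<in> {a..b} \<Longrightarrow> v \<in> {a..b} \<Longrightarrow> u < v \<Longrightarrow> v - u < d1 \<Longrightarrow> u = t \<or> v = t \<Longrightarrow>
    \<exists>z. fuzzy_number z \<and> f v = fz_add (f u) z \<and> fz_dist (fz_smul (1 / (v - u)) z) w < e / 2"
    using has_hderivD[OF w t e] by blast
  obtain d2 where d2: "0 < d2" "\<And>u v. u \<in> {a..b} \<Longrightarrow> v \<in> {a..b} \<Longrightarrow> u < v \<Longrightarrow> v - u < d2 \<Longrightarrow> u = t \<or> v = t \<Longrightarrow>
    \<exists>z. fuzzy_number z \<and> g v = fz_add (g u) z \<and> fz_dist (fz_smul (1 / (v - u)) z) w' < e / 2"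
    using has_hderivD[OF w' t e] by blast
  show "\<exists>d>0. \<forall>u v. u \<in> {a..b} \<longrightarrow> v \<in> {a..b} \<longrightarrow> u < v \<longrightarrow> v - u < d \<longrightarrow> u = t \<or> v = t \<longrightarrow>
     (\<exists>z. fuzzy_number z \<and> padd f g v = fz_add (padd f g u) z \<and> fz_dist (fz_smul (1 / (v - u)) z) (fz_add w w') < e)"
  proof (intro exI[of _ "min d1 d2"] conjI allI impI)
    fix u v assume uv: "u \<in> {a..b}" "v \<in> {a..b}" "u < v" "v - u < min d1 d2" "u = t \<or> v = t"
    obtain z where z: "fuzzy_number z" "f v = fz_add (f u) z" "fz_dist (fz_smul (1 / (v - u)) z) w < e / 2"
      using d1(2)[OF uv(1-3) _ uv(5)] uv(4) by auto
    obtain z' where z': "fuzzy_number z'" "g v = fz_add (g u) z'" "fz_dist (fz_smul (1 / (v - u)) z') w' < e / 2"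
      using d2(2)[OF uv(1-3) _ uv(5)] uv(4) by auto
    have "fz_dist (fz_smul (1 / (v - u)) (fz_add z z')) (fz_add w w')
        \<le> fz_dist (fz_smul (1 / (v - u)) z) w + fz_dist (fz_smul (1 / (v - u)) z') w'"
      using z z' fw uv(3) by (simp add: fz_smul_add fz_dist_add)
    then show "\<exists>z. fuzzy_number z \<and> padd f g v = fz_add (padd f g u) z \<and> fz_dist (fz_smul (1 / (v - u)) z) (fz_add w w') < e"
      using z z' f g by (intro exI[of _ "fz_add z z'"]) (auto simp: padd_def fz_add_add_swap)
  qed (use d1 d2 in simp)
qed

lemma has_hderiv_smul:
  assumes t: "t \<in> {a..b}" and f: "\<And>t. fuzzy_number (f t)" and w: "has_hderiv a b f w t" and c: "0 \<le> c"
  shows "has_hderiv a b (psmul c f) (fz_smul c w) t"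
proof (rule has_hderivI[OF t])
  note fw = has_hderiv_fuzzy[OF w]
  show "fuzzy_number (fz_smul c w)" using fw c by simp
  fix e :: real assume e: "0 < e"
  then have "0 < e / (c + 1)" using c by simp
  then obtain d where d: "0 < d" "\<And>u v. u \<in> {a..b} \<Longrightarrow> v \<in> {a..b} \<Longrightarrow> u < v \<Longrightarrow> v - u < d \<Longrightarrow> u = t \<or> v = t \<Longrightarrow>
    \<exists>z. fuzzy_number z \<and> f v = fz_add (f u) z \<and> fz_dist (fz_smul (1 / (v - u)) z) w < e / (c + 1)"
    using has_hderivD[OF w t] by blast
  show "\<exists>d>0. \<forall>u v. u \<in> {a..b} \<longrightarrow> v \<in> {a..b} \<longrightarrow> u < v \<longrightarrow> v - u < d \<longrightarrow> u = t \<or> v = t \<longrightarrow>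
     (\<exists>z. fuzzy_number z \<and> psmul c f v = fz_add (psmul c f u) z \<and> fz_dist (fz_smul (1 / (v - u)) z) (fz_smul c w) < e)"
  proof (intro exI[of _ d] conjI allI impI)
    fix u v assume uv: "u \<in> {a..b}" "v \<in> {a..b}" "u < v" "v - u < d" "u = t \<or> v = t"
    obtain z where z: "fuzzy_number z" "f v = fz_add (f u) z" "fz_dist (fz_smul (1 / (v - u)) z) w < e / (c + 1)"
      using d(2)[OF uv] by blast
    have "fz_smul (1 / (v - u)) (fz_smul c z) = fz_smul c (fz_smul (1 / (v - u)) z)"
      using z(1) c uv(3) by (simp add: fz_smul_smul)
    then have "fz_dist (fz_smul (1 / (v - u)) (fz_smul c z)) (fz_smul c w) = c * fz_dist (fz_smul (1 / (v - u)) z) w"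
      using z(1) c fw uv(3) by (simp add: fz_dist_smul)
    also have "\<dots> \<le> c * (e / (c + 1))" using z(3) c by (intro mult_left_mono) auto
    also have "\<dots> < e" using c e by (simp add: field_simps)
    finally show "\<exists>z. fuzzy_number z \<and> psmul c f v = fz_add (psmul c f u) z \<and> fz_dist (fz_smul (1 / (v - u)) z) (fz_smul c w) < e"
      using z(1,2) f c by (intro exI[of _ "fz_smul c z"]) (auto simp: psmul_def fz_smul_add)
  qed fact
qed

text \<open>The Hukuhara difference of a differentiable function exists on every subinterval; this
  is needed because the radius in \<open>has_hderiv\<close> need not be uniform along a series.\<close>

lemma hukuhara_mean_value:
  assumes f: "\<And>t. fuzzy_number (f t)" and w: "\<And>t. t \<in> {a..b} \<Longrightarrow> has_hderiv a b f (w t) t"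
    and B: "\<And>t. t \<in> {a..b} \<Longrightarrow> fz_dist (w t) fz_zero \<le> B" and BM: "B < M"
    and uv: "u \<in> {a..b}" "v \<in> {a..b}" "u \<le> v"
  shows "\<exists>z. fuzzy_number z \<and> f v = fz_add (f u) z \<and> fz_dist z fz_zero \<le> M * (v - u)"
proof -
  \<comment> \<open>\<open>Q\<close> adds up over adjacent intervals, so it only has to be
    established locally.\<close>
  define Q where "Q u v \<longleftrightarrow> (\<exists>z. fuzzy_number z \<and> f v = fz_add (f u) z \<and> fz_dist z fz_zero \<le> M * (v - u))" for u v
  have refl: "Q u u" for u
    unfolding Q_def using f by (intro exI[of _ fz_zero]) simp
  have trans: "Q r t" if "Q r s" "Q s t" for r s t
  proof -
    obtain z z' where z: "fuzzy_number z" "f s = fz_add (f r) z" "fz_dist z fz_zero \<le> M * (s - r)"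
      "fuzzy_number z'" "f t = fz_add (f s) z'" "fz_dist z' fz_zero \<le> M * (t - s)"
      using \<open>Q r s\<close> \<open>Q s t\<close> unfolding Q_def by blast
    then have "f t = fz_add (f r) (fz_add z z')" using f by (simp add: fz_add_assoc)
    moreover have "fz_dist (fz_add z z') fz_zero \<le> M * (t - r)"
      using fz_norm_add[OF z(1,4)] z(3,6) by (simp add: algebra_simps)
    ultimately show ?thesis unfolding Q_def using z(1,4) fuzzy_number_add by blast
  qed
  have loc: "\<exists>d>0. \<forall>u v. u \<in> {a..b} \<longrightarrow> v \<in> {a..b} \<longrightarrow> u < v \<longrightarrow> v - u < d \<longrightarrow> u = x \<or> v = x \<longrightarrow> Q u v"
    if x: "x \<in> {a..b}" for x
  proof -
    \<comment> \<open>The slack between \<open>B\<close> and \<open>M\<close> is spent as tolerance: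
      a quotient within \<open>M - B\<close> of \<open>w x\<close> has norm at most
      \<open>M\<close>.\<close>
    have "0 < M - B" using BM by simp
    then obtain d where d: "0 < d" "\<And>u v. u \<in> {a..b} \<Longrightarrow> v \<in> {a..b} \<Longrightarrow> u < v \<Longrightarrow> v - u < d \<Longrightarrow> u = x \<or> v = x \<Longrightarrow>
      \<exists>z. fuzzy_number z \<and> f v = fz_add (f u) z \<and> fz_dist (fz_smul (1 / (v - u)) z) (w x) < M - B"
      using has_hderivD[OF w[OF x] x] by blast
    have "Q u v" if uv: "u \<in> {a..b}" "v \<in> {a..b}" "u < v" "v - u < d" "u = x \<or> v = x" for u v
    proof -
      obtain z where z: "fuzzy_number z" "f v = fz_add (f u) z" "fz_dist (fz_smul (1 / (v - u)) z) (w x) < M - B"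
        using d(2)[OF uv] by blast
      have "fz_dist (fz_smul (1 / (v - u)) z) fz_zero \<le> M"
        using fz_dist_triangle[of "fz_smul (1 / (v - u)) z" "w x" fz_zero] z B[OF x] uv(3)
          has_hderiv_fuzzy[OF w[OF x]] by simp
      then have "fz_dist z fz_zero \<le> M * (v - u)"
        using uv(3) z(1) by (simp add: fz_norm_smul field_simps)
      then show ?thesis unfolding Q_def using z by blast
    qed
    then show ?thesis using d(1) by blast
  qed
  \<comment> \<open>Bisection: an additive property that holds on all short intervals around each
    point holds on the whole interval. An interval around \<open>x\<close> is split at
    \<open>x\<close>, since the derivative at \<open>x\<close> speaks only of intervals with
    endpoint \<open>x\<close>.\<close>
  have "u \<le> u \<and> v \<le> v \<longrightarrow> Q u v"
  proof (rule Bolzano[where P = "\<lambda>p r. u \<le> p \<and> r \<le> v \<longrightarrow> Q p r", OF uv(3)])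
    fix p q r assume "u \<le> p \<and> q \<le> v \<longrightarrow> Q p q" "u \<le> q \<and> r \<le> v \<longrightarrow> Q q r" "p \<le> q" "q \<le> r"
    then show "u \<le> p \<and> r \<le> v \<longrightarrow> Q p r" using trans by (meson order_trans)
  next
    fix x assume "u \<le> x" "x \<le> v"
    then have "x \<in> {a..b}" using uv by auto
    then obtain d where d: "d > 0" "\<And>u v. u \<in> {a..b} \<Longrightarrow> v \<in> {a..b} \<Longrightarrow> u < v \<Longrightarrow> v - u < d \<Longrightarrow> u = x \<or> v = x \<Longrightarrow> Q u v"
      using loc by blast
    show "\<exists>d>0. \<forall>p r. p \<le> x \<and> x \<le> r \<and> r - p < d \<longrightarrow> u \<le> p \<and> r \<le> v \<longrightarrow> Q p r"
    proof (intro exI[of _ d] conjI allI impI)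
      fix p r assume pr: "p \<le> x \<and> x \<le> r \<and> r - p < d" "u \<le> p \<and> r \<le> v"
      have "Q p x" using d(2)[of p x] refl[of x] pr uv by (cases "p = x") auto
      moreover have "Q x r" using d(2)[of x r] refl[of x] pr uv by (cases "r = x") auto
      ultimately show "Q p r" by (rule trans)
    qed fact
  qed
  then show ?thesis unfolding Q_def by simp
qed

text \<open>Term-by-term differentiation. The mean value estimate bounds the difference quotients of
  every term by the summable \<open>M k\<close>, whatever the interval; then
  \<open>fz_dist_sum_small\<close>, applied to quotients against derivatives, needs closeness only
  for the first \<open>N\<close> terms.\<close>

lemma has_hderiv_sum:
  assumes t: "t \<in> {a..b}" and f: "\<And>k t. fuzzy_number (f k t)"
    and w: "\<And>k t. t \<in> {a..b} \<Longrightarrow> has_hderiv a b (f k) (w k t) t"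
    and Bf: "\<And>k t. fz_dist (f k t) fz_zero \<le> A k" "summable A"
    and Bw: "\<And>k t. t \<in> {a..b} \<Longrightarrow> fz_dist (w k t) fz_zero \<le> B k" "summable B"
  shows "has_hderiv a b (\<lambda>t. fz_sum (\<lambda>k. f k t)) (fz_sum (\<lambda>k. w k t)) t"
proof (rule has_hderivI[OF t])
  note fw = has_hderiv_fuzzy[OF w]
  \<comment> \<open>The geometric summand makes \<open>M k\<close> strictly larger than
    \<open>B k\<close>, as the mean value estimate demands, and keeps it summable.\<close>
  define M where "M k = B k + (1/2) ^ k" for k
  have M: "summable M" "\<And>k. B k < M k"
    unfolding M_def using Bw(2) by (auto intro: summable_add summable_geometric)
  show "fuzzy_number (fz_sum (\<lambda>k. w k t))"
    by (rule fz_summable.fuzzy_number_sum) (rule fz_summableI[OF fw[OF t] Bw(1)[OF t] Bw(2)])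
  fix e :: real assume e: "0 < e"
  obtain N c where c: "0 < c" and
    small: "\<And>u v. (\<And>k. fuzzy_number (u k)) \<Longrightarrow> (\<And>k. fuzzy_number (v k)) \<Longrightarrow>
       (\<And>k. fz_dist (u k) fz_zero \<le> M k) \<Longrightarrow> (\<And>k. fz_dist (v k) fz_zero \<le> M k) \<Longrightarrow>
       (\<And>k. k < N \<Longrightarrow> fz_dist (u k) (v k) < c) \<Longrightarrow> fz_dist (fz_sum u) (fz_sum v) < e"
    using fz_dist_sum_small[OF M(1) e] by metis
  \<comment> \<open>Intervals are coded as pairs to fit the single argument in
    \<open>finitely_many_small\<close>.\<close>
  have "\<exists>d>0. \<forall>k<N. \<forall>p. snd p - fst p < d \<longrightarrow> fst p \<in> {a..b} \<longrightarrow> snd p \<in> {a..b} \<longrightarrow> fst p < snd p \<longrightarrow> fst p = t \<or> snd p = t \<longrightarrow>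
     (\<exists>z. fuzzy_number z \<and> f k (snd p) = fz_add (f k (fst p)) z \<and> fz_dist (fz_smul (1 / (snd p - fst p)) z) (w k t) < c)"
  proof (rule finitely_many_small)
    fix k
    obtain d where "0 < d" "\<And>u v. u \<in> {a..b} \<Longrightarrow> v \<in> {a..b} \<Longrightarrow> u < v \<Longrightarrow> v - u < d \<Longrightarrow> u = t \<or> v = t \<Longrightarrow>
      \<exists>z. fuzzy_number z \<and> f k v = fz_add (f k u) z \<and> fz_dist (fz_smul (1 / (v - u)) z) (w k t) < c"
      using has_hderivD[OF w[OF t] t c] by blast
    then show "\<exists>d>0. \<forall>p. snd p - fst p < d \<longrightarrow> fst p \<in> {a..b} \<longrightarrow> snd p \<in> {a..b} \<longrightarrow> fst p < snd p \<longrightarrow> fst p = t \<or> snd p = t \<longrightarrow>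
     (\<exists>z. fuzzy_number z \<and> f k (snd p) = fz_add (f k (fst p)) z \<and> fz_dist (fz_smul (1 / (snd p - fst p)) z) (w k t) < c)"
      by blast
  qed
  then obtain d where d: "0 < d" "\<And>k u v. k < N \<Longrightarrow> v - u < d \<Longrightarrow> u \<in> {a..b} \<Longrightarrow> v \<in> {a..b} \<Longrightarrow> u < v \<Longrightarrow> u = t \<or> v = t \<Longrightarrow>
     \<exists>z. fuzzy_number z \<and> f k v = fz_add (f k u) z \<and> fz_dist (fz_smul (1 / (v - u)) z) (w k t) < c"
    by (metis fst_conv snd_conv)
  show "\<exists>d>0. \<forall>u v. u \<in> {a..b} \<longrightarrow> v \<in> {a..b} \<longrightarrow> u < v \<longrightarrow> v - u < d \<longrightarrow> u = t \<or> v = t \<longrightarrow>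
     (\<exists>z. fuzzy_number z \<and> fz_sum (\<lambda>k. f k v) = fz_add (fz_sum (\<lambda>k. f k u)) z \<and>
        fz_dist (fz_smul (1 / (v - u)) z) (fz_sum (\<lambda>k. w k t)) < e)"
  proof (intro exI[of _ d] conjI allI impI)
    fix u v assume uv: "u \<in> {a..b}" "v \<in> {a..b}" "u < v" "v - u < d" "u = t \<or> v = t"
    have "\<exists>z. \<forall>k. fuzzy_number (z k) \<and> f k v = fz_add (f k u) (z k) \<and> fz_dist (z k) fz_zero \<le> M k * (v - u)"
      using hukuhara_mean_value[OF f w Bw(1) M(2) uv(1,2)] uv(3) by (intro choice) auto
    then obtain z where z: "\<And>k. fuzzy_number (z k)" "\<And>k. f k v = fz_add (f k u) (z k)"
      "\<And>k. fz_dist (z k) fz_zero \<le> M k * (v - u)" by blast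
    define h where "h = 1 / (v - u)"
    have h: "0 < h" "h * (v - u) = 1" using uv(3) by (auto simp: h_def)
    have sz: "fz_summable z"
      using M(1) by (intro fz_summableI[OF z(1,3)] summable_mult2)
    have "fz_sum (\<lambda>k. f k v) = fz_add (fz_sum (\<lambda>k. f k u)) (fz_sum z)"
      using fz_sum_add[OF fz_summableI[of "\<lambda>k. f k u", OF f Bf] sz] z(2) by simp
    moreover have "fz_smul h (fz_sum z) = fz_sum (\<lambda>k. fz_smul h (z k))"
      using fz_sum_smul[OF sz, of h] h by simp
    moreover have "fz_dist (fz_sum (\<lambda>k. fz_smul h (z k))) (fz_sum (\<lambda>k. w k t)) < e"
    proof (rule small)
      show "fuzzy_number (fz_smul h (z k))" "fuzzy_number (w k t)" for k using z h fw t by auto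
      show "fz_dist (w k t) fz_zero \<le> M k" for k using Bw(1)[OF t, of k] M(2)[of k] by linarith
      show "fz_dist (fz_smul h (z k)) fz_zero \<le> M k" for k
      proof -
        have "fz_dist (fz_smul h (z k)) fz_zero \<le> h * (M k * (v - u))"
          using z(1,3) h by (simp add: fz_norm_smul)
        also have "\<dots> = M k" using h(2) by (metis mult.left_commute mult.right_neutral)
        finally show ?thesis .
      qed
      show "fz_dist (fz_smul h (z k)) (w k t) < c" if k: "k < N" for k
      proof -
        obtain z' where z': "fuzzy_number z'" "f k v = fz_add (f k u) z'" "fz_dist (fz_smul (1 / (v - u)) z') (w k t) < c"
          using d(2)[OF k uv(4,1,2,3,5)] by blast
        \<comment> \<open>Two differences over the same interval arise, one from the mean value
          estimate and one from the derivative; cancellation identifies them.\<close>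
        have "z' = z k" using fz_add_left_cancel[OF f z'(1) z(1)] z'(2) z(2) by metis
        then show ?thesis using z'(3) by (simp add: h_def)
      qed
    qed
    ultimately show "\<exists>z. fuzzy_number z \<and> fz_sum (\<lambda>k. f k v) = fz_add (fz_sum (\<lambda>k. f k u)) z \<and>
        fz_dist (fz_smul (1 / (v - u)) z) (fz_sum (\<lambda>k. w k t)) < e"
      using fz_summable.fuzzy_number_sum[OF sz] by (intro exI[of _ "fz_sum z"]) (simp add: h_def)
  qed fact
qed

section \<open>The spaces of p times differentiable functions\<close>

lemma Cp_car_C: "f \<in> Cp_car a b p \<Longrightarrow> i \<le> p \<Longrightarrow> (hderiv a b ^^ i) f \<in> C_car a b"
  by (simp add: Cp_car_def)

lemma Cp_car_hderiv:
  assumes f: "f \<in> Cp_car a b p" and i: "i < p" and t: "t \<in> {a..b}"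
  shows "has_hderiv a b ((hderiv a b ^^ i) f) ((hderiv a b ^^ Suc i) f t) t"
proof -
  have "\<exists>w. has_hderiv a b ((hderiv a b ^^ i) f) w t" using assms by (simp add: Cp_car_def)
  from someI_ex[OF this] show ?thesis using t by (simp add: hderiv_def)
qed

text \<open>Membership is shown by exhibiting the whole chain \<open>F\<close> of derivatives.
  Uniqueness identifies each iterate of \<open>hderiv\<close> with the chain on [a,b]; outside, both
  are zero by convention.\<close>

lemma Cp_carI:
  assumes ab: "a < b" and F: "\<And>i. i \<le> p \<Longrightarrow> F i \<in> C_car a b"
    and der: "\<And>i t. i < p \<Longrightarrow> t \<in> {a..b} \<Longrightarrow> has_hderiv a b (F i) (F (Suc i) t) t"
  shows "F 0 \<in> Cp_car a b p" "i \<le> p \<Longrightarrow> (hderiv a b ^^ i) (F 0) = F i"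
proof -
  have eq: "(hderiv a b ^^ i) (F 0) = F i" if "i \<le> p" for i
    using that
  proof (induction i)
    case (Suc i)
    then have i: "i < p" and IH: "(hderiv a b ^^ i) (F 0) = F i" by auto
    have "hderiv a b (F i) = F (Suc i)"
    proof
      fix t
      show "hderiv a b (F i) t = F (Suc i) t"
      proof (cases "t \<in> {a..b}")
        case True
        then show ?thesis using hderiv_eq[OF ab True C_car_fuzzy[OF F] der[OF i True]] i by simp
      next
        case False
        then have "hderiv a b (F i) t = fz_zero" unfolding hderiv_def by (rule if_not_P)
        then show ?thesis using C_car_outside[OF F[of "Suc i"] False] i by simp
      qed
    qed
    then show ?case using IH by simp
  qed simp
  show "i \<le> p \<Longrightarrow> (hderiv a b ^^ i) (F 0) = F i" by (rule eq)
  show "F 0 \<in> Cp_car a b p"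
  proof -
    have "\<exists>w. has_hderiv a b ((hderiv a b ^^ i) (F 0)) w t" if "i < p" "t \<in> {a..b}" for i t
      using der[OF that] eq[of i] that(1) by auto
    then show ?thesis unfolding Cp_car_def using F eq by simp
  qed
qed

text \<open>The iterates of \<open>hderiv\<close> commute with sums, nonnegative multiples and
  rapidly convergent series, so \<open>Dpstar\<close> inherits every axiom from the supremum metric,
  order by order.\<close>

lemma fuzzy_cone_Cp:
  assumes ab: "a < b"
  shows "fuzzy_cone (Cp_car a b p) padd psmul (Dpstar a b p) pzero"
proof -
  interpret S: sup_cone "{a..b}" "C_car a b" using sup_cone_C[OF ab] .
  let ?K = "Cp_car a b p" and ?J = "\<lambda>i. hderiv a b ^^ i" and ?d = "sup_dist {a..b}"
  note fz = C_car_fuzzy[OF Cp_car_C]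
  have zero: "pzero \<in> ?K" "\<And>i. i \<le> p \<Longrightarrow> ?J i pzero = pzero"
    using Cp_carI[OF ab, of p "\<lambda>i. pzero"] S.zero has_hderiv_zero by auto
  have add: "padd f g \<in> ?K" "\<And>i. i \<le> p \<Longrightarrow> ?J i (padd f g) = padd (?J i f) (?J i g)"
    if f: "f \<in> ?K" and g: "g \<in> ?K" for f g
  proof -
    have 1: "\<And>i. i \<le> p \<Longrightarrow> padd (?J i f) (?J i g) \<in> C_car a b" using S.add f g Cp_car_C by blast
    have 2: "\<And>i t. i < p \<Longrightarrow> t \<in> {a..b} \<Longrightarrow> has_hderiv a b (padd (?J i f) (?J i g)) (padd (?J (Suc i) f) (?J (Suc i) g) t) t"
      using has_hderiv_add[OF _ fz[OF f] fz[OF g] Cp_car_hderiv[OF f] Cp_car_hderiv[OF g]] by (simp add: padd_def)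
    show "padd f g \<in> ?K" "\<And>i. i \<le> p \<Longrightarrow> ?J i (padd f g) = padd (?J i f) (?J i g)"
      using Cp_carI[OF ab, of p "\<lambda>i. padd (?J i f) (?J i g)", OF 1 2] by simp_all
  qed
  have smul: "psmul c f \<in> ?K" "\<And>i. i \<le> p \<Longrightarrow> ?J i (psmul c f) = psmul c (?J i f)"
    if f: "f \<in> ?K" and c: "0 \<le> c" for f c
  proof -
    have 1: "\<And>i. i \<le> p \<Longrightarrow> psmul c (?J i f) \<in> C_car a b" using S.smul f c Cp_car_C by blast
    have 2: "\<And>i t. i < p \<Longrightarrow> t \<in> {a..b} \<Longrightarrow> has_hderiv a b (psmul c (?J i f)) (psmul c (?J (Suc i) f) t) t"
      using has_hderiv_smul[OF _ fz[OF f] Cp_car_hderiv[OF f] c] by (simp add: psmul_def)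
    show "psmul c f \<in> ?K" "\<And>i. i \<le> p \<Longrightarrow> ?J i (psmul c f) = psmul c (?J i f)"
      using Cp_carI[OF ab, of p "\<lambda>i. psmul c (?J i f)", OF 1 2] by simp_all
  qed
  have D: "Dpstar a b p f g = (\<Sum>i\<le>p. ?d (?J i f) (?J i g))" for f g
    unfolding Dpstar_def Dstar_eq ..
  have D0: "Dpstar a b p f pzero = (\<Sum>i\<le>p. ?d (?J i f) pzero)" for f
    unfolding D using zero(2) by simp
  have self: "Dpstar a b p f f = 0" for f unfolding D by (simp add: S.sup_dist_self)
  have nonneg: "0 \<le> Dpstar a b p f g" if "f \<in> ?K" "g \<in> ?K" for f g
    unfolding D using that Cp_car_C by (intro sum_nonneg S.sup_dist_nonneg) auto
  show ?thesis
  proof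
    show "Dpstar a b p f g = Dpstar a b p g f" for f g
      unfolding D sup_dist_def by (simp add: fz_dist_commute)
    show "Dpstar a b p f h \<le> 2 * (Dpstar a b p f g + Dpstar a b p g h)"
      if fgh: "f \<in> ?K" "g \<in> ?K" "h \<in> ?K" for f g h
    proof -
      have "Dpstar a b p f h \<le> Dpstar a b p f g + Dpstar a b p g h"
        unfolding D sum.distrib[symmetric] using fgh Cp_car_C by (intro sum_mono S.sup_dist_triangle) auto
      then show ?thesis using nonneg[OF fgh(1,2)] nonneg[OF fgh(2,3)] by (simp add: algebra_simps)
    qed
    show "Dpstar a b p (padd h f) (padd h g) = Dpstar a b p f g"
      if "h \<in> ?K" "f \<in> ?K" "g \<in> ?K" for h f g
      unfolding D using that Cp_car_C by (intro sum.cong) (auto simp: add S.sup_dist_add)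
    show "Dpstar a b p (psmul c f) pzero = c * Dpstar a b p f pzero" if "f \<in> ?K" "0 \<le> c" for c f
      unfolding D0 sum_distrib_left using that Cp_car_C by (intro sum.cong) (auto simp: smul S.sup_dist_norm_smul)
  next
    fix x :: "nat \<Rightarrow> real \<Rightarrow> fz"
    assume x: "\<And>k. x k \<in> ?K" "\<And>k. Dpstar a b p (x k) pzero \<le> (1/512) ^ k"
    define t where "t n = (\<lambda>s. fz_sum (\<lambda>k. x (k + n) s))" for n
    define N where "N i k = ?d (?J i (x k)) pzero" for i k
    have N0: "0 \<le> N i k" if "i \<le> p" for i k
      unfolding N_def using Cp_car_C[OF x(1) that] S.zero by (rule S.sup_dist_nonneg)
    have Nq: "N i k \<le> (1/512) ^ k" if "i \<le> p" for i k
      using member_le_sum[of i "{..p}" "\<lambda>i. N i k"] that N0 x(2)[of k] unfolding D0 N_def by force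
    have NS: "summable (\<lambda>k. N i (k + n))" if "i \<le> p" for i n
      using that N0 Nq by (intro summable_comparison_test'[OF summable_scale[of n], of 0]) auto
    note xC = Cp_car_C[OF x(1)]
    have J: "t n \<in> ?K \<and> (\<forall>i\<le>p. ?J i (t n) = (\<lambda>s. fz_sum (\<lambda>k. ?J i (x (k + n)) s)))" for n
    proof -
      have 1: "(\<lambda>s. fz_sum (\<lambda>k. ?J i (x (k + n)) s)) \<in> C_car a b" if "i \<le> p" for i
        by (rule S.fz_summable_pointwise(2)[OF xC[OF that] _ NS[OF that, of n]]) (simp add: N_def)
      have bd: "fz_dist (?J i (x (k + n)) s) fz_zero \<le> N i (k + n)" if "i \<le> p" for i k s
        unfolding N_def using S.norm_le_sup_dist[OF xC[OF that]] .
      have 2: "has_hderiv a b (\<lambda>s. fz_sum (\<lambda>k. ?J i (x (k + n)) s)) (fz_sum (\<lambda>k. ?J (Suc i) (x (k + n)) s)) s"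
        if i: "i < p" and s: "s \<in> {a..b}" for i s
      proof -
        have i': "i \<le> p" "Suc i \<le> p" using i by auto
        show ?thesis
          by (rule has_hderiv_sum[OF s fz[OF x(1) i'(1)] Cp_car_hderiv[OF x(1) i] bd[OF i'(1)] NS[OF i'(1)]
                bd[OF i'(2)] NS[OF i'(2)]])
      qed
      show ?thesis
        using Cp_carI[OF ab, of p "\<lambda>i s. fz_sum (\<lambda>k. ?J i (x (k + n)) s)", OF 1 2] by (simp add: t_def)
    qed
    have "t n = padd (x n) (t (Suc n))" for n
    proof
      fix s
      have s: "fz_summable (\<lambda>k. x (k + n) s)"
        using S.fz_summable_pointwise(1)[OF xC[of 0] _ NS[of 0 n], of "\<lambda>k. k + n"] by (simp add: N_def)
      show "t n s = padd (x n) (t (Suc n)) s"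
        using fz_sum_head[OF s] by (simp add: t_def padd_def)
    qed
    then have "Dpstar a b p (t n) (padd (x n) (t (Suc n))) = 0" for n
      using self by metis
    moreover have "Dpstar a b p (t n) pzero \<le> 4 * (1/512) ^ n" for n
    proof -
      have "Dpstar a b p (t n) pzero \<le> (\<Sum>i\<le>p. \<Sum>k. N i (k + n))"
        unfolding D0
      proof (rule sum_mono)
        fix i assume "i \<in> {..p}"
        then have i: "i \<le> p" by simp
        show "?d (?J i (t n)) pzero \<le> (\<Sum>k. N i (k + n))"
          using S.fz_summable_pointwise(3)[OF xC[OF i] _ NS[OF i, of n], of "\<lambda>k. k + n"] J i by (simp add: N_def)
      qed
      \<comment> \<open>Interchanging the sums lets the bound on the full norm of each term be used
        at once; estimating each order of derivative separately would cost a factor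
        \<open>p + 1\<close>.\<close>
      also have "\<dots> = (\<Sum>k. \<Sum>i\<le>p. N i (k + n))"
        using NS by (intro suminf_sum[symmetric]) auto
      also have "\<dots> \<le> (\<Sum>k. (1/512) ^ (k + n))"
        using x(2) NS by (intro suminf_le summable_sum summable_scale) (auto simp: D0 N_def)
      also have "\<dots> \<le> 2 * (1/512) ^ n" by (rule suminf_scale)
      also have "\<dots> \<le> 4 * (1/512) ^ n" by simp
      finally show ?thesis .
    qed
    ultimately show "\<exists>t. \<forall>n. t n \<in> ?K \<and> Dpstar a b p (t n) (padd (x n) (t (Suc n))) = 0 \<and>
        Dpstar a b p (t n) pzero \<le> 4 * (1/512) ^ n"
      using J by blast
  next
    show "padd (padd f g) h = padd f (padd g h)" if "f \<in> ?K" "g \<in> ?K" "h \<in> ?K" for f g h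
      using fz[OF that(1), of 0] fz[OF that(2), of 0] fz[OF that(3), of 0] by (simp add: padd_def fz_add_assoc)
    show "padd f pzero = f" "padd pzero f = f" if "f \<in> ?K" for f
      using fz[OF that, of 0] by (simp_all add: padd_def)
  qed (auto simp: zero add smul self nonneg, simp add: psmul_def)
qed

lemma fspace_cone_Cp: "a < b \<Longrightarrow> fspace_cone (Cp_space a b p)"
  unfolding Cp_space_def by (intro fspace_cone_fun_space fuzzy_cone_Cp)

subsection \<open>The spaces of p-integrable functions and p-summable sequences\<close>

lemma add_powr_le:
  fixes x y :: real
  assumes "0 \<le> x" "0 \<le> y" "0 \<le> p"
  shows "(x + y) powr p \<le> 2 powr p * (x powr p + y powr p)"
proof -
  have "(x + y) powr p \<le> (2 * max x y) powr p" using assms by (intro powr_mono2) auto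
  also have "\<dots> = 2 powr p * max x y powr p" by (rule powr_mult)
  also have "\<dots> \<le> 2 powr p * (x powr p + y powr p)" by (intro mult_left_mono) (auto simp: max_def)
  finally show ?thesis .
qed

text \<open>Raised to the power \<open>p\<close>, the claim is superadditivity: write
  \<open>u powr p\<close> as \<open>u * u powr (p - 1)\<close> and enlarge the second factor by
  monotonicity, as \<open>p - 1\<close> is nonnegative.\<close>

lemma powr_inverse_subadditive:
  fixes x y :: real
  assumes x: "0 \<le> x" and y: "0 \<le> y" and p: "1 \<le> p"
  shows "(x + y) powr (1/p) \<le> x powr (1/p) + y powr (1/p)"
proof -
  define u v where "u = x powr (1/p)" and "v = y powr (1/p)"
  have uv: "0 \<le> u" "0 \<le> v" "x = u powr p" "y = v powr p"
    using p x y by (auto simp: u_def v_def powr_powr)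
  have split: "r powr p = r * r powr (p - 1)" if "0 \<le> r" for r :: real
    using that powr_add[of r 1 "p - 1"] by (cases "r = 0") auto
  have "x + y = u * u powr (p - 1) + v * v powr (p - 1)" using uv split by simp
  also have "\<dots> \<le> u * (u + v) powr (p - 1) + v * (u + v) powr (p - 1)"
    using uv p by (intro add_mono mult_left_mono powr_mono2) auto
  also have "\<dots> = (u + v) powr p" using split[of "u + v"] uv by (simp add: distrib_right)
  finally have "(x + y) powr (1/p) \<le> ((u + v) powr p) powr (1/p)"
    using x y p by (intro powr_mono2) auto
  also have "\<dots> = u + v" using uv p by (simp add: powr_powr)
  finally show ?thesis by (simp add: u_def v_def)
qed

text \<open>A countable supremum makes the distance measurable. Left continuity allows a positive
  level to be replaced by a slightly smaller rational one, and the exceptional level 0 is itself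
  rational.\<close>

lemma fz_dist_eq_SUP_rational:
  assumes u: "fuzzy_number u" and v: "fuzzy_number v"
  shows "fz_dist u v = (SUP r\<in>\<rat> \<inter> {0..1}. max \<bar>lower u r - lower v r\<bar> \<bar>upper u r - upper v r\<bar>)"
    (is "_ = Sup (?g ` ?Q)")
proof (rule antisym)
  have bdd: "bdd_above (?g ` ?Q)"
    by (rule bdd_above_mono[OF fz_dist_bdd_above[OF u v]]) auto
  have Q: "\<bar>lower u s - lower v s\<bar> \<le> Sup (?g ` ?Q)" "\<bar>upper u s - upper v s\<bar> \<le> Sup (?g ` ?Q)" if "s \<in> ?Q" for s
    using cSUP_upper[OF that bdd] by auto
  have Q0: "0 \<in> ?Q" by simp
  show "Sup (?g ` ?Q) \<le> fz_dist u v"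
    using fz_dist_lower[OF u v] fz_dist_upper[OF u v] Q0 by (intro cSUP_least) auto
  have near: "\<exists>s\<in>?Q. \<bar>l r - m r\<bar> \<le> \<bar>l s - m s\<bar> + e"
    if l: "level_fun l" and m: "level_fun m" and r: "0 \<le> r" "r \<le> 1" and e: "0 < e" for l m r e
  proof (cases "r = 0")
    case False
    then have r0: "0 < r" using r by simp
    obtain s1 where s1: "s1 < r" "\<And>s'. s1 \<le> s' \<Longrightarrow> s' \<le> 1 \<Longrightarrow> l r - e < l s'"
      using level_fun_left[OF l r0 r(2) e] by metis
    obtain s2 where s2: "s2 < r" "\<And>s'. s2 \<le> s' \<Longrightarrow> s' \<le> 1 \<Longrightarrow> m r - e < m s'"
      using level_fun_left[OF m r0 r(2) e] by metis
    obtain s where s: "s \<in> \<rat>" "max 0 (max s1 s2) < s" "s < r"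
      using Rats_dense_in_real[of "max 0 (max s1 s2)" r] s1 s2 r0 by auto
    have "l s \<le> l r" "m s \<le> m r" using level_fun_mono[OF l] level_fun_mono[OF m] s r by auto
    then have "\<bar>l r - m r\<bar> \<le> \<bar>l s - m s\<bar> + e"
      using s1(2)[of s] s2(2)[of s] s r by auto
    then show ?thesis using s r by (intro bexI[of _ s]) auto
  qed (use e in \<open>auto intro: bexI[of _ 0]\<close>)
  show "fz_dist u v \<le> Sup (?g ` ?Q)"
  proof (rule fz_dist_leI)
    fix r :: real assume r: "0 \<le> r" "r \<le> 1"
    show "\<bar>lower u r - lower v r\<bar> \<le> Sup (?g ` ?Q)"
    proof (rule field_le_epsilon)
      fix e :: real assume "0 < e"
      from near[OF fuzzy_number_level_fun(1)[OF u] fuzzy_number_level_fun(1)[OF v] r this]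
      show "\<bar>lower u r - lower v r\<bar> \<le> Sup (?g ` ?Q) + e" using Q(1) by force
    qed
    show "\<bar>upper u r - upper v r\<bar> \<le> Sup (?g ` ?Q)"
    proof (rule field_le_epsilon)
      fix e :: real assume "0 < e"
      \<comment> \<open>The negated upper endpoints are the level functions; swapping
        \<open>u\<close> and \<open>v\<close> absorbs the sign.\<close>
      from near[OF fuzzy_number_level_fun(2)[OF v] fuzzy_number_level_fun(2)[OF u] r this]
      obtain s where "s \<in> ?Q" "\<bar>upper u r - upper v r\<bar> \<le> \<bar>upper u s - upper v s\<bar> + e" by auto
      then show "\<bar>upper u r - upper v r\<bar> \<le> Sup (?g ` ?Q) + e" using Q(2)[of s] by linarith
    qed
  qed
qed

text \<open>Both \<open>L\<^sup>p([a,b])\<close> and \<open>l\<^sup>p\<close> are instances, the latter with counting measure.\<close>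

locale fuzzy_Lp =
  fixes M :: "'i measure" and T :: "'i set" and p :: real
  assumes p: "1 \<le> p"
begin

definition K :: "('i \<Rightarrow> fz) set" where
  "K = {f. (\<forall>t. fuzzy_number (f t)) \<and> (\<forall>t. t \<notin> T \<longrightarrow> f t = fz_zero) \<and>
     (\<forall>r\<in>{0..1}. (\<lambda>t. lower (f t) r) \<in> borel_measurable M \<and> (\<lambda>t. upper (f t) r) \<in> borel_measurable M) \<and>
     (\<integral>\<^sup>+ t. ennreal (fz_dist (f t) fz_zero powr p) \<partial>M) < \<infinity>}"

definition I :: "('i \<Rightarrow> fz) \<Rightarrow> ('i \<Rightarrow> fz) \<Rightarrow> ennreal" where
  "I f g = (\<integral>\<^sup>+ t. ennreal (fz_dist (f t) (g t) powr p) \<partial>M)"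

definition dst :: "('i \<Rightarrow> fz) \<Rightarrow> ('i \<Rightarrow> fz) \<Rightarrow> real" where
  "dst f g = enn2real (I f g) powr (1 / p)"

lemma K_fuzzy: "f \<in> K \<Longrightarrow> fuzzy_number (f t)"
  and K_outside: "f \<in> K \<Longrightarrow> t \<notin> T \<Longrightarrow> f t = fz_zero"
  and K_lower: "f \<in> K \<Longrightarrow> 0 \<le> r \<Longrightarrow> r \<le> 1 \<Longrightarrow> (\<lambda>t. lower (f t) r) \<in> borel_measurable M"
  and K_upper: "f \<in> K \<Longrightarrow> 0 \<le> r \<Longrightarrow> r \<le> 1 \<Longrightarrow> (\<lambda>t. upper (f t) r) \<in> borel_measurable M"
  and K_finite: "f \<in> K \<Longrightarrow> I f pzero < \<infinity>"
  by (simp_all add: K_def I_def)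

lemma KI:
  assumes "\<And>t. fuzzy_number (f t)" "\<And>t. t \<notin> T \<Longrightarrow> f t = fz_zero"
    "\<And>r. 0 \<le> r \<Longrightarrow> r \<le> 1 \<Longrightarrow> (\<lambda>t. lower (f t) r) \<in> borel_measurable M"
    "\<And>r. 0 \<le> r \<Longrightarrow> r \<le> 1 \<Longrightarrow> (\<lambda>t. upper (f t) r) \<in> borel_measurable M"
    "I f pzero < \<infinity>"
  shows "f \<in> K"
  using assms by (simp add: K_def I_def)

lemma dist_measurable:
  assumes f: "f \<in> K" and g: "g \<in> K"
  shows "(\<lambda>t. fz_dist (f t) (g t)) \<in> borel_measurable M"
proof -
  have "(\<lambda>t. SUP r\<in>\<rat> \<inter> {0..1}. max \<bar>lower (f t) r - lower (g t) r\<bar> \<bar>upper (f t) r - upper (g t) r\<bar>)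
      \<in> borel_measurable M"
  proof (rule borel_measurable_cSUP)
    show "countable (\<rat> \<inter> {0..1::real})" using countable_rat by blast
    show "(\<lambda>t. max \<bar>lower (f t) r - lower (g t) r\<bar> \<bar>upper (f t) r - upper (g t) r\<bar>) \<in> borel_measurable M"
      if "r \<in> \<rat> \<inter> {0..1}" for r
      using that K_lower[OF f] K_lower[OF g] K_upper[OF f] K_upper[OF g]
      by (intro borel_measurable_max borel_measurable_abs borel_measurable_diff) auto
    show "bdd_above ((\<lambda>r. max \<bar>lower (f t) r - lower (g t) r\<bar> \<bar>upper (f t) r - upper (g t) r\<bar>) ` (\<rat> \<inter> {0..1}))" for t
      by (rule bdd_above_mono[OF fz_dist_bdd_above[OF K_fuzzy[OF f] K_fuzzy[OF g]]]) auto
  qed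
  then show ?thesis by (simp add: fz_dist_eq_SUP_rational K_fuzzy[OF f] K_fuzzy[OF g])
qed

text \<open>Additivity of the integral is applied to the majorants \<open>a\<close> and
  \<open>b\<close> only, so \<open>h\<close> may be the norm of a sum whose membership in
  \<open>K\<close> is still to be shown.\<close>

lemma nn_integral_powr_add_le:
  assumes "a \<in> borel_measurable M" "b \<in> borel_measurable M"
    and "\<And>t. 0 \<le> h t" "\<And>t. 0 \<le> a t" "\<And>t. 0 \<le> b t" "\<And>t. h t \<le> a t + b t"
  shows "(\<integral>\<^sup>+ t. ennreal (h t powr p) \<partial>M) \<le>
    ennreal (2 powr p) * ((\<integral>\<^sup>+ t. ennreal (a t powr p) \<partial>M) + (\<integral>\<^sup>+ t. ennreal (b t powr p) \<partial>M))"
proof -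
  have "(\<integral>\<^sup>+ t. ennreal (h t powr p) \<partial>M) \<le>
      (\<integral>\<^sup>+ t. ennreal (2 powr p) * (ennreal (a t powr p) + ennreal (b t powr p)) \<partial>M)"
  proof (rule nn_integral_mono)
    fix t
    have "h t powr p \<le> (a t + b t) powr p" using assms p by (intro powr_mono2) auto
    also have "\<dots> \<le> 2 powr p * (a t powr p + b t powr p)" using assms p by (intro add_powr_le) auto
    finally have "ennreal (h t powr p) \<le> ennreal (2 powr p * (a t powr p + b t powr p))" by (rule ennreal_leI)
    then show "ennreal (h t powr p) \<le> ennreal (2 powr p) * (ennreal (a t powr p) + ennreal (b t powr p))"
      by (simp add: ennreal_mult)
  qed
  also have "\<dots> = ennreal (2 powr p) * ((\<integral>\<^sup>+ t. ennreal (a t powr p) \<partial>M) + (\<integral>\<^sup>+ t. ennreal (b t powr p) \<partial>M))"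
    using assms(1,2) by (simp add: nn_integral_cmult nn_integral_add)
  finally show ?thesis .
qed

lemma pzero_mem: "pzero \<in> K"
  using p by (intro KI) (auto simp: I_def)

lemma I_commute: "I f g = I g f"
  by (simp add: I_def fz_dist_commute)

lemma I_triangle:
  assumes "f \<in> K" "g \<in> K" "h \<in> K"
  shows "I f h \<le> ennreal (2 powr p) * (I f g + I g h)"
  unfolding I_def using assms K_fuzzy
  by (intro nn_integral_powr_add_le dist_measurable fz_dist_nonneg fz_dist_triangle)

lemma ennreal_mult_less_top_real: "x < \<infinity> \<Longrightarrow> ennreal c * x < \<infinity>"
  by (simp add: ennreal_mult_less_top)

lemma I_finite:
  assumes f: "f \<in> K" and g: "g \<in> K" shows "I f g < \<infinity>"
proof -
  have "I f g \<le> ennreal (2 powr p) * (I f pzero + I g pzero)"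
    using I_triangle[OF f pzero_mem g] by (simp add: I_commute)
  also have "\<dots> < \<infinity>" using K_finite[OF f] K_finite[OF g] by (intro ennreal_mult_less_top_real) simp
  finally show ?thesis .
qed

lemma dst_le:
  assumes "0 \<le> c" "I f g \<le> ennreal (c powr p)" shows "dst f g \<le> c"
proof -
  have "enn2real (I f g) \<le> c powr p" using assms by (intro enn2real_leI) auto
  then have "dst f g \<le> (c powr p) powr (1 / p)" unfolding dst_def using p by (intro powr_mono2) auto
  then show ?thesis using p assms(1) by (simp add: powr_powr)
qed

lemma I_eq_dst:
  assumes "I f g < \<infinity>" shows "I f g = ennreal (dst f g powr p)"
proof -
  have "dst f g powr p = enn2real (I f g)" using p by (simp add: dst_def powr_powr)
  then show ?thesis using assms by simp
qed

text \<open>The constant \<open>2 powr p\<close> from \<open>I_triangle\<close> turns into 2 under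
  the p-th root, and the root of a sum is at most the sum of the roots.\<close>

lemma dst_triangle:
  assumes fgh: "f \<in> K" "g \<in> K" "h \<in> K"
  shows "dst f h \<le> 2 * (dst f g + dst g h)"
proof -
  have fin: "I f g < \<infinity>" "I g h < \<infinity>" using I_finite fgh by auto
  have "enn2real (I f h) \<le> enn2real (ennreal (2 powr p) * (I f g + I g h))"
    using I_triangle[OF fgh] fin by (intro enn2real_mono) (auto simp: ennreal_mult_less_top)
  also have "\<dots> = 2 powr p * (enn2real (I f g) + enn2real (I g h))"
    using fin by (simp add: enn2real_mult enn2real_plus)
  finally have "dst f h \<le> (2 powr p * (enn2real (I f g) + enn2real (I g h))) powr (1/p)"
    unfolding dst_def using p by (intro powr_mono2) auto
  also have "\<dots> = 2 * (enn2real (I f g) + enn2real (I g h)) powr (1/p)"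
    using p by (simp add: powr_mult powr_powr)
  also have "\<dots> \<le> 2 * (dst f g + dst g h)"
    unfolding dst_def using p by (intro mult_left_mono powr_inverse_subadditive) auto
  finally show ?thesis .
qed

lemma padd_mem:
  assumes f: "f \<in> K" and g: "g \<in> K" shows "padd f g \<in> K"
proof (rule KI)
  have "I (padd f g) pzero \<le> ennreal (2 powr p) * (I f pzero + I g pzero)"
    unfolding I_def padd_def using K_fuzzy f g
    by (intro nn_integral_powr_add_le dist_measurable pzero_mem fz_dist_nonneg fz_norm_add) auto
  also have "\<dots> < \<infinity>" using K_finite[OF f] K_finite[OF g] by (intro ennreal_mult_less_top_real) simp
  finally show "I (padd f g) pzero < \<infinity>" .
qed (use f g in \<open>auto simp: padd_def lower_add upper_add K_fuzzy K_outside K_lower K_upper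
       intro!: borel_measurable_add\<close>)

lemma I_smul:
  assumes f: "f \<in> K" and c: "0 \<le> c"
  shows "I (psmul c f) pzero = ennreal (c powr p) * I f pzero"
proof -
  have "I (psmul c f) pzero = (\<integral>\<^sup>+ t. ennreal (c powr p) * ennreal (fz_dist (f t) fz_zero powr p) \<partial>M)"
    unfolding I_def psmul_def using K_fuzzy[OF f] c
    by (intro nn_integral_cong) (simp add: fz_norm_smul powr_mult ennreal_mult)
  also have "\<dots> = ennreal (c powr p) * I f pzero"
    unfolding I_def using dist_measurable[OF f pzero_mem] by (intro nn_integral_cmult) measurable
  finally show ?thesis .
qed

lemma psmul_mem:
  assumes f: "f \<in> K" and c: "0 \<le> c" shows "psmul c f \<in> K"
proof (rule KI)
  show "I (psmul c f) pzero < \<infinity>"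
    unfolding I_smul[OF f c] using K_finite[OF f] by (rule ennreal_mult_less_top_real)
qed (use f c in \<open>auto simp: psmul_def lower_smul upper_smul K_fuzzy K_outside K_lower K_upper
       intro!: borel_measurable_times\<close>)

section \<open>Rapidly decreasing series in the p-integrable spaces\<close>

text \<open>With R the p-th root of the weighted sum, every single term gives
  \<open>g k \<le> R * (1/2) ^ Suc k\<close>, and these bounds add up to R. The weights thus do the
  work of a triangle inequality for infinitely many summands.\<close>

lemma suminf_norm_powr_le:
  assumes g: "\<And>k. 0 \<le> g k" and fin: "(\<Sum>k. ennreal ((2 ^ Suc k * g k) powr p)) < \<infinity>"
  shows "summable g" "ennreal ((\<Sum>k. g k) powr p) \<le> (\<Sum>k. ennreal ((2 ^ Suc k * g k) powr p))"
proof -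
  let ?G = "\<Sum>k. ennreal ((2 ^ Suc k * g k) powr p)"
  define R where "R = enn2real ?G powr (1/p)"
  have G: "?G = ennreal (R powr p)" using fin p by (simp add: R_def powr_powr)
  have le_suminf: "h k \<le> suminf h" for h :: "nat \<Rightarrow> ennreal" and k
    using sum_le_suminf[of h "{k}"] by simp
  have le: "g k \<le> R * (1/2) ^ Suc k" for k
  proof -
    have "ennreal ((2 ^ Suc k * g k) powr p) \<le> ?G"
      by (rule le_suminf)
    then have "(2 ^ Suc k * g k) powr p \<le> R powr p" unfolding G by (simp add: ennreal_le_iff)
    moreover have "R powr p < (2 ^ Suc k * g k) powr p" if "R < 2 ^ Suc k * g k"
      using that p by (intro powr_less_mono2) (simp_all add: R_def)
    ultimately have "2 ^ Suc k * g k \<le> R" by (meson not_le)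
    then show ?thesis by (simp add: field_simps)
  qed
  have s: "(\<lambda>k. R * (1/2) ^ Suc k) sums (R * 1)" by (intro sums_mult power_half_series)
  show sg: "summable g"
    using le g by (intro summable_comparison_test'[OF sums_summable[OF s], of 0]) auto
  have "(\<Sum>k. g k) \<le> R" using suminf_le[OF le sg sums_summable[OF s]] sums_unique[OF s] by simp
  then have "(\<Sum>k. g k) powr p \<le> R powr p" using g sg p by (intro powr_mono2 suminf_nonneg) auto
  then show "ennreal ((\<Sum>k. g k) powr p) \<le> ?G" unfolding G by (rule ennreal_leI)
qed

text \<open>The weight \<open>2 ^ Suc k\<close> turns the ratio 1/512 into 1/256. As
  \<open>p \<ge> 1\<close>, the p-th powers of this geometric sequence stay below
  \<open>(1/2) ^ k\<close>, whose sum 2 is at most \<open>2 powr p\<close>; this produces the factor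
  4 found in \<open>series\<close>.\<close>

lemma nn_integral_weighted_series_le:
  assumes x: "\<And>k. x k \<in> K" and q: "\<And>k. dst (x k) pzero \<le> (1/512) ^ k"
  shows "(\<integral>\<^sup>+ t. (\<Sum>k. ennreal ((2 ^ Suc k * fz_dist (x (k + n) t) fz_zero) powr p)) \<partial>M)
    \<le> ennreal ((4 * (1/512) ^ n) powr p)"
proof -
  let ?c = "2 * (1/512::real) ^ n"
  have term_le: "(\<integral>\<^sup>+ t. ennreal ((2 ^ Suc k * fz_dist (x (k + n) t) fz_zero) powr p) \<partial>M)
      \<le> ennreal (?c powr p * (1/2) ^ k)" for k
  proof -
    have "(\<integral>\<^sup>+ t. ennreal ((2 ^ Suc k * fz_dist (x (k + n) t) fz_zero) powr p) \<partial>M)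
        = (\<integral>\<^sup>+ t. ennreal ((2 ^ Suc k) powr p) * ennreal (fz_dist (x (k + n) t) fz_zero powr p) \<partial>M)"
      by (simp only: powr_mult) (simp add: ennreal_mult)
    also have "\<dots> = ennreal ((2 ^ Suc k) powr p) * I (x (k + n)) pzero"
      unfolding I_def using dist_measurable[OF x pzero_mem, of "k + n"] by (intro nn_integral_cmult) measurable
    also have "\<dots> \<le> ennreal ((2 ^ Suc k) powr p) * ennreal (((1/512) ^ (k + n)) powr p)"
      unfolding I_eq_dst[OF K_finite[OF x]] using q[of "k + n"] p
      by (intro mult_left_mono ennreal_leI powr_mono2) (auto simp: dst_def)
    also have "\<dots> = ennreal ((2 ^ Suc k * (1/512) ^ (k + n)) powr p)"
      by (simp add: powr_mult ennreal_mult)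
    also have "2 ^ Suc k * (1/512) ^ (k + n) = ?c * (1/256::real) ^ k"
    proof -
      have "(1/256::real) ^ k = 2 ^ k * (1/512) ^ k" by (simp flip: power_mult_distrib)
      then show ?thesis by (simp only: power_add power_Suc ac_simps)
    qed
    also have "ennreal ((?c * (1/256) ^ k) powr p) = ennreal (?c powr p * ((1/256) ^ k) powr p)"
      by (simp only: powr_mult)
    also have "\<dots> \<le> ennreal (?c powr p * (1/2) ^ k)"
    proof (intro ennreal_leI mult_left_mono)
      have "((1/256::real) ^ k) powr p \<le> ((1/256) ^ k) powr 1"
        using p by (intro powr_mono') (auto intro: power_le_one)
      also have "\<dots> \<le> (1/2) ^ k" by (simp add: power_mono)
      finally show "((1/256::real) ^ k) powr p \<le> (1/2) ^ k" .
    qed simp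
    finally show ?thesis .
  qed
  have s: "(\<lambda>k. ?c powr p * (1/2) ^ k) sums (?c powr p * 2)"
    using geometric_sums[of "1/2::real"] by (intro sums_mult) simp
  have "(\<integral>\<^sup>+ t. (\<Sum>k. ennreal ((2 ^ Suc k * fz_dist (x (k + n) t) fz_zero) powr p)) \<partial>M)
      = (\<Sum>k. \<integral>\<^sup>+ t. ennreal ((2 ^ Suc k * fz_dist (x (k + n) t) fz_zero) powr p) \<partial>M)"
    using dist_measurable[OF x pzero_mem] by (intro nn_integral_suminf) measurable
  also have "\<dots> \<le> (\<Sum>k. ennreal (?c powr p * (1/2) ^ k))"
    using term_le by (intro suminf_le) auto
  also have "\<dots> = ennreal (?c powr p * 2)" using s by (intro suminf_ennreal_eq) auto
  also have "\<dots> \<le> ennreal ((4 * (1/512) ^ n) powr p)"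
  proof (rule ennreal_leI)
    have "(2::real) powr 1 \<le> 2 powr p" using p by (intro powr_mono) auto
    then have "?c powr p * 2 \<le> ?c powr p * 2 powr p" by (intro mult_left_mono) auto
    also have "\<dots> = (4 * (1/512) ^ n) powr p" by (simp flip: powr_mult)
    finally show "?c powr p * 2 \<le> (4 * (1/512) ^ n) powr p" .
  qed
  finally show ?thesis .
qed

text \<open>The series converges pointwise only almost everywhere; on the exceptional null set
  its terms are replaced by zero.\<close>

lemma Lp_series:
  assumes x: "\<And>k. x k \<in> K" and q: "\<And>k. dst (x k) pzero \<le> (1/512) ^ k"
  shows "\<exists>t. \<forall>n. t n \<in> K \<and> I (t n) (padd (x n) (t (Suc n))) = 0 \<and> dst (t n) pzero \<le> 4 * (1/512) ^ n"
proof -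
  \<comment> \<open>The weighted series has finite integral, so it is finite almost everywhere;
    where \<open>G 0\<close> is finite, the norms of the terms are summable.\<close>
  define G where "G n t = (\<Sum>k. ennreal ((2 ^ Suc k * fz_dist (x (k + n) t) fz_zero) powr p))" for n t
  have Gm[measurable]: "G n \<in> borel_measurable M" for n
    unfolding G_def using dist_measurable[OF x pzero_mem] by measurable
  define E where "E t \<longleftrightarrow> G 0 t < \<infinity>" for t
  have E_set: "{t \<in> space M. E t} \<in> sets M" unfolding E_def by measurable
  have "(\<integral>\<^sup>+ t. G 0 t \<partial>M) \<noteq> \<infinity>"
    using nn_integral_weighted_series_le[OF x q, of 0] unfolding G_def by (auto simp: top_unique)
  then have AE: "AE t in M. E t"
    using nn_integral_noteq_infinite[OF Gm, of 0] by (simp add: E_def less_top)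
  define y where "y k t = (if E t then x k t else fz_zero)" for k t
  have y: "fuzzy_number (y k t)" for k t using K_fuzzy[OF x] by (simp add: y_def)
  have sy: "fz_summable (\<lambda>k. y k t)" for t
  proof (cases "E t")
    case True
    then have "summable (\<lambda>k. fz_dist (x k t) fz_zero)"
      using K_fuzzy[OF x] suminf_norm_powr_le(1)[of "\<lambda>k. fz_dist (x k t) fz_zero"] by (simp add: E_def G_def)
    then show ?thesis using True K_fuzzy[OF x] by unfold_locales (simp_all add: y_def)
  qed (simp add: y_def fz_summable_zero)
  have syn: "fz_summable (\<lambda>k. y (k + n) s)" for n s
    using fz_summable_shift[OF sy] .
  define t where "t n s = fz_sum (\<lambda>k. y (k + n) s)" for n s
  have t_fuzzy: "fuzzy_number (t n s)" for n s
    unfolding t_def by (rule fz_summable.fuzzy_number_sum[OF syn])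
  have t_le: "ennreal (fz_dist (t n s) fz_zero powr p) \<le> G n s" for n s
  \<comment> \<open>Off \<open>E\<close> the sum is zero, and where \<open>G n s\<close> is infinite
    the bound is trivial.\<close>
  proof (cases "E s \<and> G n s < \<infinity>")
    case True
    then have yx: "y k s = x k s" for k by (simp add: y_def)
    note b = suminf_norm_powr_le[of "\<lambda>k. fz_dist (x (k + n) s) fz_zero"]
    have "fz_dist (t n s) fz_zero \<le> (\<Sum>k. fz_dist (x (k + n) s) fz_zero)"
      using fz_norm_sum_le[OF syn[of n s]] by (simp add: t_def yx)
    then have "ennreal (fz_dist (t n s) fz_zero powr p) \<le> ennreal ((\<Sum>k. fz_dist (x (k + n) s) fz_zero) powr p)"
      using t_fuzzy p by (intro ennreal_leI powr_mono2) auto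
    also have "\<dots> \<le> G n s"
      unfolding G_def by (rule b(2)) (use K_fuzzy[OF x] True in \<open>simp_all only: G_def fz_dist_nonneg fuzzy_number_zero\<close>)
    finally show ?thesis .
  next
    case False
    then consider "\<not> E s" | "G n s = \<infinity>" by (auto simp: not_less top_unique)
    then show ?thesis
    proof cases
      case 1
      then show ?thesis using p by (simp add: t_def y_def)
    qed simp
  qed
  have It: "I (t n) pzero \<le> ennreal ((4 * (1/512) ^ n) powr p)" for n
  proof -
    have "I (t n) pzero \<le> (\<integral>\<^sup>+ s. G n s \<partial>M)" unfolding I_def by (intro nn_integral_mono t_le)
    also have "\<dots> \<le> ennreal ((4 * (1/512) ^ n) powr p)"
      unfolding G_def by (rule nn_integral_weighted_series_le[OF x q])
    finally show ?thesis .
  qed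
  have tK: "t n \<in> K" for n
  proof (rule KI)
    show "fuzzy_number (t n s)" for s by (rule t_fuzzy)
    show "t n s = fz_zero" if "s \<notin> T" for s
      using K_outside[OF x that] by (simp add: t_def y_def cong: if_cong)
    show "I (t n) pzero < \<infinity>" using It[of n] by (rule le_less_trans) simp
    fix r :: real assume r: "0 \<le> r" "r \<le> 1"
    have "(\<lambda>s. lower (y k s) r) = (\<lambda>s. if E s then lower (x k s) r else 0)"
      "(\<lambda>s. upper (y k s) r) = (\<lambda>s. if E s then upper (x k s) r else 0)" for k
      using r by (auto simp: y_def)
    then have "(\<lambda>s. lower (y k s) r) \<in> borel_measurable M" "(\<lambda>s. upper (y k s) r) \<in> borel_measurable M" for k
      using E_set K_lower[OF x r] K_upper[OF x r] by (auto intro!: measurable_If)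
    then show "(\<lambda>s. lower (t n s) r) \<in> borel_measurable M" "(\<lambda>s. upper (t n s) r) \<in> borel_measurable M"
      using r by (auto simp: t_def fz_summable.lower_sum[OF syn] fz_summable.upper_sum[OF syn])
  qed
  have rec: "t n s = fz_add (y n s) (t (Suc n) s)" for n s
    using fz_sum_head[OF syn[of n s]] by (simp add: t_def)
  have "I (t n) (padd (x n) (t (Suc n))) = 0" for n
  proof -
    \<comment> \<open>The recursion \<open>rec\<close> is exact for the truncated terms
      \<open>y\<close>, which agree with \<open>x\<close> on \<open>E\<close>; hence distance zero
      in place of equality.\<close>
    have "AE s in M. ennreal (fz_dist (t n s) (padd (x n) (t (Suc n)) s) powr p) = 0"
      using AE
    proof eventually_elim
      case (elim s)
      then have "t n s = padd (x n) (t (Suc n)) s" using rec[of n s] by (simp add: padd_def y_def)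
      then show ?case by simp
    qed
    then show ?thesis unfolding I_def by (simp add: nn_integral_cong_AE[of _ "\<lambda>_. 0"])
  qed
  moreover have "dst (t n) pzero \<le> 4 * (1/512) ^ n" for n
    by (rule dst_le[OF _ It]) simp
  ultimately show ?thesis using tK by blast
qed

text \<open>The metric is a parameter because the actual metrics match \<open>dst\<close> only on
  \<open>K\<close>: for sequences, the real series equals the integral only when it
  converges.\<close>

lemma fuzzy_cone:
  assumes d: "\<And>f g. f \<in> K \<Longrightarrow> g \<in> K \<Longrightarrow> d f g = dst f g"
  shows "fuzzy_cone K padd psmul d pzero"
proof
  show "0 \<le> d f g" if "f \<in> K" "g \<in> K" for f g using that by (simp add: d dst_def)
  show "d f f = 0" if "f \<in> K" for f using that p by (simp add: d dst_def I_def)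
  show "d f g = d g f" if "f \<in> K" "g \<in> K" for f g using that by (simp add: d dst_def I_commute)
  show "d f h \<le> 2 * (d f g + d g h)" if "f \<in> K" "g \<in> K" "h \<in> K" for f g h
    using dst_triangle[OF that] that by (simp add: d)
  show "d (padd h f) (padd h g) = d f g" if "h \<in> K" "f \<in> K" "g \<in> K" for h f g
  proof -
    have "dst (padd h f) (padd h g) = dst f g"
      using that by (simp add: dst_def I_def padd_def K_fuzzy)
    then show ?thesis using that by (simp add: d padd_mem)
  qed
  show "d (psmul c f) pzero = c * d f pzero" if "f \<in> K" "0 \<le> c" for f c
    using that p by (simp add: d psmul_mem pzero_mem dst_def I_smul enn2real_mult powr_mult powr_powr)
next
  fix x assume x: "\<And>k. x k \<in> K" "\<And>k. d (x k) pzero \<le> (1/512) ^ k"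
  then have "\<And>k. dst (x k) pzero \<le> (1/512) ^ k" by (simp add: d pzero_mem)
  then obtain t where t: "\<And>n. t n \<in> K" "\<And>n. I (t n) (padd (x n) (t (Suc n))) = 0" "\<And>n. dst (t n) pzero \<le> 4 * (1/512) ^ n"
    using Lp_series[of x] x(1) by blast
  then have "dst (t n) (padd (x n) (t (Suc n))) = 0" for n using p by (simp add: dst_def)
  then show "\<exists>t. \<forall>n. t n \<in> K \<and> d (t n) (padd (x n) (t (Suc n))) = 0 \<and> d (t n) pzero \<le> 4 * (1/512) ^ n"
    using t x(1) by (intro exI[of _ t]) (simp add: d padd_mem pzero_mem)
qed (auto simp: pzero_mem padd_mem psmul_mem, auto simp: padd_def psmul_def K_fuzzy fz_add_assoc)

end

text \<open>Functions in the space are zero off [a,b], so they coincide with their product by the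
  indicator; this converts restricted measurability and integrals over [a,b] into statements on the
  whole line.\<close>

lemma fspace_cone_Lp:
  assumes "1 \<le> p" shows "fspace_cone (Lp_space a b p)"
proof -
  interpret fuzzy_Lp lebesgue "{a..b}" p using assms by unfold_locales
  have ind: "indicator {a..b} t *\<^sub>R h (f t) = h (f t)" if "fuzzy_fun_on a b f" "h fz_zero = 0" for f t and h :: "fz \<Rightarrow> real"
    using that by (auto simp: fuzzy_fun_on_def indicator_def)
  have restr: "(\<lambda>t. lower (f t) r) \<in> borel_measurable (restrict_space lebesgue {a..b}) \<longleftrightarrow>
        (\<lambda>t. lower (f t) r) \<in> borel_measurable lebesgue"
      "(\<lambda>t. upper (f t) r) \<in> borel_measurable (restrict_space lebesgue {a..b}) \<longleftrightarrow>
        (\<lambda>t. upper (f t) r) \<in> borel_measurable lebesgue"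
    if "fuzzy_fun_on a b f" "0 \<le> r" "r \<le> 1" for f r
    using ind[OF that(1), of "\<lambda>u. lower u r"] ind[OF that(1), of "\<lambda>u. upper u r"] that(2,3)
    by (simp_all add: borel_measurable_restrict_space_iff del: real_scaleR_def)
  have int: "(\<integral>\<^sup>+ t \<in> {a..b}. ennreal (fz_dist (f t) (g t) powr p) \<partial>lebesgue) = I f g"
    if "\<And>t. t \<notin> {a..b} \<Longrightarrow> f t = fz_zero" "\<And>t. t \<notin> {a..b} \<Longrightarrow> g t = fz_zero" for f g
    unfolding I_def using that by (intro nn_integral_cong) (auto simp: indicator_def)
  have fz: "fuzzy_number (f t)" if "fuzzy_fun_on a b f" for f t
    using that by (cases "t \<in> {a..b}") (auto simp: fuzzy_fun_on_def)
  have K: "Lp_car a b p = K"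
  proof (intro set_eqI iffI)
    fix f assume f: "f \<in> Lp_car a b p"
    then have ff: "fuzzy_fun_on a b f" by (simp add: Lp_car_def)
    show "f \<in> K"
    proof (rule KI)
      show "I f pzero < \<infinity>" using f ff int[of f pzero] by (simp add: Lp_car_def fuzzy_fun_on_def)
      fix r :: real assume r: "0 \<le> r" "r \<le> 1"
      show "(\<lambda>t. lower (f t) r) \<in> borel_measurable lebesgue" "(\<lambda>t. upper (f t) r) \<in> borel_measurable lebesgue"
        using f r restr[OF ff r] by (auto simp: Lp_car_def)
    qed (use ff fz in \<open>auto simp: fuzzy_fun_on_def\<close>)
  next
    fix f assume f: "f \<in> K"
    have ff: "fuzzy_fun_on a b f" using K_fuzzy[OF f] K_outside[OF f] by (simp add: fuzzy_fun_on_def)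
    have "(\<lambda>t. lower (f t) r) \<in> borel_measurable (restrict_space lebesgue {a..b})"
      "(\<lambda>t. upper (f t) r) \<in> borel_measurable (restrict_space lebesgue {a..b})" if "0 \<le> r" "r \<le> 1" for r
      using restr[OF ff that] K_lower[OF f that] K_upper[OF f that] by auto
    then show "f \<in> Lp_car a b p"
      using ff K_finite[OF f] int[of f pzero] K_outside[OF f] by (simp add: Lp_car_def)
  qed
  show ?thesis
    unfolding Lp_space_def K
  proof (intro fspace_cone_fun_space fuzzy_cone)
    fix f g assume f: "f \<in> K" and g: "g \<in> K"
    show "Dp a b p f g = dst f g"
      unfolding Dp_def dst_def using int[OF K_outside[OF f] K_outside[OF g]] by simp
  qed
qed

lemma fspace_cone_lp:
  assumes "1 \<le> p" shows "fspace_cone (lp_space p)"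
proof -
  interpret fuzzy_Lp "count_space (UNIV :: nat set)" UNIV p using assms by unfold_locales
  have I: "I f g = (\<Sum>n. ennreal (fz_dist (f n) (g n) powr p))" for f g
    by (simp add: I_def nn_integral_count_space_nat)
  have sm: "summable (\<lambda>n. fz_dist (f n) (g n) powr p)" if "f \<in> K" "g \<in> K" for f g
    using I_finite[OF that] by (intro summable_suminf_not_top) (auto simp: I)
  have K: "{x. (\<forall>n. fuzzy_number (x n)) \<and> summable (\<lambda>n. fz_dist (x n) fz_zero powr p)} = K"
  proof (intro set_eqI iffI)
    fix x assume x: "x \<in> {x. (\<forall>n. fuzzy_number (x n)) \<and> summable (\<lambda>n. fz_dist (x n) fz_zero powr p)}"
    then have "I x pzero < \<infinity>" by (simp add: I suminf_ennreal2)
    then show "x \<in> K" using x by (intro KI) auto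
  next
    fix x assume "x \<in> K"
    then show "x \<in> {x. (\<forall>n. fuzzy_number (x n)) \<and> summable (\<lambda>n. fz_dist (x n) fz_zero powr p)}"
      using sm[OF _ pzero_mem] K_fuzzy by simp
  qed
  show ?thesis
    unfolding lp_space_def K
    by (intro fspace_cone_seq_space fuzzy_cone) (simp add: dst_def I suminf_ennreal2 sm suminf_nonneg)
qed

subsection \<open>Finite products\<close>

lemma fspace_cone_base: "base_space S \<Longrightarrow> fspace_cone S"
  by (induction rule: base_space.induct)
    (auto intro: fspace_cone_RF fspace_cone_C fspace_cone_Lp fspace_cone_Cp fspace_cone_lp fspace_cone_m
      fspace_cone_c fspace_cone_c0)

text \<open>All axioms hold componentwise. The maximum keeps the common bound
  \<open>4 * (1/512) ^ n\<close> of the remainders, which are chosen separately in each factor, and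
  nonemptiness of \<open>Ss\<close> gives the maximum its meaning.\<close>

lemma fspace_cone_prod:
  assumes ne: "Ss \<noteq> []" and cone: "\<And>T. T \<in> set Ss \<Longrightarrow> fspace_cone T"
  shows "fspace_cone (prod_space Ss)"
proof -
  let ?P = "prod_space Ss" and ?n = "length Ss"
  have cone_nth: "fuzzy_cone (carrier (Ss ! i)) (fadd (Ss ! i)) (fsmul (Ss ! i)) (fdist (Ss ! i)) (fzero (Ss ! i))"
    if "i < ?n" for i
    using cone[OF nth_mem[OF that]] by (simp add: fspace_cone_def)
  note C = fuzzy_cone.zero_mem[OF cone_nth] fuzzy_cone.add_mem[OF cone_nth] fuzzy_cone.smul_mem[OF cone_nth]
    fuzzy_cone.assoc[OF cone_nth] fuzzy_cone.add_zero[OF cone_nth] fuzzy_cone.smul_0[OF cone_nth]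
    fuzzy_cone.dist_self[OF cone_nth] fuzzy_cone.dist_add[OF cone_nth] fuzzy_cone.norm_smul[OF cone_nth]
  have n: "0 < ?n" using ne by simp
  have carrier: "x \<in> carrier ?P \<longleftrightarrow> (\<exists>xs. x = FTup xs \<and> length xs = ?n \<and> (\<forall>i<?n. xs ! i \<in> carrier (Ss ! i)))" for x
    by (auto simp: prod_space_def)
  have mem: "ftup x ! i \<in> carrier (Ss ! i)" if "x \<in> carrier ?P" "i < ?n" for x i
    using that by (auto simp: carrier)
  have memI: "FTup (map h [0..<?n]) \<in> carrier ?P" if "\<And>i. i < ?n \<Longrightarrow> h i \<in> carrier (Ss ! i)" for h
    using that by (auto simp: carrier)
  have ext: "x = y" if "x \<in> carrier ?P" "y \<in> carrier ?P" "\<And>i. i < ?n \<Longrightarrow> ftup x ! i = ftup y ! i" for x y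
    using that by (auto simp: carrier intro: nth_equalityI)
  have ops: "fadd ?P x y = FTup (map (\<lambda>i. fadd (Ss ! i) (ftup x ! i) (ftup y ! i)) [0..<?n])"
    "fsmul ?P c x = FTup (map (\<lambda>i. fsmul (Ss ! i) c (ftup x ! i)) [0..<?n])"
    "fzero ?P = FTup (map (\<lambda>i. fzero (Ss ! i)) [0..<?n])" for c x y
    by (auto simp: prod_space_def intro: nth_equalityI)
  \<comment> \<open>The maximum is used only through this characterisation of its upper
    bounds.\<close>
  have dist_le_iff: "fdist ?P x y \<le> B \<longleftrightarrow> (\<forall>i<?n. fdist (Ss ! i) (ftup x ! i) (ftup y ! i) \<le> B)" for x y B
    using ne by (auto simp: prod_space_def Max_le_iff lessThan_empty_iff)
  have dist_ge: "fdist (Ss ! i) (ftup x ! i) (ftup y ! i) \<le> fdist ?P x y" if "i < ?n" for x y i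
    using dist_le_iff[of x y "fdist ?P x y"] that by simp
  have dist_cong: "fdist ?P x y = fdist ?P x' y'"
    if "\<And>i. i < ?n \<Longrightarrow> fdist (Ss ! i) (ftup x ! i) (ftup y ! i) = fdist (Ss ! i) (ftup x' ! i) (ftup y' ! i)" for x y x' y'
  proof (rule antisym)
    show "fdist ?P x y \<le> fdist ?P x' y'" unfolding dist_le_iff[of x y] using dist_ge that by simp
    show "fdist ?P x' y' \<le> fdist ?P x y" unfolding dist_le_iff[of x' y'] using dist_ge[of _ x y] that by simp
  qed
  have dist_0: "fdist ?P x y = 0" if "\<And>i. i < ?n \<Longrightarrow> fdist (Ss ! i) (ftup x ! i) (ftup y ! i) = 0" for x y
  proof (rule antisym)
    show "fdist ?P x y \<le> 0" unfolding dist_le_iff using that by simp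
    show "0 \<le> fdist ?P x y" using dist_ge[OF n, of x y] that[OF n] by simp
  qed
  have nonneg: "0 \<le> fdist ?P x y" if "x \<in> carrier ?P" "y \<in> carrier ?P" for x y
    using fuzzy_cone.dist_nonneg[OF cone_nth[OF n] mem[OF that(1) n] mem[OF that(2) n]] dist_ge[OF n, of x y] by linarith
  have zero_mem: "fzero ?P \<in> carrier ?P" unfolding ops using C(1) by (intro memI)
  have add_mem: "fadd ?P x y \<in> carrier ?P" if "x \<in> carrier ?P" "y \<in> carrier ?P" for x y
    unfolding ops using that C(2) mem by (intro memI) auto
  have smul_mem: "fsmul ?P c x \<in> carrier ?P" if "x \<in> carrier ?P" "0 \<le> c" for c x
    unfolding ops using that C(3) mem by (intro memI) auto
  show ?thesis
    unfolding fspace_cone_def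
  proof
    show "fadd ?P (fadd ?P x y) w = fadd ?P x (fadd ?P y w)"
      if "x \<in> carrier ?P" "y \<in> carrier ?P" "w \<in> carrier ?P" for x y w
      by (rule ext) (use that in \<open>simp_all add: add_mem, simp add: ops C(4) mem\<close>)
    show "fadd ?P x (fzero ?P) = x" if "x \<in> carrier ?P" for x
      by (rule ext) (use that zero_mem in \<open>simp_all add: add_mem, simp add: ops C(5) mem\<close>)
    show "fadd ?P (fzero ?P) x = x" if "x \<in> carrier ?P" for x
      by (rule ext) (use that zero_mem in \<open>simp_all add: add_mem, simp add: ops C(6) mem\<close>)
    show "fsmul ?P 0 x = fzero ?P" if "x \<in> carrier ?P" for x
      using that by (simp add: ops C(7) mem)
    show "fdist ?P x x = 0" if "x \<in> carrier ?P" for x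
      using that by (intro dist_0 C(8) mem)
    show "fdist ?P x y = fdist ?P y x" if "x \<in> carrier ?P" "y \<in> carrier ?P" for x y
      using that by (intro dist_cong fuzzy_cone.dist_commute[OF cone_nth] mem)
    show "fdist ?P x w \<le> 2 * (fdist ?P x y + fdist ?P y w)"
      if xyw: "x \<in> carrier ?P" "y \<in> carrier ?P" "w \<in> carrier ?P" for x y w
      unfolding dist_le_iff
    proof (intro allI impI)
      fix i assume i: "i < ?n"
      show "fdist (Ss ! i) (ftup x ! i) (ftup w ! i) \<le> 2 * (fdist ?P x y + fdist ?P y w)"
        using fuzzy_cone.dist_triangle[OF cone_nth[OF i] xyw[THEN mem, OF i]] dist_ge[OF i, of x y] dist_ge[OF i, of y w]
        by (simp add: algebra_simps)
    qed
    show "fdist ?P (fadd ?P w x) (fadd ?P w y) = fdist ?P x y"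
      if "w \<in> carrier ?P" "x \<in> carrier ?P" "y \<in> carrier ?P" for w x y
      using that by (intro dist_cong) (auto simp: ops C(9) mem)
    show "fdist ?P (fsmul ?P c x) (fzero ?P) = c * fdist ?P x (fzero ?P)"
      if x: "x \<in> carrier ?P" and c: "0 \<le> c" for c x
    proof (rule antisym)
      have eq: "fdist (Ss ! i) (ftup (fsmul ?P c x) ! i) (ftup (fzero ?P) ! i)
          = c * fdist (Ss ! i) (ftup x ! i) (ftup (fzero ?P) ! i)" if "i < ?n" for i
        using that x c by (simp add: ops C(10) mem)
      show "fdist ?P (fsmul ?P c x) (fzero ?P) \<le> c * fdist ?P x (fzero ?P)"
        unfolding dist_le_iff using eq dist_ge c by (auto intro: mult_left_mono)
      show "c * fdist ?P x (fzero ?P) \<le> fdist ?P (fsmul ?P c x) (fzero ?P)"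
      proof (cases "c = 0")
        case True
        then show ?thesis using nonneg[OF smul_mem[OF x c] zero_mem] by simp
      next
        case False
        then have "fdist ?P x (fzero ?P) \<le> fdist ?P (fsmul ?P c x) (fzero ?P) / c"
          unfolding dist_le_iff[of x] using dist_ge[of _ "fsmul ?P c x" "fzero ?P"] c
          by (auto simp: field_simps eq[symmetric])
        then show ?thesis using False c by (simp add: field_simps)
      qed
    qed
  next
    fix x assume x: "\<And>k. x k \<in> carrier ?P" "\<And>k. fdist ?P (x k) (fzero ?P) \<le> (1/512) ^ k"
    have "\<exists>t. \<forall>n. t n \<in> carrier (Ss ! i) \<and> fdist (Ss ! i) (t n) (fadd (Ss ! i) (ftup (x n) ! i) (t (Suc n))) = 0 \<and>
        fdist (Ss ! i) (t n) (fzero (Ss ! i)) \<le> 4 * (1/512) ^ n" if i: "i < ?n" for i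
    proof (rule fuzzy_cone.series[OF cone_nth[OF i] mem[OF x(1) i]])
      show "fdist (Ss ! i) (ftup (x k) ! i) (fzero (Ss ! i)) \<le> (1/512) ^ k" for k
        using dist_ge[OF i, of "x k" "fzero ?P"] x(2)[of k] i by (simp add: ops)
    qed
    then have "\<forall>i. \<exists>t. i < ?n \<longrightarrow> (\<forall>n. t n \<in> carrier (Ss ! i) \<and>
        fdist (Ss ! i) (t n) (fadd (Ss ! i) (ftup (x n) ! i) (t (Suc n))) = 0 \<and>
        fdist (Ss ! i) (t n) (fzero (Ss ! i)) \<le> 4 * (1/512) ^ n)" by blast
    from choice[OF this] obtain t where t: "\<And>i n. i < ?n \<Longrightarrow> t i n \<in> carrier (Ss ! i)"
      "\<And>i n. i < ?n \<Longrightarrow> fdist (Ss ! i) (t i n) (fadd (Ss ! i) (ftup (x n) ! i) (t i (Suc n))) = 0"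
      "\<And>i n. i < ?n \<Longrightarrow> fdist (Ss ! i) (t i n) (fzero (Ss ! i)) \<le> 4 * (1/512) ^ n" by blast
    define s where "s n = FTup (map (\<lambda>i. t i n) [0..<?n])" for n
    have "s n \<in> carrier ?P" for n unfolding s_def using t(1) by (intro memI)
    moreover have "fdist ?P (s n) (fadd ?P (x n) (s (Suc n))) = 0" for n
      by (rule dist_0) (simp add: s_def ops t(2))
    moreover have "fdist ?P (s n) (fzero ?P) \<le> 4 * (1/512) ^ n" for n
      unfolding dist_le_iff using t(3) by (simp add: s_def ops)
    ultimately show "\<exists>t. \<forall>n. t n \<in> carrier ?P \<and> fdist ?P (t n) (fadd ?P (x n) (t (Suc n))) = 0 \<and>
        fdist ?P (t n) (fzero ?P) \<le> 4 * (1/512) ^ n" by blast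
  qed (auto simp: zero_mem add_mem smul_mem nonneg)
qed

lemma fspace_cone_admissible: "admissible_space S \<Longrightarrow> fspace_cone S"
  unfolding admissible_space_def using fspace_cone_base fspace_cone_prod by blast

theorem theorem3p7:
  fixes S :: fspace and J :: "'j set" and A :: "'j \<Rightarrow> felem \<Rightarrow> felem"
  assumes "admissible_space S"
    and "(\<forall>j\<in>J. L_op S (A j)) \<or> (\<forall>j\<in>J. Lplus_op S (A j))"
    and "\<forall>x\<in>carrier S. \<exists>Mx. \<forall>j\<in>J. fdist S (A j x) (fzero S) \<le> Mx"
  shows "\<exists>M>0. \<forall>j\<in>J. opnorm S (A j) \<le> M"
proof -
  interpret fuzzy_cone "carrier S" "fadd S" "fsmul S" "fdist S" "fzero S"
    using fspace_cone_admissible[OF assms(1)] by (simp add: fspace_cone_def)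
  \<comment> \<open>Homogeneity for all real scalars specialises to nonnegative ones, so both
    operator classes are treated at once.\<close>
  have plus: "Lplus_op S (A j)" if "j \<in> J" for j
    using assms(2) that unfolding L_op_def Lplus_op_def by blast
  then have op: "operator (A j)" if "j \<in> J" for j
    using that unfolding operator_def Lplus_op_def cont_at_def by blast
  \<comment> \<open>\<open>fnorm\<close> has zero as first argument, while the norm of the cone has
    it as second.\<close>
  have comm: "fnorm S x = fdist S x (fzero S)" if "x \<in> carrier S" for x
    unfolding fnorm_def using dist_commute that zero_mem by blast
  have "opnorm S (A j) = op_bound (A j)" if "j \<in> J" for j
    unfolding opnorm_def op_bound_def by (simp add: comm op_mem[OF op[OF that]] cong: ball_cong)
  moreover have "\<exists>M>0. \<forall>j\<in>J. op_bound (A j) \<le> M"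
    using op assms(3) by (intro uniform_boundedness) auto
  ultimately show ?thesis by simp
qed

end
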